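(* Let $U$ be any one of $\mathrm{PAI}^{\circ}$, $\mathrm{PAI}$, $\mathrm{PAI}+\alpha$. Then $\mathrm{PA}$ is not a retract of $U$, and $U$ is not a retract of $\mathrm{PA}$ (in particular, $\mathrm{PA}$ and $U$ are not bi-interpretable).
   Context: $\mathcal{L}_{\mathrm{A}}=\{+,\cdot,\mathrm{S},<,0\}$. $\mathrm{PAI}$ is the $\mathcal{L}_{\mathrm{A}}\cup\{I\}$-theory with axioms: (1) $\mathrm{PA}$ with induction for all $\mathcal{L}_{\mathrm{A}}\cup\{I\}$-formulae; (2) "$I$ is unbounded"; (3) for each $\mathcal{L}_{\mathrm{A}}$-formula $\varphi(v_1,\dots,v_n)$: for all $x_1<\dots<x_n$ and $y_1<\dots<y_n$ in $I$, $\varphi(\bar x)\leftrightarrow\varphi(\bar y)$. $\mathrm{PAI}^{\circ}$ is the same except that in (3) the equivalence is required only when also $\ulcorner\varphi\urcorner<x_1$ and $\ulcorner\varphi\urcorner<y_1$. The sentence $\alpha$: for the recursive transformation of an $\mathcal{L}_{\mathrm{A}}$-formula $\varphi(\bar x)$ (built with $\neg,\vee,\exists$) into a $\Delta_0$-formula $\varphi^*(\bar x,z_1,\dots,z_k)$ given by $\varphi^*=\varphi$ for atomic $\varphi$, $(\neg\varphi)^*=\neg\varphi^*$, $(\varphi_1\vee\varphi_2)^*=\varphi_1^*\vee\varphi_2^*$, $(\exists y\,\varphi)^*=\exists y<z_1\,\widetilde{\varphi^*}$ (where $\varphi^*=\varphi^*(\bar x,y,z_1,\dots,z_k)$ and $\widetilde{\varphi^*}$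 replaces each $z_i$ by $z_{i+1}$), let $\sigma(x)$ express: $x=\langle\varphi,\bar a\rangle$ and, with $j$ the least element of $I$ exceeding $\ulcorner\varphi\urcorner$ and all $a_s$ and $i_1<\dots<i_k$ the next $k$ elements of $I$ above $j$, $\varphi^*(\bar a,i_1,\dots,i_k)$ holds according to the canonical $\Sigma_1$ satisfaction predicate for $\Delta_0$-formulae. $\alpha$ says "the set defined by $\sigma$ satisfies Tarski's satisfaction clauses for all $\mathcal{L}_{\mathrm{A}}$-formulae of the model". An interpretation $\mathcal{I}$ of $U$ in $V$ is given by a domain formula and translations of $U$-predicates into $V$-formulae such that $V$ proves the translations of all axioms of $U$; it yields uniformly a model $\mathcal{I}(\mathcal{M})\models U$ for each $\mathcal{M}\models V$. $U$ is a retract of $V$ if there are interpretations $\mathcal{I}$ of $U$ in $V$ and $\mathcal{J}$ of $V$ in $U$ and a formula $F$ of $U$'s language such that, provably in $U$ (equivalently, in every $\mathcal{M}\models U$), $F$ defines an isomorphism from $\mathcal{M}$ onto $\mathcal{I}(\mathcal{J}(\mathcal{M}))$. $U$ and $V$ are bi-interpretable if in addition there is a formula $G$ of $V$'s language defining, in every $\mathcal{N}\models V$, an isomorphism from $\mathcal{N}$ onto $\mathcal{J}(\mathcal{I}(\mathcal{N}))$. *)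

theory Defs
  imports "HOL-Library.Nat_Bijection"
begin

section \<open>Syntax of the languages of \<open>PA\<close> and \<open>PAI\<close>\<close>

text \<open>One datatype serves both languages; the formulas of the language of arithmetic are those
  without \<^term>\<open>Ind\<close>, the predicate I. Variables are de Bruijn indices: \<open>Ex\<close> binds
  the index 0 of its body, and a formula whose free indices are below n is a formula in the
  n free variables 0, ..., n - 1.\<close>

datatype tm = Var nat | Zero | Succ tm | Plus tm tm | Times tm tm

datatype fm = Eq tm tm | Lt tm tm | Ind tm | Neg fm | Or fm fm | Ex fm

datatype lang = LA | LAI

abbreviation And :: "fm \<Rightarrow> fm \<Rightarrow> fm" where "And p q \<equiv> Neg (Or (Neg p) (Neg q))"
abbreviation Imp :: "fm \<Rightarrow> fm \<Rightarrow> fm" where "Imp p q \<equiv> Or (Neg p) q"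
abbreviation Iff :: "fm \<Rightarrow> fm \<Rightarrow> fm" where "Iff p q \<equiv> And (Imp p q) (Imp q p)"
abbreviation All :: "fm \<Rightarrow> fm" where "All p \<equiv> Neg (Ex (Neg p))"

primrec ind_free :: "fm \<Rightarrow> bool" where
  "ind_free (Eq s t) = True"
| "ind_free (Lt s t) = True"
| "ind_free (Ind t) = False"
| "ind_free (Neg p) = ind_free p"
| "ind_free (Or p q) = (ind_free p \<and> ind_free q)"
| "ind_free (Ex p) = ind_free p"

definition in_lang :: "lang \<Rightarrow> fm \<Rightarrow> bool" where
  "in_lang L p \<longleftrightarrow> (L = LA \<longrightarrow> ind_free p)"

text \<open>\<open>fbound p\<close> is the least n such that all free indices of p are below n.\<close>

primrec tbound :: "tm \<Rightarrow> nat" where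
  "tbound (Var i) = Suc i"
| "tbound Zero = 0"
| "tbound (Succ t) = tbound t"
| "tbound (Plus s t) = max (tbound s) (tbound t)"
| "tbound (Times s t) = max (tbound s) (tbound t)"

primrec fbound :: "fm \<Rightarrow> nat" where
  "fbound (Eq s t) = max (tbound s) (tbound t)"
| "fbound (Lt s t) = max (tbound s) (tbound t)"
| "fbound (Ind t) = tbound t"
| "fbound (Neg p) = fbound p"
| "fbound (Or p q) = max (fbound p) (fbound q)"
| "fbound (Ex p) = fbound p - 1"

primrec tsub :: "(nat \<Rightarrow> tm) \<Rightarrow> tm \<Rightarrow> tm" where
  "tsub f (Var i) = f i"
| "tsub f Zero = Zero"
| "tsub f (Succ t) = Succ (tsub f t)"
| "tsub f (Plus s t) = Plus (tsub f s) (tsub f t)"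
| "tsub f (Times s t) = Times (tsub f s) (tsub f t)"

definition under_binder :: "(nat \<Rightarrow> tm) \<Rightarrow> nat \<Rightarrow> tm" where
  "under_binder f = case_nat (Var 0) (\<lambda>i. tsub (\<lambda>j. Var (Suc j)) (f i))"

primrec fsub :: "(nat \<Rightarrow> tm) \<Rightarrow> fm \<Rightarrow> fm" where
  "fsub f (Eq s t) = Eq (tsub f s) (tsub f t)"
| "fsub f (Lt s t) = Lt (tsub f s) (tsub f t)"
| "fsub f (Ind t) = Ind (tsub f t)"
| "fsub f (Neg p) = Neg (fsub f p)"
| "fsub f (Or p q) = Or (fsub f p) (fsub f q)"
| "fsub f (Ex p) = Ex (fsub (under_binder f) p)"

definition lift :: "fm \<Rightarrow> fm" where
  "lift p = fsub (\<lambda>i. Var (Suc i)) p"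

definition inst :: "tm \<Rightarrow> fm \<Rightarrow> fm" where
  "inst t p = fsub (case_nat t Var) p"

definition univ_closure :: "fm \<Rightarrow> fm" where
  "univ_closure p = (All ^^ fbound p) p"

primrec num :: "nat \<Rightarrow> tm" where
  "num 0 = Zero"
| "num (Suc n) = Succ (num n)"

section \<open>Provability\<close>

text \<open>Classical natural deduction with equality. In \<open>ExE\<close> the index 0 is the eigenvariable.
  Derivations from an \<open>I\<close>-free theory may mention \<open>Ind\<close>; this is conservative.\<close>

inductive provable :: "fm set \<Rightarrow> fm \<Rightarrow> bool" (infix "\<turnstile>" 45) where
  Assm: "p \<in> H \<Longrightarrow> H \<turnstile> p"
| NegI: "insert p H \<turnstile> q \<Longrightarrow> insert p H \<turnstile> Neg q \<Longrightarrow> H \<turnstile> Neg p"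
| Class: "insert (Neg p) H \<turnstile> q \<Longrightarrow> insert (Neg p) H \<turnstile> Neg q \<Longrightarrow> H \<turnstile> p"
| OrI1: "H \<turnstile> p \<Longrightarrow> H \<turnstile> Or p q"
| OrI2: "H \<turnstile> q \<Longrightarrow> H \<turnstile> Or p q"
| OrE: "H \<turnstile> Or p q \<Longrightarrow> insert p H \<turnstile> r \<Longrightarrow> insert q H \<turnstile> r \<Longrightarrow> H \<turnstile> r"
| ExI: "H \<turnstile> inst t p \<Longrightarrow> H \<turnstile> Ex p"
| ExE: "H \<turnstile> Ex p \<Longrightarrow> insert p (lift ` H) \<turnstile> lift q \<Longrightarrow> H \<turnstile> q"
| Refl: "H \<turnstile> Eq t t"
| Subst: "H \<turnstile> Eq s t \<Longrightarrow> H \<turnstile> inst s p \<Longrightarrow> H \<turnstile> inst t p"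

section \<open>Writing formulas with bound names\<close>

text \<open>An expression of type \<open>fb\<close> (\<open>tb\<close>) maps the number of enclosing binders to a formula
  (term). The variable bound at depth n has index m - n - 1 at depth m; this makes it possible to
  write quantifiers with HOL binders. A closed expression becomes a sentence at depth 0.\<close>

type_synonym tb = "nat \<Rightarrow> tm"
type_synonym fb = "nat \<Rightarrow> fm"

definition bZero :: tb ("\<^bold>0") where "\<^bold>0 = (\<lambda>m. Zero)"
definition bSucc :: "tb \<Rightarrow> tb" ("\<^bold>S") where "\<^bold>S t = (\<lambda>m. Succ (t m))"
definition bNum :: "nat \<Rightarrow> tb" ("\<^bold>#") where "\<^bold># k = (\<lambda>m. num k)"
definition bPlus :: "tb \<Rightarrow> tb \<Rightarrow> tb" (infixl "\<^bold>+" 65) where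
  "s \<^bold>+ t = (\<lambda>m. Plus (s m) (t m))"
definition bTimes :: "tb \<Rightarrow> tb \<Rightarrow> tb" (infixl "\<^bold>*" 70) where
  "s \<^bold>* t = (\<lambda>m. Times (s m) (t m))"
definition bEq :: "tb \<Rightarrow> tb \<Rightarrow> fb" (infix "\<^bold>=" 50) where
  "(s \<^bold>= t) = (\<lambda>m. Eq (s m) (t m))"
definition bLt :: "tb \<Rightarrow> tb \<Rightarrow> fb" (infix "\<^bold><" 50) where
  "(s \<^bold>< t) = (\<lambda>m. Lt (s m) (t m))"
definition bInd :: "tb \<Rightarrow> fb" where
  "bInd t = (\<lambda>m. Ind (t m))"
definition bNot :: "fb \<Rightarrow> fb" ("\<^bold>\<not> _" [40] 40) where
  "(\<^bold>\<not> p) = (\<lambda>m. Neg (p m))"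
definition bAnd :: "fb \<Rightarrow> fb \<Rightarrow> fb" (infixr "\<^bold>\<and>" 35) where
  "(p \<^bold>\<and> q) = (\<lambda>m. And (p m) (q m))"
definition bOr :: "fb \<Rightarrow> fb \<Rightarrow> fb" (infixr "\<^bold>\<or>" 30) where
  "(p \<^bold>\<or> q) = (\<lambda>m. Or (p m) (q m))"
definition bImp :: "fb \<Rightarrow> fb \<Rightarrow> fb" (infixr "\<^bold>\<longrightarrow>" 25) where
  "(p \<^bold>\<longrightarrow> q) = (\<lambda>m. Imp (p m) (q m))"
definition bIff :: "fb \<Rightarrow> fb \<Rightarrow> fb" (infixr "\<^bold>\<longleftrightarrow>" 25) where
  "(p \<^bold>\<longleftrightarrow> q) = (\<lambda>m. Iff (p m) (q m))"
definition bEx :: "(tb \<Rightarrow> fb) \<Rightarrow> fb" (binder "\<^bold>\<exists>" 10) where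
  "bEx P = (\<lambda>n. Ex (P (\<lambda>m. Var (m - Suc n)) (Suc n)))"
definition bAll :: "(tb \<Rightarrow> fb) \<Rightarrow> fb" (binder "\<^bold>\<forall>" 10) where
  "bAll P = (\<lambda>n. All (P (\<lambda>m. Var (m - Suc n)) (Suc n)))"

text \<open>\<open>p\<lblot>ss\<rblot>\<close> puts ss ! i for the free index i of p; it is meant for \<open>fbound p \<le> length ss\<close>.\<close>

definition app :: "fm \<Rightarrow> tb list \<Rightarrow> fb" ("_\<lblot>_\<rblot>" [1000, 0] 1000) where
  "p\<lblot>ss\<rblot> = (\<lambda>m. fsub (\<lambda>i. (ss ! i) m) p)"

section \<open>Interpretations, retracts, bi-interpretability\<close>

record thy =
  language :: lang
  axms :: "fm set"

text \<open>A function symbol is interpreted through its graph, the value being the last argument, and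
  equality by a formula \<open>eqv\<close>, so that the interpreted model is the quotient of the domain by
  \<open>eqv\<close>. The component \<open>ind_rel\<close> is irrelevant when the interpreted theory is in \<^term>\<open>LA\<close>.\<close>

record interp =
  domain :: fm
  eqv :: fm
  zero_gr :: fm
  succ_gr :: fm
  plus_gr :: fm
  times_gr :: fm
  less_rel :: fm
  ind_rel :: fm

text \<open>\<open>trt K e t x\<close> is the translation of \<open>t = x\<close>, where e gives the names of the free variables
  of t.\<close>

primrec trt :: "interp \<Rightarrow> (nat \<Rightarrow> tb) \<Rightarrow> tm \<Rightarrow> tb \<Rightarrow> fb" where
  "trt K e (Var i) = (\<lambda>x. (eqv K)\<lblot>[e i, x]\<rblot>)"
| "trt K e Zero = (\<lambda>x. (zero_gr K)\<lblot>[x]\<rblot>)"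
| "trt K e (Succ t) =
    (\<lambda>x. \<^bold>\<exists>y. (domain K)\<lblot>[y]\<rblot> \<^bold>\<and> trt K e t y \<^bold>\<and> (succ_gr K)\<lblot>[y, x]\<rblot>)"
| "trt K e (Plus s t) =
    (\<lambda>x. \<^bold>\<exists>y z. (domain K)\<lblot>[y]\<rblot> \<^bold>\<and> (domain K)\<lblot>[z]\<rblot> \<^bold>\<and> trt K e s y \<^bold>\<and> trt K e t z \<^bold>\<and> (plus_gr K)\<lblot>[y, z, x]\<rblot>)"
| "trt K e (Times s t) =
    (\<lambda>x. \<^bold>\<exists>y z. (domain K)\<lblot>[y]\<rblot> \<^bold>\<and> (domain K)\<lblot>[z]\<rblot> \<^bold>\<and> trt K e s y \<^bold>\<and> trt K e t z \<^bold>\<and> (times_gr K)\<lblot>[y, z, x]\<rblot>)"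

primrec trf :: "interp \<Rightarrow> (nat \<Rightarrow> tb) \<Rightarrow> fm \<Rightarrow> fb" where
  "trf K e (Eq s t) = (\<^bold>\<exists>x. (domain K)\<lblot>[x]\<rblot> \<^bold>\<and> trt K e s x \<^bold>\<and> trt K e t x)"
| "trf K e (Lt s t) =
    (\<^bold>\<exists>x y. (domain K)\<lblot>[x]\<rblot> \<^bold>\<and> (domain K)\<lblot>[y]\<rblot> \<^bold>\<and> trt K e s x \<^bold>\<and> trt K e t y \<^bold>\<and> (less_rel K)\<lblot>[x, y]\<rblot>)"
| "trf K e (Ind t) = (\<^bold>\<exists>x. (domain K)\<lblot>[x]\<rblot> \<^bold>\<and> trt K e t x \<^bold>\<and> (ind_rel K)\<lblot>[x]\<rblot>)"
| "trf K e (Neg p) = (\<^bold>\<not> trf K e p)"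
| "trf K e (Or p q) = (trf K e p \<^bold>\<or> trf K e q)"
| "trf K e (Ex p) = (\<^bold>\<exists>x. (domain K)\<lblot>[x]\<rblot> \<^bold>\<and> trf K (case_nat x e) p)"

text \<open>The free index i of a formula has index m + i at depth m.\<close>

definition tr :: "interp \<Rightarrow> fm \<Rightarrow> fm" where
  "tr K p = trf K (\<lambda>i m. Var (m + i)) p 0"

definition interp_in :: "lang \<Rightarrow> lang \<Rightarrow> interp \<Rightarrow> bool" where
  "interp_in L L' K \<longleftrightarrow>
     (\<forall>(p, n) \<in> {(domain K, 1), (eqv K, 2), (zero_gr K, 1), (succ_gr K, 2), (plus_gr K, 3), (times_gr K, 3), (less_rel K, 2)}
        \<union> (if L = LAI then {(ind_rel K, 1)} else {}). in_lang L' p \<and> fbound p \<le> n)"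

text \<open>The translations of the axioms of logic with equality and function symbols, which are axioms
  of every theory.\<close>

definition logical_conditions :: "lang \<Rightarrow> interp \<Rightarrow> fm set" where
  "logical_conditions L K = (\<lambda>p. p 0) ` (
    { \<^bold>\<exists>x. (domain K)\<lblot>[x]\<rblot>,
      \<^bold>\<forall>x. (domain K)\<lblot>[x]\<rblot> \<^bold>\<longrightarrow> (eqv K)\<lblot>[x, x]\<rblot>,
      \<^bold>\<forall>x y. (domain K)\<lblot>[x]\<rblot> \<^bold>\<and> (domain K)\<lblot>[y]\<rblot> \<^bold>\<and> (eqv K)\<lblot>[x, y]\<rblot> \<^bold>\<longrightarrow> (eqv K)\<lblot>[y, x]\<rblot>,
      \<^bold>\<forall>x y z. (domain K)\<lblot>[x]\<rblot> \<^bold>\<and> (domain K)\<lblot>[y]\<rblot> \<^bold>\<and> (domain K)\<lblot>[z]\<rblot> \<^bold>\<and> (eqv K)\<lblot>[x, y]\<rblot> \<^bold>\<and> (eqv K)\<lblot>[y, z]\<rblot>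
        \<^bold>\<longrightarrow> (eqv K)\<lblot>[x, z]\<rblot>,
      \<^bold>\<exists>x. (domain K)\<lblot>[x]\<rblot> \<^bold>\<and> (zero_gr K)\<lblot>[x]\<rblot>,
      \<^bold>\<forall>x x'. (domain K)\<lblot>[x]\<rblot> \<^bold>\<and> (domain K)\<lblot>[x']\<rblot> \<^bold>\<and> (zero_gr K)\<lblot>[x]\<rblot>
        \<^bold>\<longrightarrow> ((zero_gr K)\<lblot>[x']\<rblot> \<^bold>\<longleftrightarrow> (eqv K)\<lblot>[x, x']\<rblot>),
      \<^bold>\<forall>x x' y y'. (domain K)\<lblot>[x]\<rblot> \<^bold>\<and> (domain K)\<lblot>[x']\<rblot> \<^bold>\<and> (domain K)\<lblot>[y]\<rblot> \<^bold>\<and> (domain K)\<lblot>[y']\<rblot> \<^bold>\<and>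
        (eqv K)\<lblot>[x, x']\<rblot> \<^bold>\<and> (eqv K)\<lblot>[y, y']\<rblot> \<^bold>\<and> (less_rel K)\<lblot>[x, y]\<rblot> \<^bold>\<longrightarrow> (less_rel K)\<lblot>[x', y']\<rblot>,
      \<^bold>\<forall>x. (domain K)\<lblot>[x]\<rblot> \<^bold>\<longrightarrow> (\<^bold>\<exists>y. (domain K)\<lblot>[y]\<rblot> \<^bold>\<and> (succ_gr K)\<lblot>[x, y]\<rblot>),
      \<^bold>\<forall>x x' y y'. (domain K)\<lblot>[x]\<rblot> \<^bold>\<and> (domain K)\<lblot>[x']\<rblot> \<^bold>\<and> (domain K)\<lblot>[y]\<rblot> \<^bold>\<and> (domain K)\<lblot>[y']\<rblot> \<^bold>\<and>
        (eqv K)\<lblot>[x, x']\<rblot> \<^bold>\<and> (succ_gr K)\<lblot>[x, y]\<rblot> \<^bold>\<longrightarrow> ((succ_gr K)\<lblot>[x', y']\<rblot> \<^bold>\<longleftrightarrow> (eqv K)\<lblot>[y, y']\<rblot>) }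
    \<union> (\<Union>f \<in> {plus_gr K, times_gr K}. {
      \<^bold>\<forall>x y. (domain K)\<lblot>[x]\<rblot> \<^bold>\<and> (domain K)\<lblot>[y]\<rblot> \<^bold>\<longrightarrow> (\<^bold>\<exists>z. (domain K)\<lblot>[z]\<rblot> \<^bold>\<and> f\<lblot>[x, y, z]\<rblot>),
      \<^bold>\<forall>x x' y y' z z'. (domain K)\<lblot>[x]\<rblot> \<^bold>\<and> (domain K)\<lblot>[x']\<rblot> \<^bold>\<and> (domain K)\<lblot>[y]\<rblot> \<^bold>\<and> (domain K)\<lblot>[y']\<rblot> \<^bold>\<and>
        (domain K)\<lblot>[z]\<rblot> \<^bold>\<and> (domain K)\<lblot>[z']\<rblot> \<^bold>\<and> (eqv K)\<lblot>[x, x']\<rblot> \<^bold>\<and> (eqv K)\<lblot>[y, y']\<rblot> \<^bold>\<and> f\<lblot>[x, y, z]\<rblot>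
        \<^bold>\<longrightarrow> (f\<lblot>[x', y', z']\<rblot> \<^bold>\<longleftrightarrow> (eqv K)\<lblot>[z, z']\<rblot>) })
    \<union> (if L = LAI then {
      \<^bold>\<forall>x x'. (domain K)\<lblot>[x]\<rblot> \<^bold>\<and> (domain K)\<lblot>[x']\<rblot> \<^bold>\<and> (eqv K)\<lblot>[x, x']\<rblot> \<^bold>\<and> (ind_rel K)\<lblot>[x]\<rblot> \<^bold>\<longrightarrow> (ind_rel K)\<lblot>[x']\<rblot>
      } else {}))"

definition interpretation_of_in :: "interp \<Rightarrow> thy \<Rightarrow> thy \<Rightarrow> bool" where
  "interpretation_of_in K U V \<longleftrightarrow>
     interp_in (language U) (language V) K \<and>
     (\<forall>p \<in> logical_conditions (language U) K. axms V \<turnstile> p) \<and>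
     (\<forall>p \<in> axms U. axms V \<turnstile> tr K p)"

text \<open>\<open>icomp I J\<close> defines \<open>I(J(M))\<close> in M.\<close>

definition icomp :: "interp \<Rightarrow> interp \<Rightarrow> interp" where
  "icomp I J = \<lparr>
     domain = And (domain J) (tr J (domain I)),
     eqv = tr J (eqv I),
     zero_gr = tr J (zero_gr I),
     succ_gr = tr J (succ_gr I),
     plus_gr = tr J (plus_gr I),
     times_gr = tr J (times_gr I),
     less_rel = tr J (less_rel I),
     ind_rel = tr J (ind_rel I) \<rparr>"

text \<open>\<open>iso_sentence L K F\<close>: \<open>F(x, y)\<close> holds iff y is in the domain of K and its \<open>eqv\<close>-class is
  the image of x under an isomorphism from the model itself onto the model defined by K.\<close>

definition iso_sentence :: "lang \<Rightarrow> interp \<Rightarrow> fm \<Rightarrow> fm" where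
  "iso_sentence L K F = (
    (\<^bold>\<forall>x y. F\<lblot>[x, y]\<rblot> \<^bold>\<longrightarrow> (domain K)\<lblot>[y]\<rblot>) \<^bold>\<and>
    (\<^bold>\<forall>x. \<^bold>\<exists>y. F\<lblot>[x, y]\<rblot>) \<^bold>\<and>
    (\<^bold>\<forall>y. (domain K)\<lblot>[y]\<rblot> \<^bold>\<longrightarrow> (\<^bold>\<exists>x. F\<lblot>[x, y]\<rblot>)) \<^bold>\<and>
    (\<^bold>\<forall>x y y'. F\<lblot>[x, y]\<rblot> \<^bold>\<and> (domain K)\<lblot>[y']\<rblot> \<^bold>\<and> (eqv K)\<lblot>[y, y']\<rblot> \<^bold>\<longrightarrow> F\<lblot>[x, y']\<rblot>) \<^bold>\<and>
    (\<^bold>\<forall>x x' y y'. F\<lblot>[x, y]\<rblot> \<^bold>\<and> F\<lblot>[x', y']\<rblot> \<^bold>\<longrightarrow> (x \<^bold>= x' \<^bold>\<longleftrightarrow> (eqv K)\<lblot>[y, y']\<rblot>)) \<^bold>\<and>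
    (\<^bold>\<forall>x y. F\<lblot>[x, y]\<rblot> \<^bold>\<longrightarrow> (\<^bold>0 \<^bold>= x \<^bold>\<longleftrightarrow> (zero_gr K)\<lblot>[y]\<rblot>)) \<^bold>\<and>
    (\<^bold>\<forall>x x' y y'. F\<lblot>[x, y]\<rblot> \<^bold>\<and> F\<lblot>[x', y']\<rblot> \<^bold>\<longrightarrow> (\<^bold>S x \<^bold>= x' \<^bold>\<longleftrightarrow> (succ_gr K)\<lblot>[y, y']\<rblot>)) \<^bold>\<and>
    (\<^bold>\<forall>x x' x'' y y' y''. F\<lblot>[x, y]\<rblot> \<^bold>\<and> F\<lblot>[x', y']\<rblot> \<^bold>\<and> F\<lblot>[x'', y'']\<rblot> \<^bold>\<longrightarrow>
       (x \<^bold>+ x' \<^bold>= x'' \<^bold>\<longleftrightarrow> (plus_gr K)\<lblot>[y, y', y'']\<rblot>)) \<^bold>\<and>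
    (\<^bold>\<forall>x x' x'' y y' y''. F\<lblot>[x, y]\<rblot> \<^bold>\<and> F\<lblot>[x', y']\<rblot> \<^bold>\<and> F\<lblot>[x'', y'']\<rblot> \<^bold>\<longrightarrow>
       (x \<^bold>* x' \<^bold>= x'' \<^bold>\<longleftrightarrow> (times_gr K)\<lblot>[y, y', y'']\<rblot>)) \<^bold>\<and>
    (\<^bold>\<forall>x x' y y'. F\<lblot>[x, y]\<rblot> \<^bold>\<and> F\<lblot>[x', y']\<rblot> \<^bold>\<longrightarrow> (x \<^bold>< x' \<^bold>\<longleftrightarrow> (less_rel K)\<lblot>[y, y']\<rblot>)) \<^bold>\<and>
    (if L = LAI then \<^bold>\<forall>x y. F\<lblot>[x, y]\<rblot> \<^bold>\<longrightarrow> (bInd x \<^bold>\<longleftrightarrow> (ind_rel K)\<lblot>[y]\<rblot>) else \<^bold>0 \<^bold>= \<^bold>0)) 0"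

definition defines_iso :: "thy \<Rightarrow> interp \<Rightarrow> fm \<Rightarrow> bool" where
  "defines_iso U K F \<longleftrightarrow> in_lang (language U) F \<and> fbound F \<le> 2 \<and>
     axms U \<turnstile> iso_sentence (language U) K F"

definition retract :: "thy \<Rightarrow> thy \<Rightarrow> bool" where
  "retract U V \<longleftrightarrow> (\<exists>I J F.
     interpretation_of_in I U V \<and> interpretation_of_in J V U \<and> defines_iso U (icomp I J) F)"

definition bi_interpretable :: "thy \<Rightarrow> thy \<Rightarrow> bool" where
  "bi_interpretable U V \<longleftrightarrow> (\<exists>I J F G.
     interpretation_of_in I U V \<and> interpretation_of_in J V U \<and>
     defines_iso U (icomp I J) F \<and> defines_iso V (icomp J I) G)"

section \<open>The theories \<open>PA\<close>, \<open>PAI\<close> and \<open>PAI\<close> with diagonal indiscernibles\<close>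

definition induction :: "fm \<Rightarrow> fm" where
  "induction p = univ_closure
     (Imp (And (inst Zero p)
               (All (Imp p (fsub (case_nat (Succ (Var 0)) (\<lambda>i. Var (Suc i))) p))))
          (All p))"

definition PA_axioms :: "lang \<Rightarrow> fm set" where
  "PA_axioms L = (\<lambda>p. p 0) `
     { \<^bold>\<forall>x. \<^bold>\<not> \<^bold>S x \<^bold>= \<^bold>0,
       \<^bold>\<forall>x y. \<^bold>S x \<^bold>= \<^bold>S y \<^bold>\<longrightarrow> x \<^bold>= y,
       \<^bold>\<forall>x. x \<^bold>+ \<^bold>0 \<^bold>= x,
       \<^bold>\<forall>x y. x \<^bold>+ \<^bold>S y \<^bold>= \<^bold>S (x \<^bold>+ y),
       \<^bold>\<forall>x. x \<^bold>* \<^bold>0 \<^bold>= \<^bold>0,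
       \<^bold>\<forall>x y. x \<^bold>* \<^bold>S y \<^bold>= x \<^bold>* y \<^bold>+ x,
       \<^bold>\<forall>x y. x \<^bold>< y \<^bold>\<longleftrightarrow> (\<^bold>\<exists>z. x \<^bold>+ \<^bold>S z \<^bold>= y) }
     \<union> {induction p | p. in_lang L p}"

definition ind_unbounded :: fm where
  "ind_unbounded = (\<^bold>\<forall>x. \<^bold>\<exists>y. x \<^bold>< y \<^bold>\<and> bInd y) 0"

fun conj_list :: "fm list \<Rightarrow> fm" where
  "conj_list [] = Eq Zero Zero"
| "conj_list (p # ps) = And p (conj_list ps)"

text \<open>The indices k, ..., k + n - 1 denote an increasing n-tuple of elements of I.\<close>

definition increasing :: "nat \<Rightarrow> nat \<Rightarrow> fm" where
  "increasing k n = And (conj_list [Ind (Var (k + i)). i \<leftarrow> [0..<n]])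
                        (conj_list [Lt (Var (k + i)) (Var (k + Suc i)). i \<leftarrow> [0..<n - 1]])"

text \<open>Indiscernibility for p in n free variables: the indices 0, ..., n - 1 denote the first and
  the indices n, ..., 2n - 1 the second tuple.\<close>

definition indisc :: "nat \<Rightarrow> fm \<Rightarrow> fm" where
  "indisc n p = (All ^^ (2 * n))
     (Imp (And (increasing 0 n) (increasing n n)) (Iff p (fsub (\<lambda>i. Var (n + i)) p)))"

primrec tcode :: "tm \<Rightarrow> nat" where
  "tcode (Var i) = prod_encode (0, i)"
| "tcode Zero = prod_encode (1, 0)"
| "tcode (Succ t) = prod_encode (2, tcode t)"
| "tcode (Plus s t) = prod_encode (3, prod_encode (tcode s, tcode t))"
| "tcode (Times s t) = prod_encode (4, prod_encode (tcode s, tcode t))"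

primrec fcode :: "fm \<Rightarrow> nat" where
  "fcode (Eq s t) = prod_encode (0, prod_encode (tcode s, tcode t))"
| "fcode (Lt s t) = prod_encode (1, prod_encode (tcode s, tcode t))"
| "fcode (Neg p) = prod_encode (2, fcode p)"
| "fcode (Or p q) = prod_encode (3, prod_encode (fcode p, fcode q))"
| "fcode (Ex p) = prod_encode (4, fcode p)"
| "fcode (Ind t) = prod_encode (5, tcode t)"

definition indisc_above_code :: "nat \<Rightarrow> fm \<Rightarrow> fm" where
  "indisc_above_code n p = (All ^^ (2 * n))
     (Imp (And (And (increasing 0 n) (increasing n n))
               (And (Lt (num (fcode p)) (Var 0)) (Lt (num (fcode p)) (Var n))))
          (Iff p (fsub (\<lambda>i. Var (n + i)) p)))"

definition PA :: thy where
  "PA = \<lparr>language = LA, axms = PA_axioms LA\<rparr>"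

definition PAI :: thy where
  "PAI = \<lparr>language = LAI, axms = PA_axioms LAI \<union> {ind_unbounded} \<union>
     {indisc n p | n p. 1 \<le> n \<and> in_lang LA p \<and> fbound p \<le> n}\<rparr>"

definition PAI_circ :: thy where
  "PAI_circ = \<lparr>language = LAI, axms = PA_axioms LAI \<union> {ind_unbounded} \<union>
     {indisc_above_code n p | n p. 1 \<le> n \<and> in_lang LA p \<and> fbound p \<le> n}\<rparr>"

section \<open>Arithmetised syntax\<close>

text \<open>All formulas of this section are built from (possibly negated) atomic formulas by
  conjunction, disjunction, existential quantification and bounded universal quantification, hence
  are \<open>\<Sigma>\<^sub>1\<close> up to provable equivalence in \<open>PA\<close>. Pairs, finite sequences and syntax are coded as
  by \<^term>\<open>prod_encode\<close>, \<^term>\<open>list_encode\<close>, \<^term>\<open>tcode\<close> and \<^term>\<open>fcode\<close>.\<close>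

definition bLe :: "tb \<Rightarrow> tb \<Rightarrow> fb" (infix "\<^bold>\<le>" 50) where
  "(s \<^bold>\<le> t) = (s \<^bold>< \<^bold>S t)"

definition bNeq :: "tb \<Rightarrow> tb \<Rightarrow> fb" (infix "\<^bold>\<noteq>" 50) where
  "(s \<^bold>\<noteq> t) = (\<^bold>\<not> s \<^bold>= t)"

definition isPair :: "tb \<Rightarrow> tb \<Rightarrow> tb \<Rightarrow> fb" where
  "isPair z x y = (z \<^bold>+ z \<^bold>= (x \<^bold>+ y) \<^bold>* \<^bold>S (x \<^bold>+ y) \<^bold>+ (x \<^bold>+ x))"

definition isTag :: "nat \<Rightarrow> tb \<Rightarrow> tb \<Rightarrow> fb" where
  "isTag k z x = isPair z (\<^bold># k) x"

definition isTag2 :: "nat \<Rightarrow> tb \<Rightarrow> tb \<Rightarrow> tb \<Rightarrow> fb" where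
  "isTag2 k z x y = (\<^bold>\<exists>p. isPair p x y \<^bold>\<and> isTag k z p)"

definition isCons :: "tb \<Rightarrow> tb \<Rightarrow> tb \<Rightarrow> fb" where
  "isCons z x l = (\<^bold>\<exists>p. isPair p x l \<^bold>\<and> z \<^bold>= \<^bold>S p)"

text \<open>Goedel's beta function: x is the remainder of a modulo 1 + (i + 1)b, where s codes
  the pair of a and b.\<close>

definition isBeta :: "tb \<Rightarrow> tb \<Rightarrow> tb \<Rightarrow> fb" where
  "isBeta s i x = (\<^bold>\<exists>a b q. isPair s a b \<^bold>\<and> a \<^bold>= q \<^bold>* \<^bold>S (\<^bold>S i \<^bold>* b) \<^bold>+ x \<^bold>\<and> x \<^bold>< \<^bold>S (\<^bold>S i \<^bold>* b))"

text \<open>The sequence l has at least n entries, and r is what is left after removing the first n.\<close>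

definition isDrop :: "tb \<Rightarrow> tb \<Rightarrow> tb \<Rightarrow> fb" where
  "isDrop l n r = (\<^bold>\<exists>s. isBeta s \<^bold>0 l \<^bold>\<and> isBeta s n r \<^bold>\<and>
     (\<^bold>\<forall>i. i \<^bold>< n \<^bold>\<longrightarrow> (\<^bold>\<exists>u x v. isBeta s i u \<^bold>\<and> isBeta s (\<^bold>S i) v \<^bold>\<and> isCons u x v)))"

definition isLength :: "tb \<Rightarrow> tb \<Rightarrow> fb" where
  "isLength l n = isDrop l n \<^bold>0"

definition isNth :: "tb \<Rightarrow> tb \<Rightarrow> tb \<Rightarrow> fb" where
  "isNth l i x = (\<^bold>\<exists>r r'. isDrop l i r \<^bold>\<and> isCons r x r')"

definition isMem :: "tb \<Rightarrow> tb \<Rightarrow> fb" where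
  "isMem x l = (\<^bold>\<exists>i. isNth l i x)"

definition allMem :: "tb \<Rightarrow> (tb \<Rightarrow> fb) \<Rightarrow> fb" where
  "allMem l P = (\<^bold>\<exists>n. isLength l n \<^bold>\<and> (\<^bold>\<forall>i. i \<^bold>< n \<^bold>\<longrightarrow> (\<^bold>\<exists>x. isNth l i x \<^bold>\<and> P x)))"

definition isAppend :: "tb \<Rightarrow> tb \<Rightarrow> tb \<Rightarrow> fb" where
  "isAppend a b c = (\<^bold>\<exists>n. isLength a n \<^bold>\<and> isDrop c n b \<^bold>\<and>
     (\<^bold>\<forall>i. i \<^bold>< n \<^bold>\<longrightarrow> (\<^bold>\<exists>x. isNth a i x \<^bold>\<and> isNth c i x)))"

text \<open>In the recursive definitions below, s is a finite sequence that contains the pair or tuple in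
  question and in which each entry is justified by the clause for its outermost constructor, by
  way of other entries of s. No ordering of s is needed since codes of proper parts are smaller.\<close>

definition memPair :: "tb \<Rightarrow> tb \<Rightarrow> tb \<Rightarrow> fb" where
  "memPair x y s = (\<^bold>\<exists>p. isPair p x y \<^bold>\<and> isMem p s)"

definition isTriple :: "tb \<Rightarrow> tb \<Rightarrow> tb \<Rightarrow> tb \<Rightarrow> fb" where
  "isTriple z x y w = (\<^bold>\<exists>p. isPair p y w \<^bold>\<and> isPair z x p)"

definition memTriple :: "tb \<Rightarrow> tb \<Rightarrow> tb \<Rightarrow> tb \<Rightarrow> fb" where
  "memTriple x y w s = (\<^bold>\<exists>p. isTriple p x y w \<^bold>\<and> isMem p s)"

text \<open>t is a term with variables below n.\<close>

definition isTerm :: "tb \<Rightarrow> tb \<Rightarrow> fb" where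
  "isTerm n t = (\<^bold>\<exists>s. isMem t s \<^bold>\<and> allMem s (\<lambda>x.
     (\<^bold>\<exists>i. i \<^bold>< n \<^bold>\<and> isTag 0 x i) \<^bold>\<or>
     isTag 1 x \<^bold>0 \<^bold>\<or>
     (\<^bold>\<exists>u. isMem u s \<^bold>\<and> isTag 2 x u) \<^bold>\<or>
     (\<^bold>\<exists>u v. isMem u s \<^bold>\<and> isMem v s \<^bold>\<and> (isTag2 3 x u v \<^bold>\<or> isTag2 4 x u v))))"

text \<open>f is a formula of the language of arithmetic with free variables below n.\<close>

definition isForm :: "tb \<Rightarrow> tb \<Rightarrow> fb" where
  "isForm n f = (\<^bold>\<exists>s. memPair n f s \<^bold>\<and> allMem s (\<lambda>x. \<^bold>\<exists>m g. isPair x m g \<^bold>\<and> (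
     (\<^bold>\<exists>t u. isTerm m t \<^bold>\<and> isTerm m u \<^bold>\<and> (isTag2 0 g t u \<^bold>\<or> isTag2 1 g t u)) \<^bold>\<or>
     (\<^bold>\<exists>h. memPair m h s \<^bold>\<and> isTag 2 g h) \<^bold>\<or>
     (\<^bold>\<exists>h k. memPair m h s \<^bold>\<and> memPair m k s \<^bold>\<and> isTag2 3 g h k) \<^bold>\<or>
     (\<^bold>\<exists>h. memPair (\<^bold>S m) h s \<^bold>\<and> isTag 4 g h))))"

text \<open>t' arises from the term t, and g' from the formula g, by raising the free indices that are at
  least c by one. In \<open>isShift\<close> the entries of s are triples since c grows under quantifiers.\<close>

definition isShiftTerm :: "tb \<Rightarrow> tb \<Rightarrow> tb \<Rightarrow> fb" where
  "isShiftTerm c t t' = (\<^bold>\<exists>s. memPair t t' s \<^bold>\<and> allMem s (\<lambda>x. \<^bold>\<exists>u u'. isPair x u u' \<^bold>\<and> (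
     (\<^bold>\<exists>i. isTag 0 u i \<^bold>\<and> (i \<^bold>< c \<^bold>\<and> u' \<^bold>= u \<^bold>\<or> c \<^bold>\<le> i \<^bold>\<and> isTag 0 u' (\<^bold>S i))) \<^bold>\<or>
     isTag 1 u \<^bold>0 \<^bold>\<and> u' \<^bold>= u \<^bold>\<or>
     (\<^bold>\<exists>v v'. memPair v v' s \<^bold>\<and> isTag 2 u v \<^bold>\<and> isTag 2 u' v') \<^bold>\<or>
     (\<^bold>\<exists>v v' w w'. memPair v v' s \<^bold>\<and> memPair w w' s \<^bold>\<and>
        (isTag2 3 u v w \<^bold>\<and> isTag2 3 u' v' w' \<^bold>\<or> isTag2 4 u v w \<^bold>\<and> isTag2 4 u' v' w')))))"

definition isShift :: "tb \<Rightarrow> tb \<Rightarrow> tb \<Rightarrow> fb" where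
  "isShift c g g' = (\<^bold>\<exists>s. memTriple c g g' s \<^bold>\<and> allMem s (\<lambda>x. \<^bold>\<exists>d f f'. isTriple x d f f' \<^bold>\<and> (
     (\<^bold>\<exists>t t' u u'. isShiftTerm d t t' \<^bold>\<and> isShiftTerm d u u' \<^bold>\<and>
        (isTag2 0 f t u \<^bold>\<and> isTag2 0 f' t' u' \<^bold>\<or> isTag2 1 f t u \<^bold>\<and> isTag2 1 f' t' u')) \<^bold>\<or>
     (\<^bold>\<exists>h h'. memTriple d h h' s \<^bold>\<and> isTag 2 f h \<^bold>\<and> isTag 2 f' h') \<^bold>\<or>
     (\<^bold>\<exists>h h' k k'. memTriple d h h' s \<^bold>\<and> memTriple d k k' s \<^bold>\<and> isTag2 3 f h k \<^bold>\<and> isTag2 3 f' h' k') \<^bold>\<or>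
     (\<^bold>\<exists>h h'. memTriple (\<^bold>S d) h h' s \<^bold>\<and> isTag 4 f h \<^bold>\<and> isTag 4 f' h'))))"

definition isConj :: "tb \<Rightarrow> tb \<Rightarrow> tb \<Rightarrow> fb" where
  "isConj z p q = (\<^bold>\<exists>p' q' r. isTag 2 p' p \<^bold>\<and> isTag 2 q' q \<^bold>\<and> isTag2 3 r p' q' \<^bold>\<and> isTag 2 z r)"

text \<open>z is the formula ``there is y < t such that h'', where t' (the term t shifted past the
  binder of y) and h are in the scope of the quantifier.\<close>

definition isBoundedEx :: "tb \<Rightarrow> tb \<Rightarrow> tb \<Rightarrow> fb" where
  "isBoundedEx z t' h = (\<^bold>\<exists>y b c. isTag 0 y \<^bold>0 \<^bold>\<and> isTag2 1 b y t' \<^bold>\<and> isConj c b h \<^bold>\<and> isTag 4 z c)"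

text \<open>g is the transform \<open>\<phi>\<^sup>*(x\<^sub>1, ..., x\<^sub>n, z\<^sub>1, ..., z\<^sub>k)\<close> of the formula f in n
  free variables. The variables \<open>x\<^sub>1, ..., x\<^sub>n\<close> are the indices 0, ..., n - 1 and \<open>z\<^sub>i\<close> is the
  index n + i - 1. In the last clause, for f the formula ``there is y such that h'', the body h
  has n + 1 free variables, so in its transform h' the variable \<open>z\<^sub>i\<close> is n + i; shifting from n + 1
  on replaces \<open>z\<^sub>i\<close> by \<open>z\<^sub>i\<^sub>+\<^sub>1\<close>, and makes n + 1 the new \<open>z\<^sub>1\<close> in the scope of y.\<close>

definition isStar :: "tb \<Rightarrow> tb \<Rightarrow> tb \<Rightarrow> tb \<Rightarrow> fb" where
  "isStar n f g k = (
     let tuple = (\<lambda>z n f g k. \<^bold>\<exists>p. isPair p g k \<^bold>\<and> isTriple z n f p);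
         memTuple = (\<lambda>n f g k s. \<^bold>\<exists>z. tuple z n f g k \<^bold>\<and> isMem z s)
     in \<^bold>\<exists>s. memTuple n f g k s \<^bold>\<and> allMem s (\<lambda>x. \<^bold>\<exists>n f g k. tuple x n f g k \<^bold>\<and> (
       (\<^bold>\<exists>t u. isTag2 0 f t u \<^bold>\<or> isTag2 1 f t u) \<^bold>\<and> g \<^bold>= f \<^bold>\<and> k \<^bold>= \<^bold>0 \<^bold>\<or>
       (\<^bold>\<exists>h h'. memTuple n h h' k s \<^bold>\<and> isTag 2 f h \<^bold>\<and> isTag 2 g h') \<^bold>\<or>
       (\<^bold>\<exists>h1 h1' k1 h2 h2' k2. memTuple n h1 h1' k1 s \<^bold>\<and> memTuple n h2 h2' k2 s \<^bold>\<and>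
          isTag2 3 f h1 h2 \<^bold>\<and> isTag2 3 g h1' h2' \<^bold>\<and>
          (k1 \<^bold>\<le> k2 \<^bold>\<and> k \<^bold>= k2 \<^bold>\<or> k2 \<^bold>\<le> k1 \<^bold>\<and> k \<^bold>= k1)) \<^bold>\<or>
       (\<^bold>\<exists>h h' h'' z k'. memTuple (\<^bold>S n) h h' k' s \<^bold>\<and> isTag 4 f h \<^bold>\<and>
          isShift (\<^bold>S n) h' h'' \<^bold>\<and> isTag 0 z (\<^bold>S n) \<^bold>\<and> isBoundedEx g z h'' \<^bold>\<and> k \<^bold>= \<^bold>S k'))))"

text \<open>v is the value of the term t when the index i is given the entry i of the sequence a.\<close>

definition isVal :: "tb \<Rightarrow> tb \<Rightarrow> tb \<Rightarrow> fb" where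
  "isVal t a v = (\<^bold>\<exists>s. memPair t v s \<^bold>\<and> allMem s (\<lambda>x. \<^bold>\<exists>u w. isPair x u w \<^bold>\<and> (
     (\<^bold>\<exists>i. isTag 0 u i \<^bold>\<and> isNth a i w) \<^bold>\<or>
     isTag 1 u \<^bold>0 \<^bold>\<and> w \<^bold>= \<^bold>0 \<^bold>\<or>
     (\<^bold>\<exists>u1 w1. memPair u1 w1 s \<^bold>\<and> isTag 2 u u1 \<^bold>\<and> w \<^bold>= \<^bold>S w1) \<^bold>\<or>
     (\<^bold>\<exists>u1 w1 u2 w2. memPair u1 w1 s \<^bold>\<and> memPair u2 w2 s \<^bold>\<and>
        (isTag2 3 u u1 u2 \<^bold>\<and> w \<^bold>= w1 \<^bold>+ w2 \<^bold>\<or> isTag2 4 u u1 u2 \<^bold>\<and> w \<^bold>= w1 \<^bold>* w2)))))"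

text \<open>The satisfaction predicate for \<open>\<Delta>\<^sub>0\<close>-formulas: some finite sequence s of triples (g, b, e), each
  recording that g is true (e = 1) or false (e = 0) under b, is correct according to Tarski's clauses
  and contains (f, a, 1).\<close>

definition satDelta0 :: "tb \<Rightarrow> tb \<Rightarrow> fb" where
  "satDelta0 f a = (\<^bold>\<exists>s. memTriple f a (\<^bold># 1) s \<^bold>\<and> allMem s (\<lambda>x. \<^bold>\<exists>g b e. isTriple x g b e \<^bold>\<and> (
     (\<^bold>\<exists>t u v w. isTag2 0 g t u \<^bold>\<and> isVal t b v \<^bold>\<and> isVal u b w \<^bold>\<and>
        (e \<^bold>= \<^bold># 1 \<^bold>\<and> v \<^bold>= w \<^bold>\<or> e \<^bold>= \<^bold>0 \<^bold>\<and> v \<^bold>\<noteq> w)) \<^bold>\<or>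
     (\<^bold>\<exists>t u v w. isTag2 1 g t u \<^bold>\<and> isVal t b v \<^bold>\<and> isVal u b w \<^bold>\<and>
        (e \<^bold>= \<^bold># 1 \<^bold>\<and> v \<^bold>< w \<^bold>\<or> e \<^bold>= \<^bold>0 \<^bold>\<and> w \<^bold>\<le> v)) \<^bold>\<or>
     (\<^bold>\<exists>h. isTag 2 g h \<^bold>\<and>
        (e \<^bold>= \<^bold># 1 \<^bold>\<and> memTriple h b \<^bold>0 s \<^bold>\<or> e \<^bold>= \<^bold>0 \<^bold>\<and> memTriple h b (\<^bold># 1) s)) \<^bold>\<or>
     (\<^bold>\<exists>h k. isTag2 3 g h k \<^bold>\<and>
        (e \<^bold>= \<^bold># 1 \<^bold>\<and> (memTriple h b (\<^bold># 1) s \<^bold>\<or> memTriple k b (\<^bold># 1) s) \<^bold>\<or>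
         e \<^bold>= \<^bold>0 \<^bold>\<and> memTriple h b \<^bold>0 s \<^bold>\<and> memTriple k b \<^bold>0 s)) \<^bold>\<or>
     (\<^bold>\<exists>t t' h v. isShiftTerm \<^bold>0 t t' \<^bold>\<and> isBoundedEx g t' h \<^bold>\<and> isVal t b v \<^bold>\<and>
        (e \<^bold>= \<^bold># 1 \<^bold>\<and> (\<^bold>\<exists>y c. y \<^bold>< v \<^bold>\<and> isCons c y b \<^bold>\<and> memTriple h c (\<^bold># 1) s) \<^bold>\<or>
         e \<^bold>= \<^bold>0 \<^bold>\<and> (\<^bold>\<forall>y. y \<^bold>< v \<^bold>\<longrightarrow> (\<^bold>\<exists>c. isCons c y b \<^bold>\<and> memTriple h c \<^bold>0 s)))))))"

section \<open>The sentence \<open>\<alpha>\<close>\<close>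

text \<open>\<open>\<phi>(x\<^sub>1, ..., x\<^sub>n)\<close> stands for a formula with free variables among \<open>x\<^sub>1, ..., x\<^sub>n\<close>, so the
  sequence a may assign values to variables that do not occur.\<close>

definition isAbove :: "tb \<Rightarrow> tb \<Rightarrow> tb \<Rightarrow> fb" where
  "isAbove f a j = (f \<^bold>< j \<^bold>\<and> allMem a (\<lambda>x. x \<^bold>< j))"

definition isNextInd :: "tb \<Rightarrow> tb \<Rightarrow> fb" where
  "isNextInd u v = (u \<^bold>< v \<^bold>\<and> bInd v \<^bold>\<and> (\<^bold>\<forall>w. u \<^bold>< w \<^bold>\<and> w \<^bold>< v \<^bold>\<longrightarrow> \<^bold>\<not> bInd w))"

definition sigma :: "tb \<Rightarrow> fb" where
  "sigma x = (\<^bold>\<exists>f a n. isPair x f a \<^bold>\<and> isLength a n \<^bold>\<and> isForm n f \<^bold>\<and>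
     (\<^bold>\<exists>j. bInd j \<^bold>\<and> isAbove f a j \<^bold>\<and> (\<^bold>\<forall>w. w \<^bold>< j \<^bold>\<and> bInd w \<^bold>\<longrightarrow> \<^bold>\<not> isAbove f a w) \<^bold>\<and>
     (\<^bold>\<exists>g k l jl c. isStar n f g k \<^bold>\<and>
        isLength l k \<^bold>\<and> isCons jl j l \<^bold>\<and>
        (\<^bold>\<forall>i. i \<^bold>< k \<^bold>\<longrightarrow> (\<^bold>\<exists>u v. isNth jl i u \<^bold>\<and> isNth jl (\<^bold>S i) v \<^bold>\<and> isNextInd u v)) \<^bold>\<and>
        isAppend a l c \<^bold>\<and> satDelta0 g c)))"

definition sat :: "tb \<Rightarrow> tb \<Rightarrow> fb" where
  "sat f a = (\<^bold>\<exists>x. isPair x f a \<^bold>\<and> sigma x)"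

definition alpha :: fm where
  "alpha = (\<^bold>\<forall>f a n. isLength a n \<^bold>\<and> isForm n f \<^bold>\<longrightarrow>
     (\<^bold>\<forall>t u. isTag2 0 f t u \<^bold>\<longrightarrow> (sat f a \<^bold>\<longleftrightarrow> (\<^bold>\<exists>v w. isVal t a v \<^bold>\<and> isVal u a w \<^bold>\<and> v \<^bold>= w))) \<^bold>\<and>
     (\<^bold>\<forall>t u. isTag2 1 f t u \<^bold>\<longrightarrow> (sat f a \<^bold>\<longleftrightarrow> (\<^bold>\<exists>v w. isVal t a v \<^bold>\<and> isVal u a w \<^bold>\<and> v \<^bold>< w))) \<^bold>\<and>
     (\<^bold>\<forall>h. isTag 2 f h \<^bold>\<longrightarrow> (sat f a \<^bold>\<longleftrightarrow> \<^bold>\<not> sat h a)) \<^bold>\<and>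
     (\<^bold>\<forall>h k. isTag2 3 f h k \<^bold>\<longrightarrow> (sat f a \<^bold>\<longleftrightarrow> sat h a \<^bold>\<or> sat k a)) \<^bold>\<and>
     (\<^bold>\<forall>h. isTag 4 f h \<^bold>\<longrightarrow> (sat f a \<^bold>\<longleftrightarrow> (\<^bold>\<exists>b c. isCons c b a \<^bold>\<and> sat h c)))) 0"

definition PAI_alpha :: thy where
  "PAI_alpha = PAI\<lparr>axms := axms PAI \<union> {alpha}\<rparr>"

end

theory Submission
  imports Defs "HOL-Library.Infinite_Set"
begin

text \<open>If K interprets a theory containing \<open>PA\<close> in a theory containing \<open>PA\<close>, then every model M of the
  latter defines, by recursion, a homomorphism h from M into the interpreted model N. If V is a retract
  of W, then the maps \<open>M \<rightarrow> N\<^sub>1 \<rightarrow> N\<^sub>2\<close> for a model M of V and the given isomorphism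
  \<open>M \<cong> N\<^sub>2\<close> agree by induction in M, so that both homomorphisms are surjective. One of them is an
  isomorphism of a model X of \<open>PA\<close> with the arithmetical part of a model Y of U that is definable in X,
  hence the predicate I of Y has a definition in Y without I. This contradicts indiscernibility, since
  then ``consecutive elements of I'' is definable too. The model M to start with is the standard model, or
  the model of U interpreted in it.\<close>

section \<open>Semantics\<close>

text \<open>Derivations enter only through soundness. Since all models needed are obtained from the
  natural numbers by passing to interpreted models, no completeness theorem is called for. A
  structure here has a whole type as its domain, whereas an interpreted model is a quotient of a
  definable set; it is therefore re-indexed by nat, along a map q from representatives to elements.
  The obstacle is that the maps between models lead out of the model in which the induction takes
  place. The map h from M to N is not an object of M; what M can define is the relation E between x
  and the representatives of h x, and every claim to be proved by induction is first restated
  through E. To have E at all, M must carry out a recursion whose steps are functional only up to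
  \<open>eqv\<close>. This needs codes in M for finite sets of pairs, hence divisibility and the
  beta function developed from the axioms. Surjectivity is shared out as follows: the composite of
  the two maps is onto, so the second one is, and as the second is also injective, the first is onto
  too.\<close>

record 'a struct =
  zeroS :: 'a
  succS :: "'a \<Rightarrow> 'a"
  plusS :: "'a \<Rightarrow> 'a \<Rightarrow> 'a"
  timesS :: "'a \<Rightarrow> 'a \<Rightarrow> 'a"
  lessS :: "'a \<Rightarrow> 'a \<Rightarrow> bool"
  indS :: "'a \<Rightarrow> bool"

primrec tval :: "'a struct \<Rightarrow> (nat \<Rightarrow> 'a) \<Rightarrow> tm \<Rightarrow> 'a" where
  "tval M \<rho> (Var i) = \<rho> i"
| "tval M \<rho> Zero = zeroS M"
| "tval M \<rho> (Succ t) = succS M (tval M \<rho> t)"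
| "tval M \<rho> (Plus s t) = plusS M (tval M \<rho> s) (tval M \<rho> t)"
| "tval M \<rho> (Times s t) = timesS M (tval M \<rho> s) (tval M \<rho> t)"

primrec sem :: "'a struct \<Rightarrow> (nat \<Rightarrow> 'a) \<Rightarrow> fm \<Rightarrow> bool" where
  "sem M \<rho> (Eq s t) \<longleftrightarrow> tval M \<rho> s = tval M \<rho> t"
| "sem M \<rho> (Lt s t) \<longleftrightarrow> lessS M (tval M \<rho> s) (tval M \<rho> t)"
| "sem M \<rho> (Ind t) \<longleftrightarrow> indS M (tval M \<rho> t)"
| "sem M \<rho> (Neg p) \<longleftrightarrow> \<not> sem M \<rho> p"
| "sem M \<rho> (Or p q) \<longleftrightarrow> sem M \<rho> p \<or> sem M \<rho> q"
| "sem M \<rho> (Ex p) \<longleftrightarrow> (\<exists>x. sem M (case_nat x \<rho>) p)"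

lemma tval_cong: "(\<And>i. i < tbound t \<Longrightarrow> \<rho> i = \<rho>' i) \<Longrightarrow> tval M \<rho> t = tval M \<rho>' t"
  by (induction t) auto

lemma sem_cong: "(\<And>i. i < fbound p \<Longrightarrow> \<rho> i = \<rho>' i) \<Longrightarrow> sem M \<rho> p \<longleftrightarrow> sem M \<rho>' p"
proof (induction p arbitrary: \<rho> \<rho>')
  case (Eq s t)
  then show ?case using tval_cong[of s \<rho> \<rho>' M] tval_cong[of t \<rho> \<rho>' M] by simp
next
  case (Lt s t)
  then show ?case using tval_cong[of s \<rho> \<rho>' M] tval_cong[of t \<rho> \<rho>' M] by simp
next
  case (Ind t)
  then show ?case using tval_cong[of t \<rho> \<rho>' M] by simp
next
  case (Neg p)
  then show ?case by (metis fbound.simps(4) sem.simps(4))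
next
  case (Or p q)
  have "sem M \<rho> p = sem M \<rho>' p" "sem M \<rho> q = sem M \<rho>' q" using Or.prems by (auto intro!: Or.IH)
  then show ?case by simp
next
  case (Ex p)
  have "sem M (case_nat x \<rho>) p = sem M (case_nat x \<rho>') p" for x
    by (rule Ex.IH) (auto split: nat.split intro: Ex.prems)
  then show ?case by simp
qed

lemma tval_tsub: "tval M \<rho> (tsub f t) = tval M (\<lambda>i. tval M \<rho> (f i)) t"
  by (induction t) auto

lemma sem_fsub: "sem M \<rho> (fsub f p) \<longleftrightarrow> sem M (\<lambda>i. tval M \<rho> (f i)) p"
proof (induction p arbitrary: \<rho> f)
  case (Ex p)
  have "(\<lambda>i. tval M (case_nat x \<rho>) (under_binder f i)) = case_nat x (\<lambda>i. tval M \<rho> (f i))" for x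
    by (auto simp: fun_eq_iff under_binder_def tval_tsub split: nat.split)
  then show ?case by (simp add: Ex)
qed (auto simp: tval_tsub)

lemma sem_lift: "sem M (case_nat x \<rho>) (lift p) \<longleftrightarrow> sem M \<rho> p"
  by (simp add: lift_def sem_fsub)

lemma sem_inst: "sem M \<rho> (inst t p) \<longleftrightarrow> sem M (case_nat (tval M \<rho> t) \<rho>) p"
proof -
  have "(\<lambda>i. tval M \<rho> (case_nat t Var i)) = case_nat (tval M \<rho> t) \<rho>"
    by (auto simp: fun_eq_iff split: nat.split)
  then show ?thesis by (simp add: inst_def sem_fsub)
qed

text \<open>The one bridge from derivations to structures. The assignment varies in the induction
  because \<open>ExE\<close> passes to one that gives the eigenvariable 0 the witness; by
  \<open>sem_lift\<close> the hypotheses do not notice.\<close>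

lemma soundness: "H \<turnstile> p \<Longrightarrow> (\<And>h. h \<in> H \<Longrightarrow> sem M \<rho> h) \<Longrightarrow> sem M \<rho> p"
proof (induction arbitrary: \<rho> rule: provable.induct)
  case (NegI p H q)
  have "\<not> sem M \<rho> p" using NegI.IH[of \<rho>] NegI.prems by auto
  then show ?case by simp
next
  case (Class p H q)
  show ?case
  proof (rule ccontr)
    assume "\<not> sem M \<rho> p"
    then have "sem M \<rho> h" if "h \<in> insert (Neg p) H" for h using that Class.prems by auto
    from Class.IH[OF this, simplified] show False by blast
  qed
next
  case (OrE H p q r)
  show ?case using OrE.IH[of \<rho>] OrE.prems by auto
next
  case (ExI H t p)
  then show ?case by (auto simp: sem_inst)
next
  case (ExE H p q)
  then have "sem M \<rho> (Ex p)" by blast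
  then obtain x where "sem M (case_nat x \<rho>) p" by auto
  then have "sem M (case_nat x \<rho>) (lift q)"
    using ExE by (intro ExE.IH(2)) (auto simp: sem_lift)
  then show ?case by (simp add: sem_lift)
next
  case (Subst H s t p)
  then have "sem M \<rho> (Eq s t)" "sem M \<rho> (inst s p)" by blast+
  then show ?case by (simp add: sem_inst)
qed auto

definition models :: "'a struct \<Rightarrow> fm set \<Rightarrow> bool" where
  "models M T \<longleftrightarrow> (\<forall>p\<in>T. \<forall>\<rho>. sem M \<rho> p)"

lemma models_provable: "models M T \<Longrightarrow> T \<turnstile> p \<Longrightarrow> sem M \<rho> p"
  using soundness[of T p M \<rho>] by (auto simp: models_def)

lemma all_env: "(\<forall>\<rho> x. P (case_nat x \<rho>)) \<longleftrightarrow> (\<forall>\<rho>. P \<rho>)"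
proof -
  have "P \<rho>" if "\<forall>\<rho> x. P (case_nat x \<rho>)" for \<rho> :: "nat \<Rightarrow> 'a"
  proof -
    have "case_nat (\<rho> 0) (\<lambda>i. \<rho> (Suc i)) = \<rho>"
      by (auto simp: fun_eq_iff split: nat.split)
    then show ?thesis using that[rule_format, of "\<rho> 0" "\<lambda>i. \<rho> (Suc i)"] by simp
  qed
  then show ?thesis by blast
qed

text \<open>An assignment is a value for 0 together with an assignment for the rest, so under all
  assignments a prefix of universal quantifiers has no effect, whatever n is. Thus the closures in
  the axiom schemes need no count of variables.\<close>

lemma sem_closure: "(\<forall>\<rho>. sem M \<rho> ((All ^^ n) p)) \<longleftrightarrow> (\<forall>\<rho>. sem M \<rho> p)"
proof (induction n)
  case (Suc n)
  have "(\<forall>\<rho>. sem M \<rho> ((All ^^ Suc n) p)) \<longleftrightarrow> (\<forall>\<rho> x. sem M (case_nat x \<rho>) ((All ^^ n) p))"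
    by simp
  also have "\<dots> \<longleftrightarrow> (\<forall>\<rho>. sem M \<rho> ((All ^^ n) p))"
    by (rule all_env)
  finally show ?case using Suc by (rule trans)
qed simp

lemma sem_induction:
  "(\<forall>\<rho>. sem M \<rho> (induction p)) \<longleftrightarrow>
   (\<forall>\<rho>. sem M (case_nat (zeroS M) \<rho>) p \<longrightarrow>
      (\<forall>x. sem M (case_nat x \<rho>) p \<longrightarrow> sem M (case_nat (succS M x) \<rho>) p) \<longrightarrow> (\<forall>x. sem M (case_nat x \<rho>) p))"
proof -
  have *: "(\<lambda>i. tval M (case_nat x \<rho>) (case_nat (Succ (Var 0)) (\<lambda>i. Var (Suc i)) i)) = case_nat (succS M x) \<rho>"
    for x :: 'a and \<rho>
    by (auto simp: fun_eq_iff split: nat.split)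
  show ?thesis
    unfolding induction_def univ_closure_def sem_closure by (auto simp: sem_inst sem_fsub *)
qed

section \<open>Definable relations\<close>

text \<open>The defining formula may have free variables beyond those on which the relation depends.\<close>

definition dtm :: "'a struct \<Rightarrow> ((nat \<Rightarrow> 'a) \<Rightarrow> 'a) \<Rightarrow> bool" where
  "dtm M f \<longleftrightarrow> (\<exists>t. \<forall>\<rho>. f \<rho> = tval M \<rho> t)"

definition dfn :: "lang \<Rightarrow> 'a struct \<Rightarrow> ((nat \<Rightarrow> 'a) \<Rightarrow> bool) \<Rightarrow> bool" where
  "dfn L M R \<longleftrightarrow> (\<exists>p. in_lang L p \<and> (\<forall>\<rho>. R \<rho> \<longleftrightarrow> sem M \<rho> p))"

abbreviation dfn1 where "dfn1 L M P \<equiv> dfn L M (\<lambda>\<rho>. P (\<rho> 0))"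
abbreviation dfn2 where "dfn2 L M P \<equiv> dfn L M (\<lambda>\<rho>. P (\<rho> 0) (\<rho> (Suc 0)))"
abbreviation dfn3 where "dfn3 L M P \<equiv> dfn L M (\<lambda>\<rho>. P (\<rho> 0) (\<rho> (Suc 0)) (\<rho> (Suc (Suc 0))))"

lemma dtm_Var: "dtm M (\<lambda>\<rho>. \<rho> i)"
  unfolding dtm_def by (rule exI[of _ "Var i"]) simp

lemma dtm_Zero: "dtm M (\<lambda>\<rho>. zeroS M)"
  unfolding dtm_def by (rule exI[of _ "Zero"]) simp

lemma dtm_Succ: "dtm M f \<Longrightarrow> dtm M (\<lambda>\<rho>. succS M (f \<rho>))"
  unfolding dtm_def by (metis tval.simps(3))

lemma dtm_Plus: "dtm M f \<Longrightarrow> dtm M g \<Longrightarrow> dtm M (\<lambda>\<rho>. plusS M (f \<rho>) (g \<rho>))"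
  unfolding dtm_def by (metis tval.simps(4))

lemma dtm_Times: "dtm M f \<Longrightarrow> dtm M g \<Longrightarrow> dtm M (\<lambda>\<rho>. timesS M (f \<rho>) (g \<rho>))"
  unfolding dtm_def by (metis tval.simps(5))

lemmas dtm_intros = dtm_Var dtm_Zero dtm_Succ dtm_Plus dtm_Times

lemma in_lang_simps [simp]:
  "in_lang L (Eq s t)" "in_lang L (Lt s t)" "in_lang L (Neg p) = in_lang L p"
  "in_lang L (Or p q) \<longleftrightarrow> in_lang L p \<and> in_lang L q" "in_lang L (Ex p) = in_lang L p"
  "in_lang L (Ind t) \<longleftrightarrow> L = LAI"
  by (auto simp: in_lang_def intro: lang.exhaust[of L])

lemma dfnI: "in_lang L p \<Longrightarrow> (\<And>\<rho>. R \<rho> \<longleftrightarrow> sem M \<rho> p) \<Longrightarrow> dfn L M R"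
  unfolding dfn_def by blast

lemma dfnE:
  assumes "dfn L M R"
  obtains p where "in_lang L p" "\<And>\<rho>. R \<rho> \<longleftrightarrow> sem M \<rho> p"
  using assms unfolding dfn_def by blast

lemma dtmE:
  assumes "dtm M f"
  obtains t where "\<And>\<rho>. f \<rho> = tval M \<rho> t"
  using assms unfolding dtm_def by blast

lemma dfn_not:
  assumes "dfn L M R"
  shows "dfn L M (\<lambda>\<rho>. \<not> R \<rho>)"
proof -
  obtain p where "in_lang L p" "\<And>\<rho>. R \<rho> \<longleftrightarrow> sem M \<rho> p" using assms by (rule dfnE) blast
  then show ?thesis by (intro dfnI[of L "Neg p"]) simp_all
qed

lemma dfn_or:
  assumes "dfn L M R" "dfn L M S"
  shows "dfn L M (\<lambda>\<rho>. R \<rho> \<or> S \<rho>)"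
proof -
  obtain p where "in_lang L p" "\<And>\<rho>. R \<rho> \<longleftrightarrow> sem M \<rho> p" using assms(1) by (rule dfnE) blast
  moreover obtain q where "in_lang L q" "\<And>\<rho>. S \<rho> \<longleftrightarrow> sem M \<rho> q" using assms(2) by (rule dfnE) blast
  ultimately show ?thesis by (intro dfnI[of L "Or p q"]) simp_all
qed

text \<open>In the premise \<rho> 0 is the bound variable and the shifted assignment serves the
  others, just as for \<open>Ex\<close>. This form lets \<open>intro dfn_intros\<close> peel
  quantifiers off a HOL formula by unification.\<close>

lemma dfn_ex:
  assumes "dfn L M (\<lambda>\<rho>. R (\<rho> 0) (\<lambda>i. \<rho> (Suc i)))"
  shows "dfn L M (\<lambda>\<rho>. \<exists>x. R x \<rho>)"
proof -
  obtain p where p: "in_lang L p" "\<And>\<rho>. R (\<rho> 0) (\<lambda>i. \<rho> (Suc i)) \<longleftrightarrow> sem M \<rho> p"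
    using assms by (rule dfnE) blast
  have "R x \<rho> \<longleftrightarrow> sem M (case_nat x \<rho>) p" for x \<rho>
    using p(2)[of "case_nat x \<rho>"] by simp
  then show ?thesis using p(1) by (intro dfnI[of L "Ex p"]) simp_all
qed

lemma dfn_and: "dfn L M R \<Longrightarrow> dfn L M S \<Longrightarrow> dfn L M (\<lambda>\<rho>. R \<rho> \<and> S \<rho>)"
  using dfn_not[OF dfn_or[OF dfn_not dfn_not, of L M R S]] by simp

lemma dfn_imp: "dfn L M R \<Longrightarrow> dfn L M S \<Longrightarrow> dfn L M (\<lambda>\<rho>. R \<rho> \<longrightarrow> S \<rho>)"
  using dfn_or[OF dfn_not, of L M R S] unfolding imp_conv_disj by blast

lemma dfn_iff: "dfn L M R \<Longrightarrow> dfn L M S \<Longrightarrow> dfn L M (\<lambda>\<rho>. R \<rho> \<longleftrightarrow> S \<rho>)"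
  using dfn_and[OF dfn_imp dfn_imp, of L M R S S R] unfolding iff_conv_conj_imp by blast

lemma dfn_all:
  assumes "dfn L M (\<lambda>\<rho>. R (\<rho> 0) (\<lambda>i. \<rho> (Suc i)))"
  shows "dfn L M (\<lambda>\<rho>. \<forall>x. R x \<rho>)"
  using dfn_not[OF dfn_ex[of L M "\<lambda>x \<rho>. \<not> R x \<rho>"]] dfn_not[OF assms] by simp

lemma dfn_eq: "dtm M f \<Longrightarrow> dtm M g \<Longrightarrow> dfn L M (\<lambda>\<rho>. f \<rho> = g \<rho>)"
  by (elim dtmE, rule dfnI[of _ "Eq _ _"]) simp_all

lemma dfn_less: "dtm M f \<Longrightarrow> dtm M g \<Longrightarrow> dfn L M (\<lambda>\<rho>. lessS M (f \<rho>) (g \<rho>))"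
  by (elim dtmE, rule dfnI[of _ "Lt _ _"]) simp_all

lemma ind_free_fsub [simp]: "ind_free (fsub f p) = ind_free p"
  by (induction p arbitrary: f) auto

lemma in_lang_fsub [simp]: "in_lang L (fsub f p) = in_lang L p"
  by (simp add: in_lang_def)

text \<open>All indices are replaced at once. A relation of few arguments ignores the others, so the
  lemmas for one, two and three arguments fill those with their last term.\<close>

lemma dfn_subst:
  assumes "dfn L M R" "\<And>i. dtm M (g i)"
  shows "dfn L M (\<lambda>\<rho>. R (\<lambda>i. g i \<rho>))"
proof -
  obtain p where p: "in_lang L p" "\<And>\<rho>. R \<rho> \<longleftrightarrow> sem M \<rho> p"
    using assms(1) by (rule dfnE) blast
  obtain t where "\<And>i \<rho>. g i \<rho> = tval M \<rho> (t i)"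
    using assms(2) unfolding dtm_def by metis
  then have "R (\<lambda>i. g i \<rho>) \<longleftrightarrow> sem M \<rho> (fsub t p)" for \<rho>
    using p(2) by (simp add: sem_fsub)
  then show ?thesis using p(1) by (intro dfnI[of L "fsub t p"]) simp_all
qed

lemma dfn1_app:
  assumes "dfn1 L M P" "dtm M f"
  shows "dfn L M (\<lambda>\<rho>. P (f \<rho>))"
  using dfn_subst[OF assms(1), of "\<lambda>i. f"] assms(2) by simp

lemma dfn2_app:
  assumes "dfn2 L M P" "dtm M f" "dtm M g"
  shows "dfn L M (\<lambda>\<rho>. P (f \<rho>) (g \<rho>))"
  using dfn_subst[OF assms(1), of "case_nat f (\<lambda>i. g)"] assms(2,3) by (simp split: nat.split)

lemma dfn3_app:
  assumes "dfn3 L M P" "dtm M f" "dtm M g" "dtm M h"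
  shows "dfn L M (\<lambda>\<rho>. P (f \<rho>) (g \<rho>) (h \<rho>))"
  using dfn_subst[OF assms(1), of "case_nat f (case_nat g (\<lambda>i. h))"] assms(2-4) by (simp split: nat.split)

lemmas dfn_intros = dfn_not dfn_or dfn_and dfn_imp dfn_iff dfn_all dfn_ex dfn_eq dfn_less dtm_intros

lemmas fb_defs = bZero_def bSucc_def bNum_def bPlus_def bTimes_def bEq_def bLt_def bInd_def bNot_def
  bAnd_def bOr_def bImp_def bIff_def bEx_def bAll_def

section \<open>Arithmetic in models of \<open>PA\<close>\<close>

text \<open>The tail \<rho> carries parameters from M, over which the universal closure in
  \<open>induction\<close> ranges.\<close>

lemma dfn_induct:
  assumes "models M (PA_axioms L)" "dfn L M R" "R (case_nat (zeroS M) \<rho>)"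
    "\<And>x. R (case_nat x \<rho>) \<Longrightarrow> R (case_nat (succS M x) \<rho>)"
  shows "R (case_nat x \<rho>)"
proof -
  obtain p where p: "in_lang L p" "\<And>\<rho>. R \<rho> \<longleftrightarrow> sem M \<rho> p"
    using assms(2) by (rule dfnE) blast
  then have "induction p \<in> PA_axioms L"
    unfolding PA_axioms_def by blast
  then have "\<forall>\<rho>. sem M \<rho> (induction p)"
    using assms(1) unfolding models_def by blast
  then have "sem M (case_nat (zeroS M) \<rho>) p \<Longrightarrow>
      (\<And>x. sem M (case_nat x \<rho>) p \<Longrightarrow> sem M (case_nat (succS M x) \<rho>) p) \<Longrightarrow> sem M (case_nat x \<rho>) p"
    unfolding sem_induction by blast
  then show ?thesis using assms(3,4) unfolding p(2) by blast
qed

text \<open>The language L is kept open: with \<open>LAI\<close>, induction and coding extend to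
  relations that mention I, as the maps out of a model of U require.\<close>

locale pa =
  fixes L :: lang and M :: "'a struct"
  assumes PA: "models M (PA_axioms L)"
begin

abbreviation zero ("\<zero>") where "\<zero> \<equiv> zeroS M"
abbreviation succ where "succ \<equiv> succS M"
abbreviation plus (infixl "\<oplus>" 65) where "x \<oplus> y \<equiv> plusS M x y"
abbreviation times (infixl "\<otimes>" 70) where "x \<otimes> y \<equiv> timesS M x y"
abbreviation less (infix "\<prec>" 50) where "x \<prec> y \<equiv> lessS M x y"

lemma axioms_sem:
  "succ x \<noteq> \<zero>" "succ x = succ y \<Longrightarrow> x = y" "x \<oplus> \<zero> = x" "x \<oplus> succ y = succ (x \<oplus> y)"
  "x \<otimes> \<zero> = \<zero>" "x \<otimes> succ y = x \<otimes> y \<oplus> x"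
  using PA by (simp_all add: models_def PA_axioms_def ball_Un fb_defs)

lemma less_iff: "x \<prec> y \<longleftrightarrow> (\<exists>z. x \<oplus> succ z = y)"
proof -
  have "\<forall>x y. (x \<prec> y \<longrightarrow> (\<exists>z. x \<oplus> succ z = y)) \<and> ((\<forall>z. x \<oplus> succ z \<noteq> y) \<or> x \<prec> y)"
    using PA unfolding models_def PA_axioms_def
    by (simp (no_asm_use) add: ball_Un fb_defs) (elim conjE, assumption)
  then show ?thesis by blast
qed

lemma succ_simps [simp]:
  "succ x \<noteq> \<zero>" "\<zero> \<noteq> succ x" "succ x = succ y \<longleftrightarrow> x = y"
  using axioms_sem(1)[of x] axioms_sem(2)[of x y] by metis+

lemmas add_0 [simp] = axioms_sem(3) and add_succ [simp] = axioms_sem(4)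
lemmas mult_0 [simp] = axioms_sem(5) and mult_succ = axioms_sem(6)

text \<open>Here P must be definable without parameters. Applications therefore quantify the
  remaining variables inside P.\<close>

lemma induct1:
  assumes "dfn1 L M P" "P \<zero>" "\<And>x. P x \<Longrightarrow> P (succ x)"
  shows "P x"
  using dfn_induct[OF PA assms(1), of "\<lambda>_. \<zero>" x] assms(2,3) by simp

lemma zero_or_succ: "x = \<zero> \<or> (\<exists>y. x = succ y)"
  by (rule induct1[where P = "\<lambda>x. x = \<zero> \<or> (\<exists>y. x = succ y)"]) (intro dfn_intros | auto)+

section \<open>Semiring laws and the order\<close>

lemma add_assoc: "(x \<oplus> y) \<oplus> z = x \<oplus> (y \<oplus> z)"
proof -
  have "\<forall>x y. (x \<oplus> y) \<oplus> z = x \<oplus> (y \<oplus> z)"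
    by (rule induct1[where P = "\<lambda>z. \<forall>x y. (x \<oplus> y) \<oplus> z = x \<oplus> (y \<oplus> z)"]) (intro dfn_intros | simp)+
  then show ?thesis by blast
qed

lemma add_0_left [simp]: "\<zero> \<oplus> x = x"
  by (rule induct1[where P = "\<lambda>x. \<zero> \<oplus> x = x"]) (intro dfn_intros | simp)+

lemma add_succ_left [simp]: "succ x \<oplus> y = succ (x \<oplus> y)"
proof -
  have "\<forall>x. succ x \<oplus> y = succ (x \<oplus> y)"
    by (rule induct1[where P = "\<lambda>y. \<forall>x. succ x \<oplus> y = succ (x \<oplus> y)"]) (intro dfn_intros | simp)+
  then show ?thesis by blast
qed

lemma add_commute: "x \<oplus> y = y \<oplus> x"
proof -
  have "\<forall>x. x \<oplus> y = y \<oplus> x"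
    by (rule induct1[where P = "\<lambda>y. \<forall>x. x \<oplus> y = y \<oplus> x"]) (intro dfn_intros | simp)+
  then show ?thesis by blast
qed

lemma add_left_commute: "x \<oplus> (y \<oplus> z) = y \<oplus> (x \<oplus> z)"
  by (metis add_assoc add_commute)

lemmas add_ac = add_assoc add_commute add_left_commute

lemma mult_0_left [simp]: "\<zero> \<otimes> x = \<zero>"
  by (rule induct1[where P = "\<lambda>x. \<zero> \<otimes> x = \<zero>"]) (intro dfn_intros | simp add: mult_succ)+

lemma mult_succ_left: "succ x \<otimes> y = x \<otimes> y \<oplus> y"
proof -
  have "\<forall>x. succ x \<otimes> y = x \<otimes> y \<oplus> y"
    by (rule induct1[where P = "\<lambda>y. \<forall>x. succ x \<otimes> y = x \<otimes> y \<oplus> y"])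
      (intro dfn_intros | simp add: mult_succ add_ac)+
  then show ?thesis by blast
qed

lemma mult_commute: "x \<otimes> y = y \<otimes> x"
proof -
  have "\<forall>x. x \<otimes> y = y \<otimes> x"
    by (rule induct1[where P = "\<lambda>y. \<forall>x. x \<otimes> y = y \<otimes> x"])
      (intro dfn_intros | simp add: mult_succ mult_succ_left)+
  then show ?thesis by blast
qed

lemma distrib_left: "x \<otimes> (y \<oplus> z) = x \<otimes> y \<oplus> x \<otimes> z"
proof -
  have "\<forall>x y. x \<otimes> (y \<oplus> z) = x \<otimes> y \<oplus> x \<otimes> z"
    by (rule induct1[where P = "\<lambda>z. \<forall>x y. x \<otimes> (y \<oplus> z) = x \<otimes> y \<oplus> x \<otimes> z"])
      (intro dfn_intros | simp add: mult_succ add_ac)+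
  then show ?thesis by blast
qed

lemma distrib_right: "(y \<oplus> z) \<otimes> x = y \<otimes> x \<oplus> z \<otimes> x"
  by (metis distrib_left mult_commute)

lemma mult_assoc: "(x \<otimes> y) \<otimes> z = x \<otimes> (y \<otimes> z)"
proof -
  have "\<forall>x y. (x \<otimes> y) \<otimes> z = x \<otimes> (y \<otimes> z)"
    by (rule induct1[where P = "\<lambda>z. \<forall>x y. (x \<otimes> y) \<otimes> z = x \<otimes> (y \<otimes> z)"])
      (intro dfn_intros | simp add: mult_succ distrib_left)+
  then show ?thesis by blast
qed

lemma mult_left_commute: "x \<otimes> (y \<otimes> z) = y \<otimes> (x \<otimes> z)"
  by (metis mult_assoc mult_commute)

lemmas mult_ac = mult_assoc mult_commute mult_left_commute
lemmas arith_simps = add_ac mult_ac distrib_left distrib_right mult_succ mult_succ_left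

lemma add_right_cancel [simp]: "x \<oplus> z = y \<oplus> z \<longleftrightarrow> x = y"
proof -
  have "\<forall>x y. x \<oplus> z = y \<oplus> z \<longrightarrow> x = y"
    by (rule induct1[where P = "\<lambda>z. \<forall>x y. x \<oplus> z = y \<oplus> z \<longrightarrow> x = y"]) (intro dfn_intros | simp)+
  then show ?thesis by blast
qed

lemma add_left_cancel [simp]: "z \<oplus> x = z \<oplus> y \<longleftrightarrow> x = y"
  by (metis add_right_cancel add_commute)

lemma add_eq_0 [simp]: "x \<oplus> y = \<zero> \<longleftrightarrow> x = \<zero> \<and> y = \<zero>"
  using zero_or_succ[of y] by auto

lemma mult_eq_0 [simp]: "x \<otimes> y = \<zero> \<longleftrightarrow> x = \<zero> \<or> y = \<zero>"
  using zero_or_succ[of x] zero_or_succ[of y] by (auto simp: mult_succ)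

lemma le_cases: obtains w where "y = x \<oplus> w" | w where "x = y \<oplus> succ w"
proof -
  have "\<forall>x. (\<exists>w. y = x \<oplus> w) \<or> (\<exists>w. x = y \<oplus> succ w)"
  proof (rule induct1[where P = "\<lambda>y. \<forall>x. (\<exists>w. y = x \<oplus> w) \<or> (\<exists>w. x = y \<oplus> succ w)"])
    show "\<forall>x. (\<exists>w. \<zero> = x \<oplus> w) \<or> (\<exists>w. x = \<zero> \<oplus> succ w)"
      by (metis add_0_left zero_or_succ)
  next
    fix y assume "\<forall>x. (\<exists>w. y = x \<oplus> w) \<or> (\<exists>w. x = y \<oplus> succ w)"
    then show "\<forall>x. (\<exists>w. succ y = x \<oplus> w) \<or> (\<exists>w. x = succ y \<oplus> succ w)"
      by (metis add_0 add_succ add_succ_left zero_or_succ)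
  qed (intro dfn_intros)
  then show thesis using that by blast
qed

lemma less_irrefl [simp]: "\<not> x \<prec> x"
  by (metis add_0 add_left_cancel less_iff succ_simps(1))

lemma less_trans: "x \<prec> y \<Longrightarrow> y \<prec> z \<Longrightarrow> x \<prec> z"
  by (metis add_assoc add_succ less_iff)

lemma not_less_0 [simp]: "\<not> x \<prec> \<zero>"
  by (simp add: less_iff)

lemma less_succ: "x \<prec> succ y \<longleftrightarrow> x \<prec> y \<or> x = y"
proof
  assume "x \<prec> succ y"
  then obtain z where "x \<oplus> z = y" by (auto simp: less_iff)
  then show "x \<prec> y \<or> x = y" using zero_or_succ[of z] by (auto simp: less_iff)
next
  assume "x \<prec> y \<or> x = y"
  then show "x \<prec> succ y" by (metis add_0 add_succ less_iff)
qed

lemma less_linear: "x \<prec> y \<or> x = y \<or> y \<prec> x"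
  by (metis add_0 le_cases less_iff zero_or_succ)

lemma less_add: "x \<prec> y \<Longrightarrow> x \<prec> y \<oplus> z"
  by (auto simp: less_iff add_assoc)

text \<open>If nothing below x satisfies P but x does, then x is a least witness; hence plain
  induction suffices. It serves to find the next element of I.\<close>

lemma least:
  assumes "dfn2 L M P" "P x a"
  obtains y where "P y a" "\<And>z. z \<prec> y \<Longrightarrow> \<not> P z a"
proof -
  have "\<forall>a. (\<exists>y. P y a \<and> (\<forall>z. z \<prec> y \<longrightarrow> \<not> P z a)) \<or> (\<forall>z. z \<prec> x \<longrightarrow> \<not> P z a)" for x
    by (rule induct1[where P = "\<lambda>x. \<forall>a. (\<exists>y. P y a \<and> (\<forall>z. z \<prec> y \<longrightarrow> \<not> P z a)) \<or> (\<forall>z. z \<prec> x \<longrightarrow> \<not> P z a)"])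
      (intro dfn_intros dfn2_app[OF assms(1)], simp, metis less_succ)
  then show thesis using assms(2) that by blast
qed

section \<open>Divisibility and the beta function\<close>

definition divides where "divides x y \<longleftrightarrow> (\<exists>w. y = x \<otimes> w)"

lemma dfn_divides: "dtm M f \<Longrightarrow> dtm M g \<Longrightarrow> dfn L M (\<lambda>\<rho>. divides (f \<rho>) (g \<rho>))"
  by (rule dfn2_app[where P = divides]) (unfold divides_def, intro dfn_intros)

lemma divides_mult: "divides x y \<Longrightarrow> divides x (y \<otimes> z)"
  unfolding divides_def by (metis mult_assoc)

lemma divides_add_cancel:
  assumes "divides c x" "divides c (x \<oplus> y)"
  shows "divides c y"
proof -
  obtain u v where u: "x = c \<otimes> u" and v: "x \<oplus> y = c \<otimes> v"
    using assms unfolding divides_def by blast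
  \<comment> \<open>There is no subtraction: y is c times v - u if v is at least u, and otherwise y
    must be 0.\<close>
  show ?thesis
  proof (cases rule: le_cases[of v u])
    case (1 w)
    then have "y = c \<otimes> w" using u v by (simp add: distrib_left)
    then show ?thesis unfolding divides_def by blast
  next
    case (2 w)
    have "c \<otimes> v \<oplus> \<zero> = c \<otimes> (v \<oplus> succ w) \<oplus> y"
      using u v 2 by simp
    also have "\<dots> = c \<otimes> v \<oplus> (c \<otimes> succ w \<oplus> y)"
      by (simp only: distrib_left add_assoc)
    finally have "\<zero> = c \<otimes> succ w \<oplus> y" unfolding add_left_cancel .
    then have "y = \<zero>" by (metis add_eq_0)
    then show ?thesis unfolding divides_def by (metis mult_0)
  qed
qed

text \<open>A substitute for the factorial of m: in the step b is multiplied by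
  \<open>succ m\<close>. That b is nonzero keeps every modulus different from 1.\<close>

lemma common_multiple: "\<exists>b. b \<noteq> \<zero> \<and> (\<forall>d. d \<prec> m \<longrightarrow> divides (succ d) b)"
proof (rule induct1[where P = "\<lambda>m. \<exists>b. b \<noteq> \<zero> \<and> (\<forall>d. d \<prec> m \<longrightarrow> divides (succ d) b)"])
  show "\<exists>b. b \<noteq> \<zero> \<and> (\<forall>d. d \<prec> \<zero> \<longrightarrow> divides (succ d) b)"
    by (intro exI[of _ "succ \<zero>"]) simp
next
  fix m assume "\<exists>b. b \<noteq> \<zero> \<and> (\<forall>d. d \<prec> m \<longrightarrow> divides (succ d) b)"
  then obtain b where b: "b \<noteq> \<zero>" "\<And>d. d \<prec> m \<Longrightarrow> divides (succ d) b" by blast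
  have "divides (succ d) (b \<otimes> succ m)" if "d \<prec> succ m" for d
    using that unfolding less_succ by (metis b(2) divides_def divides_mult mult_commute)
  moreover have "b \<otimes> succ m \<noteq> \<zero>" using b(1) by simp
  ultimately show "\<exists>b. b \<noteq> \<zero> \<and> (\<forall>d. d \<prec> succ m \<longrightarrow> divides (succ d) b)" by blast
qed (intro dfn_intros dfn_divides)

text \<open>The moduli of Goedel's beta function are pairwise coprime because of the Bezout identity
  \<open>(v + 1)(1 + (k + 1) b) - (k + 1)(1 + (v + 1) b) = v - k\<close> and since \<open>v - k\<close> divides b.\<close>

abbreviation modulus where "modulus b v \<equiv> succ (succ v \<otimes> b)"

lemma modulus_coprime:
  assumes b: "\<And>d. d \<prec> m \<Longrightarrow> divides (succ d) b" and m: "v \<prec> m" "k \<prec> m" and "v \<noteq> k"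
    and dvd: "divides (modulus b v) (a \<otimes> modulus b k)"
  shows "divides (modulus b v) a"
proof -
  let ?c = "modulus b v"
  \<comment> \<open>The Bezout identity, multiplied by a, is arranged without subtraction according
    to which of v and k is larger; in both cases the difference \<open>succ t\<close> divides
    b.\<close>
  have ab: "divides ?c (a \<otimes> b)"
  proof (cases rule: le_cases[of v k])
    case (1 w)
    then obtain t where v: "v = k \<oplus> succ t" using \<open>v \<noteq> k\<close> zero_or_succ[of w] by auto
    have "t \<prec> m" using m(1) v less_trans by (metis add_commute add_succ less_iff)
    then obtain b' where b': "b = succ t \<otimes> b'" using b unfolding divides_def by blast
    have "a \<otimes> modulus b k \<otimes> succ v = a \<otimes> succ k \<otimes> ?c \<oplus> a \<otimes> succ t"
      by (simp add: v arith_simps)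
    moreover have "divides ?c (a \<otimes> modulus b k \<otimes> succ v)" using dvd by (rule divides_mult)
    moreover have "divides ?c (a \<otimes> succ k \<otimes> ?c)" unfolding divides_def by (metis mult_commute)
    ultimately have "divides ?c (a \<otimes> succ t)" using divides_add_cancel by metis
    then show ?thesis using divides_mult[of ?c "a \<otimes> succ t" b'] b' by (simp only: mult_assoc)
  next
    case (2 t)
    have "t \<prec> m" using m(2) 2 less_trans by (metis add_commute add_succ less_iff)
    then obtain b' where b': "b = succ t \<otimes> b'" using b unfolding divides_def by blast
    have "a \<otimes> modulus b k \<otimes> succ v \<oplus> a \<otimes> succ t = a \<otimes> succ k \<otimes> ?c"
      by (simp add: 2 arith_simps)
    moreover have "divides ?c (a \<otimes> modulus b k \<otimes> succ v)" using dvd by (rule divides_mult)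
    moreover have "divides ?c (a \<otimes> succ k \<otimes> ?c)" unfolding divides_def by (metis mult_commute)
    ultimately have "divides ?c (a \<otimes> succ t)" using divides_add_cancel by metis
    then show ?thesis using divides_mult[of ?c "a \<otimes> succ t" b'] b' by (simp only: mult_assoc)
  qed
  \<comment> \<open>The modulus is 1 plus a multiple of b, so divisibility of a b passes on to
    a.\<close>
  have "a \<otimes> ?c = a \<otimes> b \<otimes> succ v \<oplus> a" by (simp add: arith_simps)
  moreover have "divides ?c (a \<otimes> ?c)" unfolding divides_def by (metis mult_commute)
  ultimately show ?thesis using divides_mult[OF ab, of "succ v"] divides_add_cancel by metis
qed

text \<open>The code a is the product of the moduli of those v that are to be members, built up
  along a bound k. Coprimality ensures that a new factor brings in no member but its own.\<close>

lemma bounded_comprehension: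
  assumes "dfn L M (\<lambda>\<rho>. P (\<rho> 0) (\<lambda>i. \<rho> (Suc i)))"
  shows "\<exists>a b. \<forall>v. v \<prec> m \<longrightarrow> (divides (modulus b v) a \<longleftrightarrow> P v \<sigma>)"
proof -
  obtain b where b: "b \<noteq> \<zero>" "\<And>d. d \<prec> m \<Longrightarrow> divides (succ d) b"
    using common_multiple by blast
  \<comment> \<open>Index 0 is the running bound k. The elements m and b must be parameters of the
    induction formula, so they sit at 1 and 2, followed by the parameters of P.\<close>
  let ?R = "\<lambda>\<rho>. \<exists>a. \<forall>v. v \<prec> \<rho> 1 \<longrightarrow>
      (divides (modulus (\<rho> 2) v) a \<longleftrightarrow> v \<prec> \<rho> 0 \<and> P v (\<lambda>i. \<rho> (Suc (Suc (Suc i)))))"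
  \<comment> \<open>The shift by five accounts for k, m, b and the two quantifiers over a and
    v.\<close>
  have P: "dfn L M (\<lambda>\<rho>. P (\<rho> 0) (\<lambda>i. \<rho> (Suc (Suc (Suc (Suc (Suc i)))))))"
    using dfn_subst[OF assms, of "case_nat (\<lambda>\<rho>. \<rho> 0) (\<lambda>i \<rho>. \<rho> (Suc (Suc (Suc (Suc (Suc i))))))"]
    by (simp add: dtm_Var split: nat.split)
  have "?R (case_nat k (case_nat m (case_nat b \<sigma>)))" for k
  proof (rule dfn_induct[OF PA])
    show "dfn L M ?R" by (intro dfn_intros dfn_divides P)
  next
    \<comment> \<open>The empty product 1 codes the empty set, as b is nonzero.\<close>
    have "\<not> divides (modulus b v) (succ \<zero>)" for v
    proof
      assume "divides (modulus b v) (succ \<zero>)"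
      then obtain w where w: "succ \<zero> = modulus b v \<otimes> w" unfolding divides_def by blast
      obtain w' where w': "w = succ w'" using w zero_or_succ[of w] by auto
      show False using w[symmetric] b(1) unfolding w' by (simp add: mult_succ)
    qed
    then show "?R (case_nat \<zero> (case_nat m (case_nat b \<sigma>)))"
      by (intro exI[of _ "succ \<zero>"]) simp
  next
    fix k assume "?R (case_nat k (case_nat m (case_nat b \<sigma>)))"
    then obtain a where a: "\<And>v. v \<prec> m \<Longrightarrow> divides (modulus b v) a \<longleftrightarrow> v \<prec> k \<and> P v \<sigma>"
      by (auto simp: numeral_2_eq_2)
    show "?R (case_nat (succ k) (case_nat m (case_nat b \<sigma>)))"
    proof (cases "k \<prec> m \<and> P k \<sigma>")
      case True
      have "divides (modulus b v) (a \<otimes> modulus b k) \<longleftrightarrow> v \<prec> succ k \<and> P v \<sigma>" if v: "v \<prec> m" for v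
      proof (cases "v = k")
        case True
        then show ?thesis using \<open>k \<prec> m \<and> P k \<sigma>\<close> unfolding divides_def less_succ by (metis mult_commute)
      next
        case False
        then have "divides (modulus b v) (a \<otimes> modulus b k) \<longleftrightarrow> divides (modulus b v) a"
          using modulus_coprime[OF b(2) v] True divides_mult by blast
        then show ?thesis using a[OF v] False by (auto simp: less_succ)
      qed
      then show ?thesis by (intro exI[of _ "a \<otimes> modulus b k"]) (simp add: numeral_2_eq_2)
    next
      case False
      then show ?thesis using a by (intro exI[of _ a]) (auto simp: numeral_2_eq_2 less_succ)
    qed
  qed
  from this[of m] show ?thesis by (auto simp: numeral_2_eq_2)
qed

end

section \<open>Definable recursion\<close>

context pa
begin

section \<open>Codes of finite binary relations\<close>

lemma lessE:
  assumes "x \<prec> y"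
  obtains w where "y = x \<oplus> succ w"
  using assms unfolding less_iff by blast

lemma pairing_bound:
  assumes "i \<prec> m" "y \<prec> B"
  shows "i \<otimes> B \<oplus> y \<prec> m \<otimes> B"
proof -
  obtain w where m: "m = i \<oplus> succ w" using assms(1) by (rule lessE)
  obtain c where B: "B = y \<oplus> succ c" using assms(2) by (rule lessE)
  have "m \<otimes> B = i \<otimes> B \<oplus> (w \<otimes> B \<oplus> B)"
    by (simp only: m distrib_right mult_succ_left)
  also have "w \<otimes> B \<oplus> B = w \<otimes> B \<oplus> (y \<oplus> succ c)"
    by (simp only: B[symmetric])
  also have "i \<otimes> B \<oplus> (w \<otimes> B \<oplus> (y \<oplus> succ c)) = i \<otimes> B \<oplus> y \<oplus> succ (w \<otimes> B \<oplus> c)"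
    by (simp add: add_ac)
  finally show ?thesis using less_iff by metis
qed

text \<open>Uniqueness of division by B with remainder: if i is below j, then j B is at least i B +
  B, which exceeds i B + y.\<close>

lemma pairing_inj:
  assumes eq: "i \<otimes> B \<oplus> y = j \<otimes> B \<oplus> z" and less: "y \<prec> B" "z \<prec> B"
  shows "i = j \<and> y = z"
proof -
  have *: "i' \<otimes> B \<oplus> y' \<noteq> j' \<otimes> B \<oplus> z'" if ij: "i' \<prec> j'" and yB: "y' \<prec> B" for i' j' y' z'
  proof -
    obtain w where j': "j' = i' \<oplus> succ w" using ij by (rule lessE)
    obtain c where B: "B = y' \<oplus> succ c" using yB by (rule lessE)
    have "j' \<otimes> B \<oplus> z' = i' \<otimes> B \<oplus> (B \<oplus> (w \<otimes> B \<oplus> z'))"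
      by (simp add: j' arith_simps)
    moreover have "y' \<oplus> \<zero> \<noteq> y' \<oplus> (succ c \<oplus> (w \<otimes> B \<oplus> z'))"
      unfolding add_left_cancel by simp
    then have "y' \<noteq> B \<oplus> (w \<otimes> B \<oplus> z')"
      unfolding B by (simp add: add_assoc)
    ultimately show ?thesis by simp
  qed
  have "\<not> i \<prec> j" "\<not> j \<prec> i" using *[of i j y z] *[of j i z y] less eq by auto
  then have "i = j" using less_linear[of i j] by blast
  then show ?thesis using eq by simp
qed

text \<open>The pair (i, y) with y < B is represented by \<open>i B + y\<close>, and v belongs to the coded set
  if \<open>modulus b v\<close> divides a.\<close>

definition in_code where
  "in_code a b B i y \<longleftrightarrow> y \<prec> B \<and> divides (modulus b (i \<otimes> B \<oplus> y)) a"

lemma dfn_in_code: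
  "dtm M f \<Longrightarrow> dtm M g \<Longrightarrow> dtm M h \<Longrightarrow> dtm M k \<Longrightarrow> dtm M l \<Longrightarrow>
    dfn L M (\<lambda>\<rho>. in_code (f \<rho>) (g \<rho>) (h \<rho>) (k \<rho>) (l \<rho>))"
  unfolding in_code_def by (intro dfn_intros dfn_divides)

text \<open>Only the box of i below m and y below B is controlled. \<open>in_code\<close> fails for
  larger y, but for i from m on it may hold by accident; this is why \<open>computation\<close>
  inspects only positions up to its end.\<close>

lemma relation_code:
  assumes "dfn L M (\<lambda>\<rho>. R (\<rho> 0) (\<rho> (Suc 0)) (\<lambda>i. \<rho> (Suc (Suc i))))"
  obtains a b where "\<And>i y. i \<prec> m \<Longrightarrow> y \<prec> B \<Longrightarrow> in_code a b B i y \<longleftrightarrow> R i y \<sigma>"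
proof -
  let ?P = "\<lambda>v \<rho>. \<exists>i y. y \<prec> \<rho> 0 \<and> v = i \<otimes> \<rho> 0 \<oplus> y \<and> R i y (\<lambda>i. \<rho> (Suc i))"
  have R: "dfn L M (\<lambda>\<rho>. R (\<rho> (Suc 0)) (\<rho> 0) (\<lambda>i. \<rho> (Suc (Suc (Suc (Suc i))))))"
    using dfn_subst[OF assms, of "case_nat (\<lambda>\<rho>. \<rho> (Suc 0)) (case_nat (\<lambda>\<rho>. \<rho> 0) (\<lambda>i \<rho>. \<rho> (Suc (Suc (Suc (Suc i))))))"]
    by (simp add: dtm_Var split: nat.split)
  have "dfn L M (\<lambda>\<rho>. ?P (\<rho> 0) (\<lambda>i. \<rho> (Suc i)))"
    by (intro dfn_intros R)
  from bounded_comprehension[OF this, of "m \<otimes> B" "case_nat B \<sigma>"]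
  obtain a b where ab: "\<And>v. v \<prec> m \<otimes> B \<Longrightarrow> divides (modulus b v) a \<longleftrightarrow> ?P v (case_nat B \<sigma>)"
    by blast
  show thesis
  proof (rule that)
    fix i y assume *: "i \<prec> m" "y \<prec> B"
    then have "in_code a b B i y \<longleftrightarrow> ?P (i \<otimes> B \<oplus> y) (case_nat B \<sigma>)"
      using ab[OF pairing_bound[OF *]] by (simp add: in_code_def)
    also have "\<dots> \<longleftrightarrow> R i y \<sigma>"
    proof
      assume "?P (i \<otimes> B \<oplus> y) (case_nat B \<sigma>)"
      then obtain i' y' where "y' \<prec> B" "i \<otimes> B \<oplus> y = i' \<otimes> B \<oplus> y'" "R i' y' \<sigma>" by auto
      then show "R i y \<sigma>" using pairing_inj[of i B y i' y'] *(2) by blast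
    next
      assume "R i y \<sigma>"
      then show "?P (i \<otimes> B \<oplus> y) (case_nat B \<sigma>)" using *(2) by (intro exI[of _ i] exI[of _ y]) simp
    qed
    finally show "in_code a b B i y \<longleftrightarrow> R i y \<sigma>" .
  qed
qed

section \<open>Iteration of a definable relation\<close>

context
  fixes Z :: "'a \<Rightarrow> bool" and G :: "'a \<Rightarrow> 'a \<Rightarrow> bool"
  assumes dfn_Z: "dfn1 L M Z" and dfn_G: "dfn2 L M G"
    and ex_Z: "\<exists>y. Z y" and ex_G: "\<And>y. Z y \<or> (\<exists>x. G x y) \<Longrightarrow> \<exists>z. G y z"
begin

text \<open>A trace read backwards: each pair at a position up to x is justified by Z or by a pair
  one position earlier. It need not be single-valued, because in the application Z and G determine
  values only up to \<open>eqv\<close>.\<close>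

definition computation where
  "computation a b B x \<longleftrightarrow> (\<forall>i z. i \<prec> succ x \<and> in_code a b B i z \<longrightarrow>
     i = \<zero> \<and> Z z \<or> (\<exists>j u. i = succ j \<and> in_code a b B j u \<and> G u z))"

definition iterate where
  "iterate x y \<longleftrightarrow> (\<exists>a b B. computation a b B x \<and> in_code a b B x y)"

lemma dfn_iterate: "dfn2 L M iterate"
  unfolding iterate_def computation_def
  by (intro dfn_intros dfn_in_code dfn1_app[OF dfn_Z] dfn2_app[OF dfn_G])

lemma iterate_0: "iterate \<zero> y \<Longrightarrow> Z y"
  unfolding iterate_def computation_def less_succ by (metis succ_simps(1))

lemma iterate_succ: "iterate (succ x) y \<Longrightarrow> \<exists>u. iterate x u \<and> G u y"
  unfolding iterate_def computation_def less_succ by (metis succ_simps(1,3))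

text \<open>A trace ending in y is prolonged by some z with G y z. Since z may exceed the bound B,
  and a new bound changes all the numbers i B + y, the whole trace is coded afresh.\<close>

lemma ex_iterate: "\<exists>y. iterate x y"
proof (rule induct1[where P = "\<lambda>x. \<exists>y. iterate x y"])
  show "dfn1 L M (\<lambda>x. \<exists>y. iterate x y)"
    by (intro dfn_intros dfn2_app[OF dfn_iterate])
next
  obtain y where y: "Z y" using ex_Z by blast
  let ?B = "succ y"
  obtain a b where ab: "\<And>i z. i \<prec> succ \<zero> \<Longrightarrow> z \<prec> ?B \<Longrightarrow> in_code a b ?B i z \<longleftrightarrow> z = y"
    by (rule relation_code[where R = "\<lambda>i z \<rho>. z = \<rho> 0" and m = "succ \<zero>" and B = ?B and \<sigma> = "\<lambda>_. y"])
      (auto intro!: dfn_intros)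
  have "computation a b ?B \<zero>"
    unfolding computation_def using ab y in_code_def less_succ not_less_0 by metis
  moreover have "in_code a b ?B \<zero> y" using ab by (simp add: less_succ)
  ultimately show "\<exists>y. iterate \<zero> y" unfolding iterate_def by blast
next
  fix x assume "\<exists>y. iterate x y"
  then obtain y a b B where comp: "computation a b B x" and y: "in_code a b B x y"
    unfolding iterate_def by blast
  from comp y have "Z y \<or> (\<exists>u. G u y)"
    unfolding computation_def less_succ by blast
  then obtain z where z: "G y z" using ex_G by blast
  \<comment> \<open>The new bound admits z and all old values. The parameters of \<open>?R\<close>
    are, in order, the new position, the old code a, b, B, and the new value.\<close>
  let ?B = "B \<oplus> succ z" and ?\<sigma> = "case_nat (succ x) (case_nat a (case_nat b (case_nat B (\<lambda>_. z))))"
  let ?R = "\<lambda>i u \<rho>. i \<prec> \<rho> 0 \<and> in_code (\<rho> (Suc 0)) (\<rho> (Suc (Suc 0))) (\<rho> (Suc (Suc (Suc 0)))) i u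
    \<or> i = \<rho> 0 \<and> u = \<rho> (Suc (Suc (Suc (Suc 0))))"
  have "dfn L M (\<lambda>\<rho>. ?R (\<rho> 0) (\<rho> (Suc 0)) (\<lambda>i. \<rho> (Suc (Suc i))))"
    by (intro dfn_intros dfn_in_code)
  then obtain a' b' where ab: "\<And>i u. i \<prec> succ (succ x) \<Longrightarrow> u \<prec> ?B \<Longrightarrow> in_code a' b' ?B i u \<longleftrightarrow> ?R i u ?\<sigma>"
    using relation_code[where R = ?R and \<sigma> = ?\<sigma> and m = "succ (succ x)" and B = ?B] by blast
  have zB: "z \<prec> ?B" unfolding less_iff by (metis add_commute add_succ)
  have in_code': "in_code a' b' ?B i u \<longleftrightarrow> i \<prec> succ x \<and> in_code a b B i u \<or> i = succ x \<and> u = z"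
    if "i \<prec> succ (succ x)" for i u
    using ab[OF that, of u] zB less_add[of u B "succ z"] by (auto simp: in_code_def)
  have "computation a' b' ?B (succ x)"
    unfolding computation_def
  proof (intro allI impI, elim conjE)
    fix i u assume i: "i \<prec> succ (succ x)" and u: "in_code a' b' ?B i u"
    consider "i \<prec> succ x" "in_code a b B i u" | "i = succ x" "u = z" using in_code'[OF i] u by blast
    then show "i = \<zero> \<and> Z u \<or> (\<exists>j v. i = succ j \<and> in_code a' b' ?B j v \<and> G v u)"
    proof cases
      case 1
      then consider "i = \<zero>" "Z u" | j v where "i = succ j" "in_code a b B j v" "G v u"
        using comp unfolding computation_def by blast
      then show ?thesis
      proof cases
        case (2 j v)
        then have "j \<prec> i" by (simp add: less_succ)
        then have "j \<prec> succ x" "j \<prec> succ (succ x)" using 1 i less_trans by blast+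
        then show ?thesis using 2 in_code' by blast
      qed simp
    next
      case 2
      have "in_code a' b' ?B x y" using y in_code'[of x y] by (simp add: less_succ)
      then show ?thesis using 2 z by blast
    qed
  qed
  moreover have "in_code a' b' ?B (succ x) z" using in_code'[of "succ x" z] by (simp add: less_succ)
  ultimately show "\<exists>y. iterate (succ x) y" unfolding iterate_def by blast
qed

end

text \<open>The values of h lie in another type, so h itself cannot be definable in M; the relation
  E to representatives can. Iteration fixes a value only up to Q, and this uniqueness is an
  induction in M, hence the definability of Q is required.\<close>

lemma definable_recursion:
  fixes q :: "'a \<Rightarrow> 'b"
  assumes dfn: "dfn1 L M Z" "dfn2 L M G" "dfn2 L M Q"
    and Z: "\<And>y. Z y \<longleftrightarrow> D y \<and> q y = z"
    and G: "\<And>y y'. G y y' \<longleftrightarrow> D y \<and> D y' \<and> q y' = s (q y)"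
    and Q: "\<And>y y'. Q y y' \<longleftrightarrow> D y \<and> D y' \<and> q y = q y'"
    and surj: "\<And>v. \<exists>y. D y \<and> q y = v"
  obtains h E where "h \<zero> = z" "\<And>x. h (succ x) = s (h x)" "dfn2 L M E" "\<And>x y. E x y \<longleftrightarrow> D y \<and> q y = h x"
proof -
  have ex: "\<exists>y. Z y" "\<And>y. Z y \<or> (\<exists>x. G x y) \<Longrightarrow> \<exists>z. G y z"
    using surj unfolding Z G by blast+
  note it = dfn_iterate[OF dfn(1,2) ex] iterate_0[OF dfn(1,2) ex] iterate_succ[OF dfn(1,2) ex] ex_iterate[OF dfn(1,2) ex]
  let ?I = "iterate Z G"
  have unique: "\<forall>y y'. ?I x y \<and> ?I x y' \<longrightarrow> Q y y'" for x
  proof (rule induct1[where P = "\<lambda>x. \<forall>y y'. ?I x y \<and> ?I x y' \<longrightarrow> Q y y'"])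
    show "dfn1 L M (\<lambda>x. \<forall>y y'. ?I x y \<and> ?I x y' \<longrightarrow> Q y y')"
      by (intro dfn_intros dfn2_app[OF it(1)] dfn2_app[OF dfn(3)])
  next
    show "\<forall>y y'. ?I \<zero> y \<and> ?I \<zero> y' \<longrightarrow> Q y y'" using it(2) Z Q by metis
  next
    fix x assume IH: "\<forall>y y'. ?I x y \<and> ?I x y' \<longrightarrow> Q y y'"
    show "\<forall>y y'. ?I (succ x) y \<and> ?I (succ x) y' \<longrightarrow> Q y y'"
    proof (intro allI impI, elim conjE)
      fix y y' assume "?I (succ x) y" "?I (succ x) y'"
      then obtain u u' where "?I x u" "G u y" "?I x u'" "G u' y'" using it(3) by blast
      moreover from this have "q u = q u'" using IH unfolding Q by blast
      ultimately show "Q y y'" unfolding G Q by simp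
    qed
  qed
  define h where "h x = q (SOME y. ?I x y)" for x
  have D: "D y" if "?I x y" for x y using unique that Q by blast
  have h: "q y = h x" if "?I x y" for x y
    using unique that someI[of "?I x", OF that] unfolding h_def Q by blast
  show thesis
  \<comment> \<open>Closing under Q yields every representative of h x without exhibiting a trace
    for each of them.\<close>
  proof (rule that[of h "\<lambda>x y. \<exists>u. ?I x u \<and> Q u y"])
    show "h \<zero> = z" using it(4)[of \<zero>] it(2) h Z by metis
    show "h (succ x) = s (h x)" for x using it(4)[of "succ x"] it(3) h G by metis
    show "dfn2 L M (\<lambda>x y. \<exists>u. ?I x u \<and> Q u y)"
      by (intro dfn_intros dfn2_app[OF it(1)] dfn2_app[OF dfn(3)])
    show "(\<exists>u. ?I x u \<and> Q u y) \<longleftrightarrow> D y \<and> q y = h x" for x y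
      using it(4)[of x] D h unfolding Q by metis
  qed
qed

end

section \<open>Interpretations\<close>

definition holds :: "'a struct \<Rightarrow> fm \<Rightarrow> 'a list \<Rightarrow> bool" where
  "holds M p xs \<longleftrightarrow> sem M (\<lambda>i. if i < length xs then xs ! i else zeroS M) p"

text \<open>The padding by zero in \<open>holds\<close> lies beyond the free variables, so any
  assignment extending the tuple will do.\<close>

lemma holds_eq_sem:
  "fbound p \<le> length xs \<Longrightarrow> (\<And>i. i < length xs \<Longrightarrow> \<rho> i = xs ! i) \<Longrightarrow> holds M p xs \<longleftrightarrow> sem M \<rho> p"
  unfolding holds_def by (rule sem_cong) simp

lemma sem_app:
  "fbound p \<le> length ss \<Longrightarrow> sem M \<rho> (p\<lblot>ss\<rblot> m) \<longleftrightarrow> holds M p (map (\<lambda>s. tval M \<rho> (s m)) ss)"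
  unfolding app_def sem_fsub by (subst holds_eq_sem) auto

lemma dfn_holds1: "in_lang L p \<Longrightarrow> fbound p \<le> 1 \<Longrightarrow> dfn1 L M (\<lambda>x. holds M p [x])"
  by (rule dfnI[of _ p]) (auto intro!: holds_eq_sem)

lemma dfn_holds2: "in_lang L p \<Longrightarrow> fbound p \<le> 2 \<Longrightarrow> dfn2 L M (\<lambda>x y. holds M p [x, y])"
  by (rule dfnI[of _ p]) (auto intro!: holds_eq_sem simp: nth_Cons split: nat.split)

lemma dfn_holds3: "in_lang L p \<Longrightarrow> fbound p \<le> 3 \<Longrightarrow> dfn3 L M (\<lambda>x y z. holds M p [x, y, z])"
  by (rule dfnI[of _ p]) (auto intro!: holds_eq_sem simp: nth_Cons split: nat.split)

lemma interp_inD: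
  assumes "interp_in L L' K"
  shows "fbound (domain K) \<le> 1" "fbound (eqv K) \<le> 2" "fbound (zero_gr K) \<le> 1" "fbound (succ_gr K) \<le> 2"
    "fbound (plus_gr K) \<le> 3" "fbound (times_gr K) \<le> 3" "fbound (less_rel K) \<le> 2"
    "L = LAI \<Longrightarrow> fbound (ind_rel K) \<le> 1"
    "in_lang L' (domain K)" "in_lang L' (eqv K)" "in_lang L' (zero_gr K)" "in_lang L' (succ_gr K)"
    "in_lang L' (plus_gr K)" "in_lang L' (times_gr K)" "in_lang L' (less_rel K)"
    "L = LAI \<Longrightarrow> in_lang L' (ind_rel K)"
  using assms by (auto simp: interp_in_def split: if_splits)

text \<open>The names passed to \<^const>\<open>trt\<close> and \<^const>\<open>trf\<close> are evaluated below further binders, so their values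
  have to be invariant under these.\<close>

definition denotes :: "'a struct \<Rightarrow> (nat \<Rightarrow> 'a) \<Rightarrow> nat \<Rightarrow> tb \<Rightarrow> 'a \<Rightarrow> bool" where
  "denotes M \<rho> m t a \<longleftrightarrow> (\<forall>xs. tval M (foldr case_nat xs \<rho>) (t (m + length xs)) = a)"

lemma denotes_tval: "denotes M \<rho> m t a \<Longrightarrow> tval M \<rho> (t m) = a"
  unfolding denotes_def by (drule spec[of _ "[]"]) simp

lemma denotes_push:
  assumes "denotes M \<rho> m t a"
  shows "denotes M (case_nat x \<rho>) (Suc m) t a"
  unfolding denotes_def
proof
  fix xs
  show "tval M (foldr case_nat xs (case_nat x \<rho>)) (t (Suc m + length xs)) = a"
    using assms[unfolded denotes_def, THEN spec, of "xs @ [x]"] by simp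
qed

lemma foldr_case_nat: "foldr case_nat xs \<rho> (length xs + i) = \<rho> i"
  by (induction xs) auto

lemma denotes_bound: "denotes M (case_nat x \<rho>) (Suc m) (\<lambda>k. Var (k - Suc m)) x"
  unfolding denotes_def using foldr_case_nat[of _ "case_nat x \<rho>" 0] by simp

lemmas denotes_intros = denotes_push denotes_push[OF denotes_push] denotes_bound denotes_push[OF denotes_bound]

lemma denotes_free: "denotes M \<rho> 0 (\<lambda>k. Var (k + i)) (\<rho> i)"
  unfolding denotes_def using foldr_case_nat[of _ \<rho> i] by simp

text \<open>Here q is the quotient map from the domain modulo \<open>eqv\<close> onto all of N; off
  the domain its values are arbitrary. For L = \<open>LA\<close> the predicate \<open>indS\<close>
  of N is unconstrained.\<close>

locale interprets =
  fixes M :: "'a struct" and K :: interp and L :: lang and q :: "'a \<Rightarrow> 'b" and N :: "'b struct"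
  assumes bounds: "fbound (domain K) \<le> 1" "fbound (eqv K) \<le> 2" "fbound (zero_gr K) \<le> 1"
      "fbound (succ_gr K) \<le> 2" "fbound (plus_gr K) \<le> 3" "fbound (times_gr K) \<le> 3"
      "fbound (less_rel K) \<le> 2" "L = LAI \<Longrightarrow> fbound (ind_rel K) \<le> 1"
    and surj: "\<exists>x. holds M (domain K) [x] \<and> q x = b"
    and eqv_iff: "\<lbrakk>holds M (domain K) [x]; holds M (domain K) [y]\<rbrakk> \<Longrightarrow> holds M (eqv K) [x, y] \<longleftrightarrow> q x = q y"
    and zero_iff: "holds M (domain K) [x] \<Longrightarrow> holds M (zero_gr K) [x] \<longleftrightarrow> q x = zeroS N"
    and succ_iff: "\<lbrakk>holds M (domain K) [x]; holds M (domain K) [y]\<rbrakk> \<Longrightarrow>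
      holds M (succ_gr K) [x, y] \<longleftrightarrow> q y = succS N (q x)"
    and plus_iff: "\<lbrakk>holds M (domain K) [x]; holds M (domain K) [y]; holds M (domain K) [z]\<rbrakk> \<Longrightarrow>
      holds M (plus_gr K) [x, y, z] \<longleftrightarrow> q z = plusS N (q x) (q y)"
    and times_iff: "\<lbrakk>holds M (domain K) [x]; holds M (domain K) [y]; holds M (domain K) [z]\<rbrakk> \<Longrightarrow>
      holds M (times_gr K) [x, y, z] \<longleftrightarrow> q z = timesS N (q x) (q y)"
    and less_iff: "\<lbrakk>holds M (domain K) [x]; holds M (domain K) [y]\<rbrakk> \<Longrightarrow>
      holds M (less_rel K) [x, y] \<longleftrightarrow> lessS N (q x) (q y)"
    and ind_iff: "\<lbrakk>L = LAI; holds M (domain K) [x]\<rbrakk> \<Longrightarrow> holds M (ind_rel K) [x] \<longleftrightarrow> indS N (q x)"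
begin

abbreviation D where "D x \<equiv> holds M (domain K) [x]"

lemma ex_iff: "(\<exists>b. P b) \<longleftrightarrow> (\<exists>x. D x \<and> P (q x))"
  using surj by metis

lemma ex_val: "(\<exists>x. D x \<and> q x = b \<and> P (q x)) \<longleftrightarrow> P b"
  using surj[of b] by auto

lemma ex_val2: "(\<exists>x y. D x \<and> D y \<and> q x = b \<and> q y = c \<and> P (q x) (q y)) \<longleftrightarrow> P b c"
  using surj[of b] surj[of c] by auto

text \<open>The elements v i are those named by e i. Each existential quantifier over intermediate
  values collapses by \<open>ex_val\<close> or \<open>ex_val2\<close>, as q is onto and the other
  conditions depend on q alone.\<close>

lemma sem_trt:
  assumes "\<And>i. i < tbound t \<Longrightarrow> denotes M \<rho> m (e i) (v i) \<and> D (v i)" "denotes M \<rho> m x a" "D a"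
  shows "sem M \<rho> (trt K e t x m) \<longleftrightarrow> q a = tval N (\<lambda>i. q (v i)) t"
  using assms
proof (induction t arbitrary: \<rho> m x a)
  case (Var i)
  then have "tval M \<rho> (e i m) = v i" "D (v i)" using denotes_tval[of M \<rho> m "e i"] by auto
  then show ?case
    using eqv_iff[of "v i" a] bounds Var.prems(3) denotes_tval[OF Var.prems(2)] by (auto simp: sem_app)
next
  case Zero
  then show ?case using zero_iff[of a] bounds by (auto simp: sem_app denotes_tval)
next
  case (Succ t)
  have IH: "sem M (case_nat y \<rho>) (trt K e t (\<lambda>k. Var (k - Suc m)) (Suc m)) \<longleftrightarrow> q y = tval N (\<lambda>i. q (v i)) t"
    if "D y" for y
    by (rule Succ.IH) (use Succ.prems that in \<open>auto intro: denotes_intros\<close>)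
  have "sem M \<rho> (trt K e (Succ t) x m) \<longleftrightarrow> (\<exists>y. D y \<and> q y = tval N (\<lambda>i. q (v i)) t \<and> q a = succS N (q y))"
    using bounds IH succ_iff[OF _ Succ.prems(3)] denotes_tval[OF denotes_push[OF Succ.prems(2)]]
    by (auto simp: bEx_def bAnd_def sem_app)
  also have "\<dots> \<longleftrightarrow> q a = succS N (tval N (\<lambda>i. q (v i)) t)"
    by (rule ex_val[where P = "\<lambda>b. q a = succS N b"])
  finally show ?case by simp
next
  case (Plus s t)
  have s: "sem M (case_nat z (case_nat y \<rho>)) (trt K e s (\<lambda>k. Var (k - Suc m)) (Suc (Suc m))) \<longleftrightarrow> q y = tval N (\<lambda>i. q (v i)) s"
    if "D y" for y z
    by (rule Plus.IH(1)) (use Plus.prems that in \<open>auto intro: denotes_intros\<close>)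
  have t: "sem M (case_nat z (case_nat y \<rho>)) (trt K e t (\<lambda>k. Var (k - Suc (Suc m))) (Suc (Suc m))) \<longleftrightarrow> q z = tval N (\<lambda>i. q (v i)) t"
    if "D z" for y z
    by (rule Plus.IH(2)) (use Plus.prems that in \<open>auto intro: denotes_intros\<close>)
  have "sem M \<rho> (trt K e (Plus s t) x m) \<longleftrightarrow> (\<exists>y z. D y \<and> D z \<and>
      sem M (case_nat z (case_nat y \<rho>)) (trt K e s (\<lambda>k. Var (k - Suc m)) (Suc (Suc m))) \<and>
      sem M (case_nat z (case_nat y \<rho>)) (trt K e t (\<lambda>k. Var (k - Suc (Suc m))) (Suc (Suc m))) \<and>
      holds M (plus_gr K) [y, z, a])"
    using bounds denotes_tval[OF denotes_push[OF denotes_push[OF Plus.prems(2)]]]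
    by (simp add: bEx_def bAnd_def sem_app Suc_diff_le) blast
  also have "\<dots> \<longleftrightarrow>
      (\<exists>y z. D y \<and> D z \<and> q y = tval N (\<lambda>i. q (v i)) s \<and> q z = tval N (\<lambda>i. q (v i)) t \<and> q a = plusS N (q y) (q z))"
    using s t plus_iff[OF _ _ Plus.prems(3)] by (intro ex_cong1) blast
  also have "\<dots> \<longleftrightarrow> q a = plusS N (tval N (\<lambda>i. q (v i)) s) (tval N (\<lambda>i. q (v i)) t)"
    by (rule ex_val2[where P = "\<lambda>b c. q a = plusS N b c"])
  finally show ?case by simp
next
  case (Times s t)
  have s: "sem M (case_nat z (case_nat y \<rho>)) (trt K e s (\<lambda>k. Var (k - Suc m)) (Suc (Suc m))) \<longleftrightarrow> q y = tval N (\<lambda>i. q (v i)) s"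
    if "D y" for y z
    by (rule Times.IH(1)) (use Times.prems that in \<open>auto intro: denotes_intros\<close>)
  have t: "sem M (case_nat z (case_nat y \<rho>)) (trt K e t (\<lambda>k. Var (k - Suc (Suc m))) (Suc (Suc m))) \<longleftrightarrow> q z = tval N (\<lambda>i. q (v i)) t"
    if "D z" for y z
    by (rule Times.IH(2)) (use Times.prems that in \<open>auto intro: denotes_intros\<close>)
  have "sem M \<rho> (trt K e (Times s t) x m) \<longleftrightarrow> (\<exists>y z. D y \<and> D z \<and>
      sem M (case_nat z (case_nat y \<rho>)) (trt K e s (\<lambda>k. Var (k - Suc m)) (Suc (Suc m))) \<and>
      sem M (case_nat z (case_nat y \<rho>)) (trt K e t (\<lambda>k. Var (k - Suc (Suc m))) (Suc (Suc m))) \<and>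
      holds M (times_gr K) [y, z, a])"
    using bounds denotes_tval[OF denotes_push[OF denotes_push[OF Times.prems(2)]]]
    by (simp add: bEx_def bAnd_def sem_app Suc_diff_le) blast
  also have "\<dots> \<longleftrightarrow>
      (\<exists>y z. D y \<and> D z \<and> q y = tval N (\<lambda>i. q (v i)) s \<and> q z = tval N (\<lambda>i. q (v i)) t \<and> q a = timesS N (q y) (q z))"
    using s t times_iff[OF _ _ Times.prems(3)] by (intro ex_cong1) blast
  also have "\<dots> \<longleftrightarrow> q a = timesS N (tval N (\<lambda>i. q (v i)) s) (tval N (\<lambda>i. q (v i)) t)"
    by (rule ex_val2[where P = "\<lambda>b c. q a = timesS N b c"])
  finally show ?case by simp
qed

lemma sem_trf:
  assumes "in_lang L p" "\<And>i. i < fbound p \<Longrightarrow> denotes M \<rho> m (e i) (v i) \<and> D (v i)"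
  shows "sem M \<rho> (trf K e p m) \<longleftrightarrow> sem N (\<lambda>i. q (v i)) p"
  using assms
proof (induction p arbitrary: \<rho> m e v)
  case (Eq s t)
  have s: "sem M (case_nat x \<rho>) (trt K e s (\<lambda>k. Var (k - Suc m)) (Suc m)) \<longleftrightarrow> q x = tval N (\<lambda>i. q (v i)) s"
    if "D x" for x
    by (rule sem_trt) (use Eq.prems that in \<open>auto intro: denotes_intros\<close>)
  have t: "sem M (case_nat x \<rho>) (trt K e t (\<lambda>k. Var (k - Suc m)) (Suc m)) \<longleftrightarrow> q x = tval N (\<lambda>i. q (v i)) t"
    if "D x" for x
    by (rule sem_trt) (use Eq.prems that in \<open>auto intro: denotes_intros\<close>)
  have "sem M \<rho> (trf K e (Eq s t) m) \<longleftrightarrow> (\<exists>x. D x \<and> q x = tval N (\<lambda>i. q (v i)) s \<and> q x = tval N (\<lambda>i. q (v i)) t)"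
    using bounds s t by (auto simp: bEx_def bAnd_def sem_app)
  also have "\<dots> \<longleftrightarrow> tval N (\<lambda>i. q (v i)) s = tval N (\<lambda>i. q (v i)) t"
    using ex_val[where P = "\<lambda>b. b = tval N (\<lambda>i. q (v i)) t"] .
  finally show ?case by simp
next
  case (Lt s t)
  have s: "sem M (case_nat y (case_nat x \<rho>)) (trt K e s (\<lambda>k. Var (k - Suc m)) (Suc (Suc m))) \<longleftrightarrow> q x = tval N (\<lambda>i. q (v i)) s"
    if "D x" for x y
    by (rule sem_trt) (use Lt.prems that in \<open>auto intro: denotes_intros\<close>)
  have t: "sem M (case_nat y (case_nat x \<rho>)) (trt K e t (\<lambda>k. Var (k - Suc (Suc m))) (Suc (Suc m))) \<longleftrightarrow> q y = tval N (\<lambda>i. q (v i)) t"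
    if "D y" for x y
    by (rule sem_trt) (use Lt.prems that in \<open>auto intro: denotes_intros\<close>)
  have "sem M \<rho> (trf K e (Lt s t) m) \<longleftrightarrow> (\<exists>x y. D x \<and> D y \<and>
      sem M (case_nat y (case_nat x \<rho>)) (trt K e s (\<lambda>k. Var (k - Suc m)) (Suc (Suc m))) \<and>
      sem M (case_nat y (case_nat x \<rho>)) (trt K e t (\<lambda>k. Var (k - Suc (Suc m))) (Suc (Suc m))) \<and>
      holds M (less_rel K) [x, y])"
    using bounds by (simp add: bEx_def bAnd_def sem_app Suc_diff_le) blast
  also have "\<dots> \<longleftrightarrow>
      (\<exists>x y. D x \<and> D y \<and> q x = tval N (\<lambda>i. q (v i)) s \<and> q y = tval N (\<lambda>i. q (v i)) t \<and> lessS N (q x) (q y))"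
    using s t less_iff by (intro ex_cong1) blast
  also have "\<dots> \<longleftrightarrow> lessS N (tval N (\<lambda>i. q (v i)) s) (tval N (\<lambda>i. q (v i)) t)"
    by (rule ex_val2[where P = "lessS N"])
  finally show ?case by simp
next
  case (Ind t)
  have t: "sem M (case_nat x \<rho>) (trt K e t (\<lambda>k. Var (k - Suc m)) (Suc m)) \<longleftrightarrow> q x = tval N (\<lambda>i. q (v i)) t"
    if "D x" for x
    by (rule sem_trt) (use Ind.prems that in \<open>auto intro: denotes_intros\<close>)
  have L: "L = LAI" using Ind.prems by simp
  have "sem M \<rho> (trf K e (Ind t) m) \<longleftrightarrow> (\<exists>x. D x \<and> q x = tval N (\<lambda>i. q (v i)) t \<and> indS N (q x))"
    using bounds t L ind_iff by (auto simp: bEx_def bAnd_def sem_app)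
  also have "\<dots> \<longleftrightarrow> indS N (tval N (\<lambda>i. q (v i)) t)"
    by (rule ex_val)
  finally show ?case by simp
next
  case (Neg p)
  then show ?case by (simp add: bNot_def)
next
  case (Or p r)
  have "sem M \<rho> (trf K e p m) = sem N (\<lambda>i. q (v i)) p" "sem M \<rho> (trf K e r m) = sem N (\<lambda>i. q (v i)) r"
    using Or.prems by (auto intro!: Or.IH)
  then show ?case by (simp add: bOr_def)
next
  case (Ex p)
  have IH: "sem M (case_nat x \<rho>) (trf K (case_nat (\<lambda>k. Var (k - Suc m)) e) p (Suc m)) \<longleftrightarrow>
      sem N (case_nat (q x) (\<lambda>i. q (v i))) p" if "D x" for x
  proof -
    have "sem M (case_nat x \<rho>) (trf K (case_nat (\<lambda>k. Var (k - Suc m)) e) p (Suc m)) \<longleftrightarrow>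
      sem N (\<lambda>i. q (case_nat x v i)) p"
      by (rule Ex.IH) (use Ex.prems that in \<open>auto intro: denotes_intros split: nat.split\<close>)
    also have "(\<lambda>i. q (case_nat x v i)) = case_nat (q x) (\<lambda>i. q (v i))"
      by (auto simp: fun_eq_iff split: nat.split)
    finally show ?thesis .
  qed
  have "sem M \<rho> (trf K e (Ex p) m) \<longleftrightarrow> (\<exists>x. D x \<and> sem N (case_nat (q x) (\<lambda>i. q (v i))) p)"
    using bounds IH by (auto simp: bEx_def bAnd_def sem_app)
  then show ?case using ex_iff[of "\<lambda>b. sem N (case_nat b (\<lambda>i. q (v i))) p"] by simp
qed

lemma sem_tr:
  assumes "in_lang L p" "\<And>i. i < fbound p \<Longrightarrow> D (\<rho> i)"
  shows "sem M \<rho> (tr K p) \<longleftrightarrow> sem N (\<lambda>i. q (\<rho> i)) p"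
  unfolding tr_def by (rule sem_trf) (use assms in \<open>auto intro: denotes_free\<close>)

text \<open>Every assignment in N lifts to one in the domain by choosing representatives; in this
  way N inherits the axioms.\<close>

lemma sem_if_tr:
  assumes "in_lang L p" "\<And>\<rho>. sem M \<rho> (tr K p)"
  shows "sem N \<rho> p"
proof -
  obtain d where "\<And>b. D (d b) \<and> q (d b) = b" using surj by metis
  then show ?thesis using sem_tr[OF assms(1), of "\<lambda>i. d (\<rho> i)"] assms(2) by simp
qed

end

section \<open>Language and free variables of translated formulas\<close>

lemma in_lang_app [simp]: "in_lang L (p\<lblot>ss\<rblot> m) = in_lang L p"
  by (simp add: app_def)

lemma in_lang_trf:
  assumes "interp_in L L' K" "in_lang L p"
  shows "in_lang L' (trf K e p m)"
proof -
  note K = interp_inD[OF assms(1)]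
  have trt: "in_lang L' (trt K e t x m)" for e t x m
    by (induction t arbitrary: x m) (auto simp: fb_defs K)
  show ?thesis
    using assms(2)
  proof (induction p arbitrary: e m)
    case (Ind t)
    then show ?case using K(8,16) by (simp add: fb_defs K trt)
  qed (auto simp: fb_defs K trt)
qed

lemma in_lang_tr: "interp_in L L' K \<Longrightarrow> in_lang L p \<Longrightarrow> in_lang L' (tr K p)"
  unfolding tr_def by (rule in_lang_trf)

lemma tbound_tsub: "(\<And>i. i < tbound t \<Longrightarrow> tbound (f i) \<le> n) \<Longrightarrow> tbound (tsub f t) \<le> n"
  by (induction t) auto

lemma fbound_fsub: "(\<And>i. i < fbound p \<Longrightarrow> tbound (f i) \<le> n) \<Longrightarrow> fbound (fsub f p) \<le> n"
proof (induction p arbitrary: f n)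
  case (Ex p)
  have "fbound (fsub (under_binder f) p) \<le> Suc n"
  proof (rule Ex.IH)
    fix i assume i: "i < fbound p"
    show "tbound (under_binder f i) \<le> Suc n"
    proof (cases i)
      case (Suc j)
      then have "tbound (f j) \<le> n" using i Ex.prems by simp
      then show ?thesis using Suc by (auto simp: under_binder_def intro!: tbound_tsub)
    qed (simp add: under_binder_def)
  qed
  then show ?case by simp
qed (auto intro!: tbound_tsub)

lemma fbound_app: "fbound p \<le> length ss \<Longrightarrow> (\<And>s. s \<in> set ss \<Longrightarrow> tbound (s m) \<le> n) \<Longrightarrow> fbound (p\<lblot>ss\<rblot> m) \<le> n"
  unfolding app_def by (rule fbound_fsub) auto

text \<open>Needed for \<open>icomp I J\<close> to obey the arity bounds again. A name evaluated at
  depth k may use indices up to n + k, and this shape of bound is stable under further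
  binders.\<close>

lemma fbound_trf:
  assumes K: "interp_in L L' K" "in_lang L p"
    and "\<And>i k. i < fbound p \<Longrightarrow> m \<le> k \<Longrightarrow> tbound (e i k) \<le> n + k"
  shows "fbound (trf K e p m) \<le> n + m"
proof -
  note K = interp_inD[OF K(1), unfolded One_nat_def numeral_2_eq_2 numeral_3_eq_3]
  have trt: "fbound (trt K e t x m) \<le> n + m"
    if "\<And>i k. i < tbound t \<Longrightarrow> m \<le> k \<Longrightarrow> tbound (e i k) \<le> n + k" "\<And>k. m \<le> k \<Longrightarrow> tbound (x k) \<le> n + k"
    for e t x m
    using that
  proof (induction t arbitrary: x m)
    case (Succ t)
    have "fbound (trt K e t (\<lambda>k. Var (k - Suc m)) (Suc m)) \<le> n + Suc m"
      by (rule Succ.IH) (use Succ.prems in auto)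
    then show ?case using Succ.prems(2)[of "Suc m"] by (auto simp: fb_defs K le_diff_conv intro!: fbound_app)
  next
    case (Plus s t)
    have "fbound (trt K e s (\<lambda>k. Var (k - Suc m)) (Suc (Suc m))) \<le> n + Suc (Suc m)"
      "fbound (trt K e t (\<lambda>k. Var (k - Suc (Suc m))) (Suc (Suc m))) \<le> n + Suc (Suc m)"
      by (rule Plus.IH; use Plus.prems in auto)+
    then show ?case using Plus.prems(2)[of "Suc (Suc m)"] by (auto simp: fb_defs K le_diff_conv intro!: fbound_app)
  next
    case (Times s t)
    have "fbound (trt K e s (\<lambda>k. Var (k - Suc m)) (Suc (Suc m))) \<le> n + Suc (Suc m)"
      "fbound (trt K e t (\<lambda>k. Var (k - Suc (Suc m))) (Suc (Suc m))) \<le> n + Suc (Suc m)"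
      by (rule Times.IH; use Times.prems in auto)+
    then show ?case using Times.prems(2)[of "Suc (Suc m)"] by (auto simp: fb_defs K le_diff_conv intro!: fbound_app)
  qed (auto simp: fb_defs K le_diff_conv intro!: fbound_app)
  show ?thesis
    using assms(2,3)
  proof (induction p arbitrary: e m)
    case (Eq s t)
    have "fbound (trt K e s (\<lambda>k. Var (k - Suc m)) (Suc m)) \<le> n + Suc m"
      "fbound (trt K e t (\<lambda>k. Var (k - Suc m)) (Suc m)) \<le> n + Suc m"
      by (rule trt; use Eq.prems in auto)+
    then show ?case by (auto simp: fb_defs K le_diff_conv intro!: fbound_app)
  next
    case (Lt s t)
    have "fbound (trt K e s (\<lambda>k. Var (k - Suc m)) (Suc (Suc m))) \<le> n + Suc (Suc m)"
      "fbound (trt K e t (\<lambda>k. Var (k - Suc (Suc m))) (Suc (Suc m))) \<le> n + Suc (Suc m)"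
      by (rule trt; use Lt.prems in auto)+
    then show ?case by (auto simp: fb_defs K le_diff_conv intro!: fbound_app)
  next
    case (Ind t)
    have "fbound (trt K e t (\<lambda>k. Var (k - Suc m)) (Suc m)) \<le> n + Suc m"
      by (rule trt; use Ind.prems in auto)+
    then show ?case using K(8) Ind.prems by (auto simp: fb_defs K le_diff_conv intro!: fbound_app)
  next
    case (Ex p)
    have "fbound (trf K (case_nat (\<lambda>k. Var (k - Suc m)) e) p (Suc m)) \<le> n + Suc m"
    proof (rule Ex.IH)
      fix i k assume "i < fbound p" "Suc m \<le> k"
      then show "tbound (case_nat (\<lambda>k. Var (k - Suc m)) e i k) \<le> n + k"
        using Ex.prems(2)[of "i - 1" k] by (cases i) auto
    qed (use Ex.prems in simp)
    then show ?case by (auto simp: fb_defs K le_diff_conv intro!: fbound_app)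
  qed (auto simp: fb_defs)
qed

lemma fbound_tr: "interp_in L L' K \<Longrightarrow> in_lang L p \<Longrightarrow> fbound (tr K p) \<le> fbound p"
  unfolding tr_def using fbound_trf[of L L' K p 0 "\<lambda>i k. Var (k + i)" "fbound p"] by auto

lemma in_lang_PA_axioms:
  assumes "p \<in> PA_axioms L"
  shows "in_lang L p"
proof -
  have "in_lang L ((All ^^ n) p) = in_lang L p" for n p
    by (induction n) auto
  then have "in_lang L p \<Longrightarrow> in_lang L (induction p)" for p
    by (simp add: induction_def univ_closure_def inst_def)
  then show ?thesis using assms by (auto simp: PA_axioms_def fb_defs)
qed

section \<open>The model defined by an interpretation\<close>

lemma logical_conditionsD:
  assumes K: "interp_in L L' K"
    and lc: "\<And>p. p \<in> logical_conditions L K \<Longrightarrow> sem M (\<lambda>_. zeroS M) p"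
  defines "D x \<equiv> holds M (domain K) [x]"
    and "E x y \<equiv> holds M (eqv K) [x, y]"
  shows "D x \<Longrightarrow> E x x"
    and "D x \<Longrightarrow> D y \<Longrightarrow> E x y \<Longrightarrow> E y x"
    and "D x \<Longrightarrow> D y \<Longrightarrow> D z \<Longrightarrow> E x y \<Longrightarrow> E y z \<Longrightarrow> E x z"
    and "\<exists>x. D x \<and> holds M (zero_gr K) [x]"
    and "D x \<Longrightarrow> D x' \<Longrightarrow> holds M (zero_gr K) [x] \<Longrightarrow> holds M (zero_gr K) [x'] \<longleftrightarrow> E x x'"
    and "D x \<Longrightarrow> D x' \<Longrightarrow> D y \<Longrightarrow> D y' \<Longrightarrow> E x x' \<Longrightarrow> E y y' \<Longrightarrow>
      holds M (less_rel K) [x, y] \<Longrightarrow> holds M (less_rel K) [x', y']"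
    and "D x \<Longrightarrow> \<exists>y. D y \<and> holds M (succ_gr K) [x, y]"
    and "D x \<Longrightarrow> D x' \<Longrightarrow> D y \<Longrightarrow> D y' \<Longrightarrow> E x x' \<Longrightarrow> holds M (succ_gr K) [x, y] \<Longrightarrow>
      holds M (succ_gr K) [x', y'] \<longleftrightarrow> E y y'"
    and "f \<in> {plus_gr K, times_gr K} \<Longrightarrow> D x \<Longrightarrow> D y \<Longrightarrow> \<exists>z. D z \<and> holds M f [x, y, z]"
    and "f \<in> {plus_gr K, times_gr K} \<Longrightarrow> D x \<Longrightarrow> D x' \<Longrightarrow> D y \<Longrightarrow> D y' \<Longrightarrow> D z \<Longrightarrow> D z' \<Longrightarrow>
      E x x' \<Longrightarrow> E y y' \<Longrightarrow> holds M f [x, y, z] \<Longrightarrow> holds M f [x', y', z'] \<longleftrightarrow> E z z'"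
    and "L = LAI \<Longrightarrow> D x \<Longrightarrow> D x' \<Longrightarrow> E x x' \<Longrightarrow> holds M (ind_rel K) [x] \<Longrightarrow> holds M (ind_rel K) [x']"
proof -
  note K = interp_inD[OF K, unfolded One_nat_def numeral_2_eq_2 numeral_3_eq_3]
  have lc: "\<forall>p\<in>logical_conditions L K. sem M (\<lambda>_. zeroS M) p" using lc by blast
  note lc' = lc[unfolded logical_conditions_def image_Un ball_Un image_insert image_empty ball_simps fb_defs]
  note c1 = lc'[THEN conjunct1, THEN conjunct1, THEN conjunct2]
  note c2 = c1[THEN conjunct2]
  note c3 = c2[THEN conjunct2]
  note c4 = c3[THEN conjunct2]
  note c5 = c4[THEN conjunct2]
  note c6 = c5[THEN conjunct2]
  note c7 = c6[THEN conjunct2]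
  note c8 = c7[THEN conjunct2]
  show "D x \<Longrightarrow> E x x"
    using c1[THEN conjunct1] unfolding D_def E_def by (simp (no_asm_use) add: sem_app K(1-7)) blast
  show "D x \<Longrightarrow> D y \<Longrightarrow> E x y \<Longrightarrow> E y x"
    using c2[THEN conjunct1] unfolding D_def E_def by (simp (no_asm_use) add: sem_app K(1-7)) blast
  show "D x \<Longrightarrow> D y \<Longrightarrow> D z \<Longrightarrow> E x y \<Longrightarrow> E y z \<Longrightarrow> E x z"
    using c3[THEN conjunct1] unfolding D_def E_def by (simp (no_asm_use) add: sem_app K(1-7)) blast
  show "\<exists>x. D x \<and> holds M (zero_gr K) [x]"
    using c4[THEN conjunct1] unfolding D_def E_def by (simp (no_asm_use) add: sem_app K(1-7))
  show "D x \<Longrightarrow> D x' \<Longrightarrow> holds M (zero_gr K) [x] \<Longrightarrow> holds M (zero_gr K) [x'] \<longleftrightarrow> E x x'"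
    using c5[THEN conjunct1] unfolding D_def E_def by (simp (no_asm_use) add: sem_app K(1-7)) blast
  show "D x \<Longrightarrow> D x' \<Longrightarrow> D y \<Longrightarrow> D y' \<Longrightarrow> E x x' \<Longrightarrow> E y y' \<Longrightarrow>
      holds M (less_rel K) [x, y] \<Longrightarrow> holds M (less_rel K) [x', y']"
    using c6[THEN conjunct1] unfolding D_def E_def by (simp (no_asm_use) add: sem_app K(1-7)) blast
  show "D x \<Longrightarrow> \<exists>y. D y \<and> holds M (succ_gr K) [x, y]"
    using c7[THEN conjunct1] unfolding D_def E_def by (simp (no_asm_use) add: sem_app K(1-7)) blast
  show "D x \<Longrightarrow> D x' \<Longrightarrow> D y \<Longrightarrow> D y' \<Longrightarrow> E x x' \<Longrightarrow> holds M (succ_gr K) [x, y] \<Longrightarrow>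
      holds M (succ_gr K) [x', y'] \<longleftrightarrow> E y y'"
    using c8[THEN conjunct1] unfolding D_def E_def by (simp (no_asm_use) add: sem_app K(1-7)) blast
  note d = lc'[THEN conjunct1, THEN conjunct2, unfolded Union_insert Union_empty Un_empty_right ball_Un ball_simps]
  have total: "D x \<Longrightarrow> D y \<Longrightarrow> \<exists>z. D z \<and> holds M (plus_gr K) [x, y, z]"
    "D x \<Longrightarrow> D y \<Longrightarrow> \<exists>z. D z \<and> holds M (times_gr K) [x, y, z]"
    using d[THEN conjunct1, THEN conjunct1] d[THEN conjunct2, THEN conjunct1] unfolding D_def
    by (simp_all (no_asm_use) add: sem_app K(1-7)) blast+
  then show "f \<in> {plus_gr K, times_gr K} \<Longrightarrow> D x \<Longrightarrow> D y \<Longrightarrow> \<exists>z. D z \<and> holds M f [x, y, z]"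
    by blast
  have "D x \<Longrightarrow> D x' \<Longrightarrow> D y \<Longrightarrow> D y' \<Longrightarrow> D z \<Longrightarrow> D z' \<Longrightarrow>
      E x x' \<Longrightarrow> E y y' \<Longrightarrow> holds M (plus_gr K) [x, y, z] \<Longrightarrow> holds M (plus_gr K) [x', y', z'] \<longleftrightarrow> E z z'"
    using d[THEN conjunct1, THEN conjunct2, THEN conjunct1] unfolding D_def E_def
    by (simp (no_asm_use) add: sem_app K(1-7)) blast
  moreover have "D x \<Longrightarrow> D x' \<Longrightarrow> D y \<Longrightarrow> D y' \<Longrightarrow> D z \<Longrightarrow> D z' \<Longrightarrow>
      E x x' \<Longrightarrow> E y y' \<Longrightarrow> holds M (times_gr K) [x, y, z] \<Longrightarrow> holds M (times_gr K) [x', y', z'] \<longleftrightarrow> E z z'"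
    using d[THEN conjunct2, THEN conjunct2, THEN conjunct1] unfolding D_def E_def
    by (simp (no_asm_use) add: sem_app K(1-7)) blast
  ultimately show "f \<in> {plus_gr K, times_gr K} \<Longrightarrow> D x \<Longrightarrow> D x' \<Longrightarrow> D y \<Longrightarrow> D y' \<Longrightarrow> D z \<Longrightarrow> D z' \<Longrightarrow>
      E x x' \<Longrightarrow> E y y' \<Longrightarrow> holds M f [x, y, z] \<Longrightarrow> holds M f [x', y', z'] \<longleftrightarrow> E z z'"
    by blast
  show "holds M (ind_rel K) [x']" if "L = LAI" "D x" "D x'" "E x x'" "holds M (ind_rel K) [x]"
    using lc'[THEN conjunct2] that(2-) unfolding D_def E_def
    by (simp (no_asm_use) add: \<open>L = LAI\<close> sem_app K(1-8)) blast
qed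

text \<open>Stated for representatives because the number of \<open>eqv\<close> classes has to be
  known before N can be built. The extra variables are the intermediate values that
  \<open>trt\<close> introduces.\<close>

lemma interpreted_successor:
  assumes K: "interp_in L L' K"
    and "\<And>p. p \<in> PA_axioms L \<Longrightarrow> sem M (\<lambda>_. zeroS M) (tr K p)"
  defines "D x \<equiv> holds M (domain K) [x]"
    and "E x y \<equiv> holds M (eqv K) [x, y]"
  shows "\<lbrakk>D x; D y; D z; E x z; holds M (succ_gr K) [z, y]\<rbrakk> \<Longrightarrow> \<not> holds M (zero_gr K) [y]"
    and "\<lbrakk>D x; D y; D z; D u; D v; E x z; holds M (succ_gr K) [z, v]; E y u; holds M (succ_gr K) [u, v]\<rbrakk>
      \<Longrightarrow> \<exists>w. D w \<and> E x w \<and> E y w"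
proof -
  note K = interp_inD[OF K, unfolded One_nat_def numeral_2_eq_2 numeral_3_eq_3]
  have "sem M (\<lambda>_. zeroS M) (tr K ((\<^bold>\<forall>x. \<^bold>\<not> \<^bold>S x \<^bold>= \<^bold>0) 0))"
    by (rule assms(2)) (simp add: PA_axioms_def)
  then have "\<forall>x. D x \<longrightarrow> (\<forall>y. D y \<longrightarrow> (\<forall>z. D z \<longrightarrow> E x z \<longrightarrow> holds M (succ_gr K) [z, y] \<longrightarrow> \<not> holds M (zero_gr K) [y]))"
    unfolding D_def E_def by (simp (no_asm_use) add: tr_def fb_defs sem_app K(1-7)) blast
  then show "\<lbrakk>D x; D y; D z; E x z; holds M (succ_gr K) [z, y]\<rbrakk> \<Longrightarrow> \<not> holds M (zero_gr K) [y]"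
    by blast
  have "sem M (\<lambda>_. zeroS M) (tr K ((\<^bold>\<forall>x y. \<^bold>S x \<^bold>= \<^bold>S y \<^bold>\<longrightarrow> x \<^bold>= y) 0))"
    by (rule assms(2)) (simp add: PA_axioms_def)
  then show "\<exists>w. D w \<and> E x w \<and> E y w"
    if "D x" "D y" "D z" "D u" "D v" "E x z" "holds M (succ_gr K) [z, v]" "E y u" "holds M (succ_gr K) [u, v]"
    using that unfolding D_def E_def by (simp (no_asm_use) add: tr_def fb_defs sem_app K(1-7)) blast
qed

text \<open>The classes of \<open>eqv\<close> are represented by their least elements. There are infinitely many, the
  successor being injective and not surjective on them, so they can be enumerated by all of nat.\<close>

lemma ex_interpreted_structure:
  fixes M :: "nat struct"
  assumes I: "interpretation_of_in K U V" and M: "models M (axms V)"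
    and U: "PA_axioms (language U) \<subseteq> axms U" "\<And>p. p \<in> axms U \<Longrightarrow> in_lang (language U) p"
  obtains q and N :: "nat struct" where "interprets M K (language U) q N" "models N (axms U)"
proof -
  have K: "interp_in (language U) (language V) K" using I by (simp add: interpretation_of_in_def)
  have tr: "sem M \<rho> (tr K p)" if "p \<in> axms U" for \<rho> p
    using I that models_provable[OF M] by (auto simp: interpretation_of_in_def)
  have lc: "p \<in> logical_conditions (language U) K \<Longrightarrow> sem M (\<lambda>_. zeroS M) p" for p
    using I models_provable[OF M] by (auto simp: interpretation_of_in_def)
  let ?D = "\<lambda>x. holds M (domain K) [x]" and ?E = "\<lambda>x y. holds M (eqv K) [x, y]"
    and ?S = "\<lambda>x y. holds M (succ_gr K) [x, y]"
  note L = logical_conditionsD[OF K lc, simplified]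
  note succ = interpreted_successor[OF K tr[OF subsetD[OF U(1)]], simplified]
  define rep where "rep x = (LEAST y. ?D y \<and> ?E x y)" for x
  have rep: "?D (rep x) \<and> ?E x (rep x)" if "?D x" for x
    unfolding rep_def by (rule LeastI[of "\<lambda>y. ?D y \<and> ?E x y"]) (use that L(1) in blast)
  have rep_eq: "rep x = rep y \<longleftrightarrow> ?E x y" if "?D x" "?D y" for x y
  proof
    assume "rep x = rep y"
    then show "?E x y" using rep[of x] rep[of y] that L(2,3) by metis
  next
    assume "?E x y"
    then have "(?D z \<and> ?E x z) \<longleftrightarrow> (?D z \<and> ?E y z)" for z using that L(2,3) by blast
    then show "rep x = rep y" unfolding rep_def by simp
  qed
  let ?R = "rep ` {x. ?D x}"
  have "infinite ?R"
  proof
    assume fin: "finite ?R"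
    obtain s where s: "\<And>x. ?D x \<Longrightarrow> ?D (s x) \<and> ?S x (s x)" using L(7) by metis
    have "inj_on (\<lambda>x. rep (s x)) ?R"
    proof (rule inj_onI)
      fix x y assume "x \<in> ?R" "y \<in> ?R" and eq: "rep (s x) = rep (s y)"
      then have D: "?D x" "?D y" "x = rep x" "y = rep y" using rep rep_eq by auto
      then have Sy: "?S y (s x)" using rep_eq[of "s x" "s y"] s eq L(8)[of y y "s y" "s x"] L(1,2) by blast
      obtain w where "?D w" "?E x w" "?E y w"
        using succ(2)[of x y x y "s x"] D s Sy L(1) by blast
      then have "?E x y" using D L(2,3) by blast
      then show "x = y" using rep_eq D by metis
    qed
    moreover have "(\<lambda>x. rep (s x)) ` ?R \<subseteq> ?R" using rep s by auto
    ultimately have surj: "(\<lambda>x. rep (s x)) ` ?R = ?R" using endo_inj_surj[OF fin] by blast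
    obtain z where z: "?D z" "holds M (zero_gr K) [z]" using L(4) by blast
    then have "rep z \<in> (\<lambda>x. rep (s x)) ` ?R" using surj by blast
    then obtain x where x: "?D x" "rep z = rep (s x)" using rep by auto
    then have "holds M (zero_gr K) [s x]" using rep_eq[of z "s x"] s z L(5)[of z "s x"] by blast
    then show False using succ(1)[of x "s x" x] x s L(1) by blast
  qed
  then have bij: "bij_betw (enumerate ?R) UNIV ?R" by (rule bij_enumerate)
  define q where "q x = inv_into UNIV (enumerate ?R) (rep x)" for x
  have q_surj: "\<exists>x. ?D x \<and> q x = b" for b
  proof -
    obtain x where "?D x" "enumerate ?R b = rep x" using bij_betwE[OF bij] by blast
    then show ?thesis
      using inv_into_f_f[OF bij_betw_imp_inj_on[OF bij], of b] unfolding q_def by auto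
  qed
  have q_eq: "q x = q y \<longleftrightarrow> ?E x y" if "?D x" "?D y" for x y
  proof -
    have "inj_on (inv_into UNIV (enumerate ?R)) ?R"
      using bij_betw_inv_into[OF bij] by (rule bij_betw_imp_inj_on)
    from inj_on_eq_iff[OF this, of "rep x" "rep y"] show ?thesis
      using that unfolding q_def rep_eq[OF that, symmetric] by simp
  qed
  obtain d where d: "\<And>b. ?D (d b) \<and> q (d b) = b" using q_surj by metis
  obtain z where z: "?D z" "holds M (zero_gr K) [z]" using L(4) by blast
  have "\<forall>x. \<exists>y. ?D x \<longrightarrow> ?D y \<and> ?S x y" using L(7) by blast
  from choice[OF this] obtain s where "\<forall>x. ?D x \<longrightarrow> ?D (s x) \<and> ?S x (s x)" ..
  then have s: "?D (s x)" "?S x (s x)" if "?D x" for x using that by auto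
  define op where "op gr x y = (SOME z. ?D z \<and> holds M gr [x, y, z])" for gr x y
  have op: "?D (op gr x y) \<and> holds M gr [x, y, op gr x y]"
    if "gr = plus_gr K \<or> gr = times_gr K" "?D x" "?D y" for gr x y
    unfolding op_def by (rule someI_ex) (rule L(9)[OF that])
  have D_d: "?D (d b)" for b using d by blast
  have E_d: "?E x (d (q x))" "?E (d (q x)) x" if "?D x" for x
    using q_eq[of x "d (q x)"] q_eq[of "d (q x)" x] that d by auto
  \<comment> \<open>Operations are computed on the chosen representatives d; compatibility with
    \<open>eqv\<close> makes the result the same for all others.\<close>
  define N where "N = \<lparr>zeroS = q z, succS = \<lambda>b. q (s (d b)), plusS = \<lambda>b c. q (op (plus_gr K) (d b) (d c)),
    timesS = \<lambda>b c. q (op (times_gr K) (d b) (d c)), lessS = \<lambda>b c. holds M (less_rel K) [d b, d c],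
    indS = \<lambda>b. holds M (ind_rel K) [d b]\<rparr>"
  interpret interprets M K "language U" q N
  proof
    show "holds M (zero_gr K) [x] \<longleftrightarrow> q x = zeroS N" if "?D x" for x
      using L(5)[of z x] z that q_eq[of z x] by (auto simp: N_def)
    show "?S x y \<longleftrightarrow> q y = succS N (q x)" if "?D x" "?D y" for x y
      using L(8)[of "d (q x)" x "s (d (q x))" y] that d s E_d(2)[of x] q_eq[of "s (d (q x))" y]
      by (auto simp: N_def)
    show "holds M (plus_gr K) [x, y, u] \<longleftrightarrow> q u = plusS N (q x) (q y)" if "?D x" "?D y" "?D u" for x y u
      using L(10)[of "plus_gr K" "d (q x)" x "d (q y)" y "op (plus_gr K) (d (q x)) (d (q y))" u] that d op
        E_d(2)[of x] E_d(2)[of y] q_eq[of "op (plus_gr K) (d (q x)) (d (q y))" u]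
      by (auto simp: N_def)
    show "holds M (times_gr K) [x, y, u] \<longleftrightarrow> q u = timesS N (q x) (q y)" if "?D x" "?D y" "?D u" for x y u
      using L(10)[of "times_gr K" "d (q x)" x "d (q y)" y "op (times_gr K) (d (q x)) (d (q y))" u] that d op
        E_d(2)[of x] E_d(2)[of y] q_eq[of "op (times_gr K) (d (q x)) (d (q y))" u]
      by (auto simp: N_def)
    show "holds M (less_rel K) [x, y] \<longleftrightarrow> lessS N (q x) (q y)" if "?D x" "?D y" for x y
      using L(6)[OF D_d that(1) D_d that(2) E_d(2)[OF that(1)] E_d(2)[OF that(2)]]
        L(6)[OF that(1) D_d that(2) D_d E_d(1)[OF that(1)] E_d(1)[OF that(2)]]
      by (auto simp: N_def)
    show "holds M (ind_rel K) [x] \<longleftrightarrow> indS N (q x)" if "language U = LAI" "?D x" for x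
      using L(11)[OF that(1) D_d that(2) E_d(2)[OF that(2)]] L(11)[OF that D_d E_d(1)[OF that(2)]]
      by (auto simp: N_def)
  qed (use interp_inD[OF K] q_surj q_eq in auto)
  have "models N (axms U)"
    unfolding models_def by (intro ballI allI sem_if_tr U(2) tr)
  then show ?thesis using that interprets_axioms by blast
qed

section \<open>The canonical map into an interpreted model\<close>

text \<open>Only 0 and the successor are required to be preserved, which is what recursion delivers;
  sums and products follow by induction. E is the graph of h as far as M can see it.\<close>

definition canonical where
  "canonical L M K q N h E \<longleftrightarrow> h (zeroS M) = zeroS N \<and> (\<forall>x. h (succS M x) = succS N (h x)) \<and> dfn2 L M E \<and>
     (\<forall>x y. E x y \<longleftrightarrow> holds M (domain K) [y] \<and> q y = h x)"

lemma ex_canonical: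
  assumes M: "models M (PA_axioms L)" and K: "interp_in L' L K" and N: "interprets M K L' q N"
  obtains h E where "canonical L M K q N h E"
proof -
  interpret pa L M by standard (rule M)
  interpret N: interprets M K L' q N by (rule N)
  note K = interp_inD[OF K]
  have dfn: "dfn1 L M (\<lambda>y. N.D y \<and> holds M (zero_gr K) [y])"
    "dfn2 L M (\<lambda>y y'. N.D y \<and> N.D y' \<and> holds M (succ_gr K) [y, y'])"
    "dfn2 L M (\<lambda>y y'. N.D y \<and> N.D y' \<and> holds M (eqv K) [y, y'])"
    using K by (intro dfn_intros dfn1_app[OF dfn_holds1] dfn2_app[OF dfn_holds2]; simp)+
  have Z: "N.D y \<and> holds M (zero_gr K) [y] \<longleftrightarrow> N.D y \<and> q y = zeroS N" for y
    using N.zero_iff by blast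
  have G: "N.D y \<and> N.D y' \<and> holds M (succ_gr K) [y, y'] \<longleftrightarrow> N.D y \<and> N.D y' \<and> q y' = succS N (q y)" for y y'
    using N.succ_iff by blast
  have Q: "N.D y \<and> N.D y' \<and> holds M (eqv K) [y, y'] \<longleftrightarrow> N.D y \<and> N.D y' \<and> q y = q y'" for y y'
    using N.eqv_iff by blast
  show thesis
  proof (rule definable_recursion[OF dfn Z G Q N.surj])
    fix h E
    assume "h \<zero> = zeroS N" "\<And>x. h (succ x) = succS N (h x)" "dfn2 L M E" "\<And>x y. E x y \<longleftrightarrow> N.D y \<and> q y = h x"
    then show thesis by (intro that[of h E]) (simp add: canonical_def)
  qed
qed

text \<open>Inductions in M along the axioms that M and N share. Before each one, the claim about h
  is rewritten, through E and the formulas of K, into a relation between elements of M.\<close>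

lemma canonical_hom:
  assumes M: "models M (PA_axioms L)" and N: "models N (PA_axioms L')"
    and K: "interp_in L' L K" "interprets M K L' q N" and h: "canonical L M K q N h E"
  shows "inj h" "h (plusS M x y) = plusS N (h x) (h y)" "h (timesS M x y) = timesS N (h x) (h y)"
proof -
  interpret M: pa L M by standard (rule M)
  interpret N: pa L' N by standard (rule N)
  interpret K: interprets M K L' q N by (rule K(2))
  have h0: "h (zeroS M) = zeroS N" and hS: "h (succS M x) = succS N (h x)"
    and E: "dfn2 L M E" "E x y \<longleftrightarrow> K.D y \<and> q y = h x" for x y
    using h by (auto simp: canonical_def)
  note gr = interp_inD[OF K(1)]
  have eq: "h x = h y \<longleftrightarrow> (\<exists>u. E x u \<and> E y u)" for x y
    using E(2) K.surj by metis
  have ex_E: "\<exists>u. E x u" for x using E(2) K.surj by blast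
  show "inj h"
  proof (rule injI)
    have "\<forall>y. h x = h y \<longrightarrow> x = y" for x
    proof (rule M.induct1[where P = "\<lambda>x. \<forall>y. h x = h y \<longrightarrow> x = y"])
      show "dfn1 L M (\<lambda>x. \<forall>y. h x = h y \<longrightarrow> x = y)"
        unfolding eq by (intro dfn_intros dfn2_app[OF E(1)])
      show "\<forall>y. h M.zero = h y \<longrightarrow> M.zero = y"
        using M.zero_or_succ h0 hS N.succ_simps(2) by metis
    next
      fix x assume IH: "\<forall>y. h x = h y \<longrightarrow> x = y"
      show "\<forall>y. h (M.succ x) = h y \<longrightarrow> M.succ x = y"
      proof (intro allI impI)
        fix y assume "h (M.succ x) = h y"
        then show "M.succ x = y"
          using M.zero_or_succ[of y] IH by (auto simp: h0 hS)
      qed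
    qed
    then show "h x = h y \<Longrightarrow> x = y" for x y by blast
  qed
  have plus: "h (M.plus x y) = N.plus (h x) (h y) \<longleftrightarrow>
      (\<exists>u v w. E x u \<and> E y v \<and> E (M.plus x y) w \<and> holds M (plus_gr K) [u, v, w])" for x y
  proof
    obtain u v w where "E x u" "E y v" "E (M.plus x y) w" using ex_E by blast
    moreover assume "h (M.plus x y) = N.plus (h x) (h y)"
    ultimately show "\<exists>u v w. E x u \<and> E y v \<and> E (M.plus x y) w \<and> holds M (plus_gr K) [u, v, w]"
      using K.plus_iff[of u v w] E(2) by auto
  next
    assume "\<exists>u v w. E x u \<and> E y v \<and> E (M.plus x y) w \<and> holds M (plus_gr K) [u, v, w]"
    then show "h (M.plus x y) = N.plus (h x) (h y)" using K.plus_iff E(2) by auto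
  qed
  have "\<forall>x. h (M.plus x y) = N.plus (h x) (h y)" for y
  proof (rule M.induct1[where P = "\<lambda>y. \<forall>x. h (M.plus x y) = N.plus (h x) (h y)"])
    show "dfn1 L M (\<lambda>y. \<forall>x. h (M.plus x y) = N.plus (h x) (h y))"
      unfolding plus by (intro dfn_intros dfn2_app[OF E(1)] dfn3_app[OF dfn_holds3] gr)
  qed (simp_all add: h0 hS)
  then show add: "h (M.plus x y) = N.plus (h x) (h y)" for x y by blast
  have times: "h (M.times x y) = N.times (h x) (h y) \<longleftrightarrow>
      (\<exists>u v w. E x u \<and> E y v \<and> E (M.times x y) w \<and> holds M (times_gr K) [u, v, w])" for x y
  proof
    obtain u v w where "E x u" "E y v" "E (M.times x y) w" using ex_E by blast
    moreover assume "h (M.times x y) = N.times (h x) (h y)"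
    ultimately show "\<exists>u v w. E x u \<and> E y v \<and> E (M.times x y) w \<and> holds M (times_gr K) [u, v, w]"
      using K.times_iff[of u v w] E(2) by auto
  next
    assume "\<exists>u v w. E x u \<and> E y v \<and> E (M.times x y) w \<and> holds M (times_gr K) [u, v, w]"
    then show "h (M.times x y) = N.times (h x) (h y)" using K.times_iff E(2) by auto
  qed
  have "\<forall>x. h (M.times x y) = N.times (h x) (h y)" for y
  proof (rule M.induct1[where P = "\<lambda>y. \<forall>x. h (M.times x y) = N.times (h x) (h y)"])
    show "dfn1 L M (\<lambda>y. \<forall>x. h (M.times x y) = N.times (h x) (h y))"
      unfolding times by (intro dfn_intros dfn2_app[OF E(1)] dfn3_app[OF dfn_holds3] gr)
  qed (simp_all add: h0 hS add M.mult_succ N.mult_succ)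
  then show "h (M.times x y) = N.times (h x) (h y)" by blast
qed

text \<open>The map h need not respect I, hence the restriction on p. It suffices for carrying a
  definition of I that is free of I from M to N.\<close>

lemma sem_isomorphism:
  assumes h: "bij h" "h (zeroS M) = zeroS N" "\<And>x. h (succS M x) = succS N (h x)"
    "\<And>x y. h (plusS M x y) = plusS N (h x) (h y)" "\<And>x y. h (timesS M x y) = timesS N (h x) (h y)"
    "\<And>x y. lessS M x y \<longleftrightarrow> lessS N (h x) (h y)"
    and "ind_free p"
  shows "sem M \<rho> p \<longleftrightarrow> sem N (\<lambda>i. h (\<rho> i)) p"
proof -
  have t: "h (tval M \<rho> t) = tval N (\<lambda>i. h (\<rho> i)) t" for \<rho> t
    by (induction t) (simp_all add: h)
  have eq: "h x = h y \<longleftrightarrow> x = y" for x y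
    using h(1) by (metis bij_is_inj injD)
  show ?thesis
    using \<open>ind_free p\<close>
  proof (induction p arbitrary: \<rho>)
    case (Ex p)
    have push: "(\<lambda>i. h (case_nat x \<rho> i)) = case_nat (h x) (\<lambda>i. h (\<rho> i))" for x
      by (auto simp: fun_eq_iff split: nat.split)
    have "sem M \<rho> (Ex p) \<longleftrightarrow> (\<exists>x. sem N (case_nat (h x) (\<lambda>i. h (\<rho> i))) p)"
      using Ex by (simp add: push)
    also have "\<dots> \<longleftrightarrow> (\<exists>y. sem N (case_nat y (\<lambda>i. h (\<rho> i))) p)"
      using h(1) by (metis bij_is_surj surjD)
    finally show ?case by simp
  qed (simp_all add: t[symmetric] eq h(6))
qed

section \<open>Indiscernibles are not definable\<close>

text \<open>A common weakening of the indiscernibility schemes: c is the code of p for \<^const>\<open>PAI_circ\<close> and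
  arbitrary otherwise. Only the first \<open>max 1 (fbound p)\<close> entries of the sequences matter.\<close>

definition indiscernible :: "'a struct \<Rightarrow> bool" where
  "indiscernible N \<longleftrightarrow> (\<forall>p. ind_free p \<longrightarrow> (\<exists>c. \<forall>s t.
     (\<forall>i. indS N (s i) \<and> lessS N (s i) (s (Suc i))) \<and> (\<forall>i. indS N (t i) \<and> lessS N (t i) (t (Suc i))) \<and>
     lessS N c (s 0) \<and> lessS N c (t 0) \<longrightarrow> (sem N s p \<longleftrightarrow> sem N t p)))"

lemma sem_conj_list: "sem M \<rho> (conj_list ps) \<longleftrightarrow> (\<forall>p\<in>set ps. sem M \<rho> p)"
  by (induction ps) auto

lemma sem_increasing:
  "sem M \<rho> (increasing k n) \<longleftrightarrow>
   (\<forall>i<n. indS M (\<rho> (k + i))) \<and> (\<forall>i<n - 1. lessS M (\<rho> (k + i)) (\<rho> (k + Suc i)))"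
  unfolding increasing_def by (auto simp: sem_conj_list)

lemma models_indiscernible:
  assumes "U \<in> {PAI_circ, PAI, PAI_alpha}" "models N (axms U)"
  shows "models N (PA_axioms LAI)" "\<exists>y. lessS N x y \<and> indS N y" "indiscernible N"
proof -
  show "models N (PA_axioms LAI)"
    using assms by (auto simp: models_def PAI_alpha_def PAI_def PAI_circ_def)
  have "sem N \<rho> ind_unbounded" for \<rho>
    using assms by (auto simp: models_def PAI_alpha_def PAI_def PAI_circ_def)
  then show "\<exists>y. lessS N x y \<and> indS N y"
    by (simp add: ind_unbounded_def fb_defs)
  show "indiscernible N"
    unfolding indiscernible_def
  proof (intro allI impI)
    fix p assume "ind_free p"
    then have p: "in_lang LA p" by (simp add: in_lang_def)
    \<comment> \<open>The schemes speak of nonempty tuples only, so a sentence p gets one dummy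
      variable.\<close>
    let ?n = "max 1 (fbound p)"
    have "indisc ?n p \<in> axms PAI"
      unfolding PAI_def by (simp, intro disjI2 exI[of _ ?n] exI[of _ p]) (use p in simp)
    moreover have "indisc_above_code ?n p \<in> axms PAI_circ"
      unfolding PAI_circ_def by (simp, intro disjI2 exI[of _ ?n] exI[of _ p]) (use p in simp)
    ultimately have "indisc ?n p \<in> axms U \<or> indisc_above_code ?n p \<in> axms U"
      using assms(1) by (auto simp: PAI_alpha_def)
    then have cases: "(\<forall>\<rho>. sem N \<rho> (indisc ?n p)) \<or> (\<forall>\<rho>. sem N \<rho> (indisc_above_code ?n p))"
      using assms(2) unfolding models_def by blast
    have *: "sem N \<rho> p \<longleftrightarrow> sem N (\<lambda>i. \<rho> (?n + i)) p"
      if that: "sem N \<rho> (increasing 0 ?n)" "sem N \<rho> (increasing ?n ?n)"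
        "lessS N (tval N \<rho> (num (fcode p))) (\<rho> 0)" "lessS N (tval N \<rho> (num (fcode p))) (\<rho> ?n)" for \<rho>
      using cases
    proof
      assume "\<forall>\<rho>. sem N \<rho> (indisc ?n p)"
      then show ?thesis using that unfolding indisc_def sem_closure by (simp add: sem_fsub) blast
    next
      assume "\<forall>\<rho>. sem N \<rho> (indisc_above_code ?n p)"
      then show ?thesis using that unfolding indisc_above_code_def sem_closure by (simp add: sem_fsub) blast
    qed
    have num: "tval N \<rho> (num k) = (succS N ^^ k) (zeroS N)" for \<rho> k by (induction k) auto
    show "\<exists>c. \<forall>s t. (\<forall>i. indS N (s i) \<and> lessS N (s i) (s (Suc i))) \<and>
        (\<forall>i. indS N (t i) \<and> lessS N (t i) (t (Suc i))) \<and> lessS N c (s 0) \<and> lessS N c (t 0) \<longrightarrow>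
        (sem N s p \<longleftrightarrow> sem N t p)"
    proof (intro exI[of _ "(succS N ^^ fcode p) (zeroS N)"] allI impI, elim conjE)
      fix s t
      assume st: "\<forall>i. indS N (s i) \<and> lessS N (s i) (s (Suc i))" "\<forall>i. indS N (t i) \<and> lessS N (t i) (t (Suc i))"
        "lessS N ((succS N ^^ fcode p) (zeroS N)) (s 0)" "lessS N ((succS N ^^ fcode p) (zeroS N)) (t 0)"
      \<comment> \<open>One assignment holds both tuples side by side, as the schemes expect;
        \<open>?n\<close> is the position where t begins.\<close>
      let ?\<rho> = "\<lambda>i. if i < ?n then s i else t (i - ?n)"
      have "sem N s p \<longleftrightarrow> sem N ?\<rho> p" by (rule sem_cong) auto
      also have "\<dots> \<longleftrightarrow> sem N (\<lambda>i. ?\<rho> (?n + i)) p"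
        by (rule *) (use st in \<open>auto simp: sem_increasing num\<close>)
      finally show "sem N s p \<longleftrightarrow> sem N t p" by simp
    qed
  qed
qed

text \<open>Otherwise I has a definition in M, hence by isomorphism one in N that does not mention I. Then
  so has the relation ``x and y are consecutive elements of I'', but for consecutive
  \<open>x\<^sub>0 < x\<^sub>1 < x\<^sub>2\<close> it holds of \<open>(x\<^sub>0, x\<^sub>1)\<close> and not of \<open>(x\<^sub>0, x\<^sub>2)\<close>.\<close>

lemma canonical_not_surj:
  assumes M: "models M (PA_axioms LA)" and N: "models N (PA_axioms LAI)"
    and unbounded: "\<And>x. \<exists>y. lessS N x y \<and> indS N y" and indisc: "indiscernible N"
    and K: "interp_in LAI LA K" "interprets M K LAI q N" and h: "canonical LA M K q N h E"
  shows "\<not> surj h"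
proof
  assume surj: "surj h"
  interpret M: pa LA M by standard (rule M)
  interpret N: pa LAI N by standard (rule N)
  interpret K: interprets M K LAI q N by (rule K(2))
  note hom = canonical_hom[OF M N K h]
  have h0: "h (zeroS M) = zeroS N" and hS: "h (succS M x) = succS N (h x)"
    and E: "dfn2 LA M E" "E x y \<longleftrightarrow> K.D y \<and> q y = h x" for x y
    using h by (auto simp: canonical_def)
  \<comment> \<open>The order is defined from addition, and surjectivity supplies a preimage of the
    witness.\<close>
  have less: "M.less x y \<longleftrightarrow> N.less (h x) (h y)" for x y
  proof -
    have "M.less x y \<longleftrightarrow> (\<exists>z. h (M.plus x (M.succ z)) = h y)"
      unfolding M.less_iff using hom(1) by (metis injD)
    also have "\<dots> \<longleftrightarrow> (\<exists>z. N.plus (h x) (N.succ (h z)) = h y)"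
      by (simp only: hom(2) hS)
    also have "\<dots> \<longleftrightarrow> N.less (h x) (h y)"
      unfolding N.less_iff using surj by (metis surjD)
    finally show ?thesis .
  qed
  note iso = sem_isomorphism[OF bijI[OF hom(1) surj] h0 hS hom(2,3) less]
  have "indS N (h x) \<longleftrightarrow> (\<exists>u. E x u \<and> holds M (ind_rel K) [u])" for x
    using E(2) K.surj[of "h x"] K.ind_iff by auto
  moreover have "dfn1 LA M (\<lambda>x. \<exists>u. E x u \<and> holds M (ind_rel K) [u])"
    by (intro dfn_intros dfn2_app[OF E(1)] dfn1_app[OF dfn_holds1] interp_inD(8,16)[OF K(1)]) simp_all
  ultimately have ind: "dfn1 LA M (\<lambda>x. indS N (h x))" by simp
  let ?next = "\<lambda>x y. M.less x y \<and> indS N (h y) \<and> (\<forall>z. M.less x z \<and> M.less z y \<longrightarrow> \<not> indS N (h z))"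
  have "dfn2 LA M ?next"
    by (intro dfn_intros dfn1_app[OF ind])
  then obtain p where p: "in_lang LA p" "\<And>\<rho>. ?next (\<rho> 0) (\<rho> (Suc 0)) \<longleftrightarrow> sem M \<rho> p"
    by (rule dfnE) blast
  have free: "ind_free p" using p(1) by (simp add: in_lang_def)
  obtain h' where h': "\<And>y. h (h' y) = y" using surj by (metis surjD)
  have h'_h: "h' (h x) = x" for x using hom(1) h' by (metis injD)
  have sem: "sem N s p \<longleftrightarrow> ?next (h' (s 0)) (h' (s (Suc 0)))" for s
    using iso[OF free, of "\<lambda>i. h' (s i)"] p(2)[of "\<lambda>i. h' (s i)"] by (simp add: h')
  from indisc[unfolded indiscernible_def, THEN spec, THEN mp, OF free]
  obtain c where c: "\<forall>s t. (\<forall>i. indS N (s i) \<and> N.less (s i) (s (Suc i))) \<and>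
      (\<forall>i. indS N (t i) \<and> N.less (t i) (t (Suc i))) \<and> N.less c (s 0) \<and> N.less c (t 0) \<longrightarrow>
      (sem N s p \<longleftrightarrow> sem N t p)" ..
  obtain nx where nx: "\<And>x. N.less x (nx x)" "\<And>x. indS N (nx x)"
    using unbounded by metis
  \<comment> \<open>The image of a is an element of I above c, so sequences starting there are
    subject to indiscernibility for p.\<close>
  define a where "a = h' (nx c)"
  have a: "h a = nx c" by (simp add: a_def h')
  have dfn: "dfn2 LA M (\<lambda>y x. M.less x y \<and> indS N (h y))"
    by (intro dfn_intros dfn1_app[OF ind])
  \<comment> \<open>I is unbounded in N, so its preimage has an element above a; as the preimage is
    definable in M, it has a least such element b.\<close>
  have "M.less a (h' (nx (h a))) \<and> indS N (h (h' (nx (h a))))"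
    unfolding less h' using nx by blast
  from M.least[OF dfn this]
  obtain b where b: "M.less a b" "indS N (h b)" and least: "\<And>z. M.less z b \<Longrightarrow> \<not> (M.less a z \<and> indS N (h z))"
    by blast
  \<comment> \<open>For k = 0 the sequence starts h a, h b; for k = 1 it omits h b. From then on
    both just climb in I.\<close>
  let ?s = "\<lambda>k. case_nat (h a) (\<lambda>j. (nx ^^ (k + j)) (h b))"
  have s: "indS N (?s k i)" "N.less (?s k i) (?s k (Suc i))" for k i
  proof -
    have "indS N ((nx ^^ j) (h b))" for j using b nx by (cases j) auto
    then show "indS N (?s k i)" using a nx by (auto split: nat.split)
    have "N.less (h a) ((nx ^^ j) (h b))" for j
      using b(1) nx(1) N.less_trans unfolding less by (induction j) auto
    then show "N.less (?s k i) (?s k (Suc i))" using nx(1) by (auto split: nat.split)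
  qed
  have "sem N (?s 0) p \<longleftrightarrow> sem N (?s 1) p"
    by (rule c[THEN spec, THEN spec, THEN mp]) (intro conjI allI s, simp_all add: a nx)
  moreover have "sem N (?s 0) p"
    unfolding sem using b least by (simp add: h'_h)
  moreover have "\<not> sem N (?s 1) p"
    unfolding sem using b nx(1) less by (auto simp: h'_h h')
  ultimately show False by blast
qed

section \<open>Retracts\<close>

lemma (in interprets) holds_tr:
  assumes "in_lang L p" "fbound p \<le> length xs" "\<And>x. x \<in> set xs \<Longrightarrow> D x" "fbound (tr K p) \<le> fbound p"
  shows "holds M (tr K p) xs \<longleftrightarrow> holds N p (map q xs)"
proof -
  let ?\<rho> = "\<lambda>i. if i < length xs then xs ! i else zeroS M"
  have "holds M (tr K p) xs \<longleftrightarrow> sem N (\<lambda>i. q (?\<rho> i)) p"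
    unfolding holds_def by (rule sem_tr) (use assms in auto)
  also have "\<dots> \<longleftrightarrow> holds N p (map q xs)"
    by (rule holds_eq_sem[symmetric]) (use assms in auto)
  finally show ?thesis .
qed

text \<open>Relations definable in the interpreted model become definable in M by translation. This
  is how the graph of the second canonical map can occur in an induction formula of M.\<close>

lemma dfn2_pullback:
  assumes N: "interprets M K L' q N" and K: "interp_in L' L K" and R: "dfn2 L' N R"
  obtains R' where "dfn2 L M R'" "\<And>x y. R' x y \<longleftrightarrow> holds M (domain K) [x] \<and> holds M (domain K) [y] \<and> R (q x) (q y)"
proof -
  interpret interprets M K L' q N by (rule N)
  obtain p where p: "in_lang L' p" "\<And>\<rho>. R (\<rho> 0) (\<rho> (Suc 0)) \<longleftrightarrow> sem N \<rho> p"
    using R by (rule dfnE) blast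
  have "dfn L M (\<lambda>\<rho>. sem M \<rho> (tr K p))"
    using in_lang_tr[OF K p(1)] by (rule dfnI) simp
  \<comment> \<open>The formula p may have further free indices, and correctness of the translation
    wants their values in the domain, so all of them are set to y.\<close>
  from dfn_subst[OF this, of "case_nat (\<lambda>\<rho>. \<rho> 0) (\<lambda>i \<rho>. \<rho> (Suc 0))"]
  have "dfn L M (\<lambda>\<rho>. sem M (\<lambda>i. case_nat (\<lambda>\<rho>. \<rho> 0) (\<lambda>i \<rho>. \<rho> (Suc 0)) i \<rho>) (tr K p))"
    by (simp add: dtm_Var split: nat.split)
  moreover have "(\<lambda>i. case_nat (\<lambda>\<rho>. \<rho> 0) (\<lambda>i \<rho>. \<rho> (Suc 0)) i \<rho>) = case_nat (\<rho> 0) (\<lambda>i. \<rho> (Suc 0))"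
    for \<rho> :: "nat \<Rightarrow> 'a"
    by (auto simp: fun_eq_iff split: nat.split)
  ultimately have tr: "dfn2 L M (\<lambda>x y. sem M (case_nat x (\<lambda>i. y)) (tr K p))" by simp
  show thesis
  proof (rule that[of "\<lambda>x y. D x \<and> D y \<and> sem M (case_nat x (\<lambda>i. y)) (tr K p)"])
    show "dfn2 L M (\<lambda>x y. D x \<and> D y \<and> sem M (case_nat x (\<lambda>i. y)) (tr K p))"
      by (intro dfn_intros tr dfn1_app[OF dfn_holds1] interp_inD(1,9)[OF K])
    have "sem M (case_nat x (\<lambda>i. y)) (tr K p) \<longleftrightarrow> R (q x) (q y)" if "D x" "D y" for x y
      using sem_tr[OF p(1), of "case_nat x (\<lambda>i. y)"] p(2)[of "\<lambda>i. q (case_nat x (\<lambda>i. y) i)"] that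
      by (simp split: nat.split)
    then show "D x \<and> D y \<and> sem M (case_nat x (\<lambda>i. y)) (tr K p) \<longleftrightarrow> D x \<and> D y \<and> R (q x) (q y)" for x y
      by blast
  qed
qed

lemma interp_in_icomp:
  assumes I: "interp_in L L' I" and J: "interp_in L' L J"
  shows "interp_in L L (icomp I J)"
proof -
  have tr: "fbound p \<le> n \<Longrightarrow> in_lang L' p \<Longrightarrow> in_lang L (tr J p) \<and> fbound (tr J p) \<le> n" for p n
    using in_lang_tr[OF J] fbound_tr[OF J] le_trans by blast
  show ?thesis
    unfolding interp_in_def icomp_def using interp_inD[OF I] interp_inD[OF J] tr by (auto split: if_splits)
qed

lemma iso_sentenceD:
  assumes K: "interp_in L L' K" and F: "fbound F \<le> 2" and iso: "sem M \<rho> (iso_sentence L K F)"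
  shows "holds M F [x, y] \<Longrightarrow> holds M (domain K) [y]"
    and "\<exists>y. holds M F [x, y]"
    and "holds M (domain K) [y] \<Longrightarrow> \<exists>x. holds M F [x, y]"
    and "holds M F [x, y] \<Longrightarrow> holds M F [x', y'] \<Longrightarrow> x = x' \<longleftrightarrow> holds M (eqv K) [y, y']"
    and "holds M F [x, y] \<Longrightarrow> zeroS M = x \<longleftrightarrow> holds M (zero_gr K) [y]"
    and "holds M F [x, y] \<Longrightarrow> holds M F [x', y'] \<Longrightarrow> succS M x = x' \<longleftrightarrow> holds M (succ_gr K) [y, y']"
proof -
  note bd = interp_inD[OF K, unfolded One_nat_def numeral_2_eq_2 numeral_3_eq_3] F[unfolded numeral_2_eq_2]
  have And: "sem M \<rho> (And p q) \<longleftrightarrow> sem M \<rho> p \<and> sem M \<rho> q" for p q by simp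
  note c1 = iso[unfolded iso_sentence_def fb_defs And]
  note c2 = c1[THEN conjunct2]
  note c3 = c2[THEN conjunct2]
  note c5 = c3[THEN conjunct2, THEN conjunct2]
  note c6 = c5[THEN conjunct2]
  note c7 = c6[THEN conjunct2]
  show "holds M F [x, y] \<Longrightarrow> holds M (domain K) [y]"
    using c1[THEN conjunct1] by (simp (no_asm_use) add: sem_app bd(1-7,17)) blast
  show "\<exists>y. holds M F [x, y]"
    using c2[THEN conjunct1] by (simp (no_asm_use) add: sem_app bd(1-7,17)) blast
  show "holds M (domain K) [y] \<Longrightarrow> \<exists>x. holds M F [x, y]"
    using c3[THEN conjunct1] by (simp (no_asm_use) add: sem_app bd(1-7,17)) blast
  show "holds M F [x, y] \<Longrightarrow> holds M F [x', y'] \<Longrightarrow> x = x' \<longleftrightarrow> holds M (eqv K) [y, y']"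
    using c5[THEN conjunct1] by (simp (no_asm_use) add: sem_app bd(1-7,17)) blast
  show "holds M F [x, y] \<Longrightarrow> zeroS M = x \<longleftrightarrow> holds M (zero_gr K) [y]"
    using c6[THEN conjunct1] by (simp (no_asm_use) add: sem_app bd(1-7,17)) blast
  show "holds M F [x, y] \<Longrightarrow> holds M F [x', y'] \<Longrightarrow> succS M x = x' \<longleftrightarrow> holds M (succ_gr K) [y, y']"
    using c7[THEN conjunct1] by (simp (no_asm_use) add: sem_app bd(1-7,17)) blast
qed

text \<open>The composition of the canonical maps and the isomorphism f are both homomorphisms for 0 and the
  successor. Their agreement is definable in M, so they agree by induction.\<close>

lemma canonical_maps_surj:
  assumes models: "models M (PA_axioms L)" "models N1 (PA_axioms L')" "models N2 (PA_axioms L)"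
    and J: "interp_in L' L J" "interprets M J L' q1 N1" and I: "interp_in L L' I" "interprets N1 I L q2 N2"
    and h1: "canonical L M J q1 N1 h1 E1" and h2: "canonical L' N1 I q2 N2 h2 E2"
    and F: "in_lang L F" "fbound F \<le> 2" "sem M \<rho> (iso_sentence L (icomp I J) F)"
  shows "surj h1 \<and> surj h2"
proof -
  interpret M: pa L M by standard (rule models)
  interpret J: interprets M J L' q1 N1 by (rule J(2))
  interpret I: interprets N1 I L q2 N2 by (rule I(2))
  let ?K = "icomp I J"
  note iso = iso_sentenceD[OF interp_in_icomp[OF I(1) J(1)] F(2,3)]
  have tr: "holds M (tr J p) xs \<longleftrightarrow> holds N1 p (map q1 xs)"
    if "in_lang L' p" "fbound p \<le> length xs" "\<And>x. x \<in> set xs \<Longrightarrow> J.D x" for p xs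
    by (rule J.holds_tr) (use that fbound_tr[OF J(1)] in auto)
  note bI = interp_inD[OF I(1)]
  have dom: "holds M (domain ?K) [y] \<longleftrightarrow> J.D y \<and> I.D (q1 y)" for y
  proof -
    have "holds M (domain ?K) [y] \<longleftrightarrow> J.D y \<and> holds M (tr J (domain I)) [y]"
      by (simp add: icomp_def holds_def)
    then show ?thesis using tr[of "domain I" "[y]"] bI by auto
  qed
  have D: "J.D y" "I.D (q1 y)" if "holds M F [x, y]" for x y
    using iso(1)[OF that] dom by auto
  \<comment> \<open>F relates x to a whole class of the composite interpretation; q2 after q1
    collapses the class to one element of N2, so the choice is immaterial.\<close>
  define f where "f x = q2 (q1 (SOME y. holds M F [x, y]))" for x
  have f: "q2 (q1 y) = f x" if "holds M F [x, y]" for x y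
  proof -
    have y': "holds M F [x, SOME y. holds M F [x, y]]" using that by (rule someI)
    then have "holds M (eqv ?K) [y, SOME y. holds M F [x, y]]" using iso(4)[OF that] by blast
    then show ?thesis
      unfolding f_def using tr[of "eqv I" "[y, SOME y. holds M F [x, y]]"] D that y' I.eqv_iff bI
      by (auto simp: icomp_def)
  qed
  have f0: "f (zeroS M) = zeroS N2"
  proof -
    obtain y where y: "holds M F [zeroS M, y]" using iso(2) by blast
    then have "holds M (zero_gr ?K) [y]" using iso(5) by blast
    then show ?thesis
      using tr[of "zero_gr I" "[y]"] D[OF y] I.zero_iff f[OF y] bI by (auto simp: icomp_def)
  qed
  have fS: "f (succS M x) = succS N2 (f x)" for x
  proof -
    obtain y y' where y: "holds M F [x, y]" "holds M F [succS M x, y']" using iso(2) by blast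
    then have "holds M (succ_gr ?K) [y, y']" using iso(6) by blast
    then show ?thesis
      using tr[of "succ_gr I" "[y, y']"] D[OF y(1)] D[OF y(2)] I.succ_iff f[OF y(1)] f[OF y(2)] bI
      by (auto simp: icomp_def)
  qed
  have h1': "h1 (zeroS M) = zeroS N1" "h1 (succS M x) = succS N1 (h1 x)"
    "dfn2 L M E1" "E1 x y \<longleftrightarrow> J.D y \<and> q1 y = h1 x" for x y
    using h1 by (auto simp: canonical_def)
  have h2': "h2 (zeroS N1) = zeroS N2" "h2 (succS N1 x) = succS N2 (h2 x)"
    "dfn2 L' N1 E2" "E2 x y \<longleftrightarrow> I.D y \<and> q2 y = h2 x" for x y
    using h2 by (auto simp: canonical_def)
  obtain R where R: "dfn2 L M R" "\<And>x y. R x y \<longleftrightarrow> J.D x \<and> J.D y \<and> E2 (q1 x) (q1 y)"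
    using dfn2_pullback[OF J(2,1) h2'(3)] by blast
  \<comment> \<open>Agreement at x, seen in M: y represents h1 x, and w, a representative of its
    image under h2, lies in the class that F assigns to x.\<close>
  have eq: "h2 (h1 x) = f x \<longleftrightarrow> (\<exists>y w. E1 x y \<and> R y w \<and> holds M F [x, w])" for x
  proof
    obtain y where y: "J.D y" "q1 y = h1 x" using J.surj by blast
    obtain w where w: "holds M F [x, w]" using iso(2) by blast
    assume "h2 (h1 x) = f x"
    then have "E1 x y \<and> R y w \<and> holds M F [x, w]"
      using y w D[OF w] f[OF w] by (simp add: h1'(4) h2'(4) R(2))
    then show "\<exists>y w. E1 x y \<and> R y w \<and> holds M F [x, w]" by blast
  next
    assume "\<exists>y w. E1 x y \<and> R y w \<and> holds M F [x, w]"
    then show "h2 (h1 x) = f x" using f by (auto simp: h1'(4) h2'(4) R(2))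
  qed
  have comp: "h2 (h1 x) = f x" for x
  proof (rule M.induct1[where P = "\<lambda>x. h2 (h1 x) = f x"])
    show "dfn1 L M (\<lambda>x. h2 (h1 x) = f x)"
      unfolding eq by (intro dfn_intros dfn2_app[OF h1'(3)] dfn2_app[OF R(1)] dfn2_app[OF dfn_holds2] F)
  qed (simp_all add: f0 fS h1' h2')
  have f_surj: "\<exists>x. f x = c" for c
  proof -
    obtain b where b: "I.D b" "q2 b = c" using I.surj by blast
    obtain y where y: "J.D y" "q1 y = b" using J.surj by blast
    obtain x where "holds M F [x, y]" using iso(3) dom b y by blast
    from f[OF this] show ?thesis using b y by auto
  qed
  have "surj h2" unfolding surj_def using f_surj comp by metis
  \<comment> \<open>For any b there is x with h2 (h1 x) = f x = h2 b, and h2 is injective.\<close>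
  moreover have "surj h1" unfolding surj_def
    using f_surj comp canonical_hom(1)[OF models(2,3) I h2] by (metis injD)
  ultimately show ?thesis by blast
qed

section \<open>The standard model and the conclusion\<close>

definition nat_struct :: "nat struct" where
  "nat_struct = \<lparr>zeroS = 0, succS = Suc, plusS = (+), timesS = (*), lessS = (<), indS = \<lambda>x. False\<rparr>"

text \<open>Induction over nat in HOL covers every formula, whatever set interprets I.\<close>

lemma models_nat_struct: "models nat_struct (PA_axioms L)"
proof -
  have "sem nat_struct \<rho> (induction p)" for \<rho> p
  proof -
    have "\<forall>\<rho>. sem nat_struct \<rho> (induction p)"
      unfolding sem_induction
    proof (intro allI impI)
      fix \<rho> x
      assume "sem nat_struct (case_nat (zeroS nat_struct) \<rho>) p"
        "\<forall>x. sem nat_struct (case_nat x \<rho>) p \<longrightarrow> sem nat_struct (case_nat (succS nat_struct x) \<rho>) p"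
      then show "sem nat_struct (case_nat x \<rho>) p"
        by (induction x) (auto simp: nat_struct_def)
    qed
    then show ?thesis by blast
  qed
  then show ?thesis
    unfolding models_def PA_axioms_def
    by (auto simp: fb_defs nat_struct_def less_iff_Suc_add)
qed

theorem theorem5p6:
  fixes U :: thy
  assumes "U \<in> {PAI_circ, PAI, PAI_alpha}"
  shows "\<not> retract PA U \<and> \<not> retract U PA \<and> \<not> bi_interpretable PA U"
proof -
  have lang: "language U = LAI" "language PA = LA"
    using assms by (auto simp: PA_def PAI_circ_def PAI_def PAI_alpha_def)
  have U: "PA_axioms (language U) \<subseteq> axms U" "in_lang (language U) p" for p
    using assms by (auto simp: PAI_circ_def PAI_def PAI_alpha_def in_lang_def)
  have PA: "PA_axioms (language PA) \<subseteq> axms PA" "p \<in> axms PA \<Longrightarrow> in_lang (language PA) p" for p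
    using in_lang_PA_axioms by (auto simp: PA_def)
  have nat: "models nat_struct (axms PA)" using models_nat_struct by (simp add: PA_def)
  note UD = models_indiscernible[OF assms]
  have not_surj: "\<not> surj h"
    if "models M (axms PA)" "models N (axms U)" "interp_in LAI LA K" "interprets M K LAI q N"
      "canonical LA M K q N h E" for M N K h E and q :: "nat \<Rightarrow> nat"
    by (rule canonical_not_surj[OF _ UD[OF that(2)] that(3-5)]) (use that(1) in \<open>simp add: PA_def\<close>)
  have 1: "\<not> retract PA U"
  proof
    assume "retract PA U"
    then obtain I J F where I: "interpretation_of_in I PA U" and J: "interpretation_of_in J U PA"
      and F: "defines_iso PA (icomp I J) F" unfolding retract_def by blast
    obtain q1 and N1 :: "nat struct" where N1: "interprets nat_struct J (language U) q1 N1" "models N1 (axms U)"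
      by (rule ex_interpreted_structure[OF J nat U])
    obtain q2 and N2 :: "nat struct" where N2: "interprets N1 I (language PA) q2 N2" "models N2 (axms PA)"
      by (rule ex_interpreted_structure[OF I N1(2) PA])
    have in_I: "interp_in LA LAI I" and in_J: "interp_in LAI LA J"
      using I J lang by (auto simp: interpretation_of_in_def)
    have m: "models nat_struct (PA_axioms LA)" "models N1 (PA_axioms LAI)" "models N2 (PA_axioms LA)"
      using nat UD(1)[OF N1(2)] N2(2) by (auto simp: PA_def)
    obtain h1 E1 where h1: "canonical LA nat_struct J q1 N1 h1 E1"
      using ex_canonical[OF m(1) in_J] N1(1) lang by metis
    obtain h2 E2 where h2: "canonical LAI N1 I q2 N2 h2 E2"
      using ex_canonical[OF m(2) in_I] N2(1) lang by metis
    \<comment> \<open>Here h1 leads from the standard model of PA to the model N1 of U interpreted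
      in it.\<close>
    have "surj h1"
      using canonical_maps_surj[OF m in_J _ in_I _ h1 h2, of F] N1(1) N2(1) F
        models_provable[OF nat] lang by (auto simp: defines_iso_def)
    then show False
      using not_surj[OF nat N1(2) in_J _ h1] N1(1) lang by simp
  qed
  have 2: "\<not> retract U PA"
  proof
    assume "retract U PA"
    then obtain I J F where I: "interpretation_of_in I U PA" and J: "interpretation_of_in J PA U"
      and F: "defines_iso U (icomp I J) F" unfolding retract_def by blast
    obtain q and M :: "nat struct" where "interprets nat_struct I (language U) q M" and M: "models M (axms U)"
      by (rule ex_interpreted_structure[OF I nat U])
    obtain q1 and N1 :: "nat struct" where N1: "interprets M J (language PA) q1 N1" "models N1 (axms PA)"
      by (rule ex_interpreted_structure[OF J M PA])
    obtain q2 and N2 :: "nat struct" where N2: "interprets N1 I (language U) q2 N2" "models N2 (axms U)"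
      by (rule ex_interpreted_structure[OF I N1(2) U])
    have in_I: "interp_in LAI LA I" and in_J: "interp_in LA LAI J"
      using I J lang by (auto simp: interpretation_of_in_def)
    have m: "models M (PA_axioms LAI)" "models N1 (PA_axioms LA)" "models N2 (PA_axioms LAI)"
      using UD(1)[OF M] UD(1)[OF N2(2)] N1(2) by (auto simp: PA_def)
    obtain h1 E1 where h1: "canonical LAI M J q1 N1 h1 E1"
      using ex_canonical[OF m(1) in_J] N1(1) lang by metis
    obtain h2 E2 where h2: "canonical LA N1 I q2 N2 h2 E2"
      using ex_canonical[OF m(2) in_I] N2(1) lang by metis
    \<comment> \<open>Here it is h2 that leads from a model of PA, namely N1, to the model N2 of U
      interpreted in it.\<close>
    have "surj h2"
      using canonical_maps_surj[OF m in_J _ in_I _ h1 h2, of F] N1(1) N2(1) F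
        models_provable[OF M] lang by (auto simp: defines_iso_def)
    then show False
      using not_surj[OF N1(2) N2(2) in_I _ h2] N2(1) lang by simp
  qed
  have "\<not> bi_interpretable PA U"
    using 1 unfolding bi_interpretable_def retract_def by blast
  then show ?thesis using 1 2 by blast
qed

end
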